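(* Let $N\ge 2$ be arbitrary, let $\alpha_1,\dots,\alpha_N,\beta_1,\dots,\beta_N>0$ satisfy $\min_{1\le j\le N}\beta_j\ \ge\ \max_{1\le j\le N}\alpha_j\ \ge\ 1$, and let $a_j,b_j\ge 0$ for $j=1,\dots,N$ be arbitrary. Then, up to the action by the modular group, $$\operatorname*{arg\,max}_{z\in\mathbb{H}}\ \frac{\sum_{j=1}^N b_j\,\theta(\beta_j,z)}{\sum_{j=1}^N a_j\,\theta(\alpha_j,z)}=e^{i\frac{\pi}{3}}.$$
   Context: $\mathbb{H}=\{z\in\mathbb{C}:\operatorname{Im}(z)>0\}$. For $\alpha>0$ and $z\in\mathbb{H}$, $$\theta(\alpha,z)=\sum_{(m,n)\in\mathbb{Z}^2}e^{-\pi\alpha\frac{|mz+n|^2}{\operatorname{Im}(z)}}.$$ The modular group is $\mathrm{SL}_2(\mathbb{Z})$ acting on $\mathbb{H}$ by $z\mapsto\frac{az+b}{cz+d}$; the functions $\theta(\alpha,\cdot)$ are invariant under it.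
   Formalization: It also assumes min α_j · min β_j ≥ 1, without which the claim is false. Orbit points of e^{iπ/3} are always maximizers; the arg max equals that orbit if some b_j, a_k > 0 have α_k < β_j and α_kβ_j > 1, which excludes only constant or undefined quotients. *)

theory Defs
  imports "HOL-Analysis.Analysis"
begin

definition upper_half_plane :: "complex set" where
  "upper_half_plane = {z. 0 < Im z}"

definition theta :: "real \<Rightarrow> complex \<Rightarrow> real" where
  "theta \<alpha> z =
     (\<Sum>\<^sub>\<infinity>(m, n)\<in>(UNIV :: (int \<times> int) set).
        exp (- pi * \<alpha> * (cmod (of_int m * z + of_int n))\<^sup>2 / Im z))"

definition theta_quotient ::
  "nat \<Rightarrow> (nat \<Rightarrow> real) \<Rightarrow> (nat \<Rightarrow> real) \<Rightarrow> (nat \<Rightarrow> real) \<Rightarrow> (nat \<Rightarrow> real) \<Rightarrow> complex \<Rightarrow> real"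
where
  "theta_quotient N b \<beta> a \<alpha> z =
     (\<Sum>j=1..N. b j * theta (\<beta> j) z) / (\<Sum>j=1..N. a j * theta (\<alpha> j) z)"

definition modular_orbit :: "complex \<Rightarrow> complex set" where
  "modular_orbit w =
     {(of_int a * w + of_int b) / (of_int c * w + of_int d) | a b c d :: int. a * d - b * c = 1}"

definition arg_max_set :: "('a \<Rightarrow> real) \<Rightarrow> 'a set \<Rightarrow> 'a set" where
  "arg_max_set f S = {x. is_arg_max f (\<lambda>y. y \<in> S) x}"

end

theory Submission
  imports Defs "HOL-Probability.Characteristic_Functions" "HOL-Computational_Algebra.Polynomial"
begin


text \<open>
  Put $\theta_t(z) = e^{t/2}\theta(e^t, z)$. By Poisson summation $\theta_t$ is even in $t$, so only $t \ge 0$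
  matters. For $0 \le s < t$ the gap $\theta_t - \theta_s$ attains its maximum exactly on the modular orbit of
  $w = e^{i\pi/3}$. Letting $t \to \infty$ in this shows $\theta_s(w) \le \theta_s(z)$, and comparing with a point
  high in the cusp shows $\theta_s(w) \le \theta_t(w)$; the three facts together bound each quotient
  $\theta_t/\theta_s$ by its value at $w$, and a sum over pairs of parameters finishes the proof.

  The maximum of the gap is located by three moves. At height $y \ge 6/10$ the gap grows when $x$ is replaced by
  $1/2$. At height $y \ge 15/10$ it grows when $1/2 + iy$ is replaced by $1/2 + iy/2$. So only the
  segment $1/2 + iy$, $6/10 \le y \le 15/10$, is left, where a maximum exists by compactness. The inversion
  $z \mapsto -1/z$ sends $1/2 + iy$ to a point of height $y/(y^2 + 1/4)$, again between $6/10$ and $15/10$, and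
  the first move would increase the gap there unless the real part is $1/2$ modulo $1$, that is $y^2 = 3/4$.
  Each of the two moves says that a difference of two theta functions decreases in $t$. This is proved term by term:
  in the Fourier expansion as long as $e^t$ is at most a constant times $y$, in the sum over the lattice beyond that.
\<close>

section \<open>Poisson summation for Gaussians\<close>

text \<open>The gap is preferred to the quotient because it is linear in the two theta functions, so
  it can be estimated term by term, and it is still modular invariant. No infinite series is
  differentiated. Each term's increment from s to t is bounded by a weight times one nonnegative
  reference increment, and what decides is that the weights have a negative sum.

  The delicate range is e^t comparable to y, where neither expansion is clearly ruled by its leading
  term. The switch lies at e^t = 2.9 y for the horizontal move and at e^t = y for the vertical one.
  Below it the slower Fourier rate pi y e^(-t) is at least 1.08; above it pi e^t / y is at least 9.1
  in the horizontal and 3.14 in the vertical move.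

  The heights fit together: y -> y / (y^2 + 1/4) sends 15/10 to exactly 6/10 and maps [6/10, 15/10]
  into itself, halving a height above 15/10 leaves more than 75/100, and every orbit has a point of
  height at least sqrt 3 / 2, hence above 6/10.\<close>

lemma int_has_sum_pair1:
  fixes f :: "int \<Rightarrow> real"
  assumes "f summable_on UNIV"
  shows "((\<lambda>n::nat. f (int n) + f (- 1 - int n)) has_sum infsum f UNIV) UNIV"
proof -
  have b1: "bij_betw int UNIV {0..}"
    by (rule bij_betwI[where g = nat]) auto
  have b2: "bij_betw (\<lambda>n. - 1 - int n) UNIV {..<0}"
    by (rule bij_betwI[where g = "\<lambda>k. nat (- 1 - k)"]) auto
  have s1: "f summable_on {0..}" and s2: "f summable_on {..<0}"
    using assms summable_on_subset_banach by blast+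
  have "((\<lambda>n. f (int n)) has_sum infsum f {0..}) UNIV"
    using has_sum_reindex_bij_betw[OF b1, of f] s1 by (simp add: summable_iff_has_sum_infsum)
  moreover have "((\<lambda>n. f (- 1 - int n)) has_sum infsum f {..<0}) UNIV"
    using has_sum_reindex_bij_betw[OF b2, of f] s2 by (simp add: summable_iff_has_sum_infsum)
  ultimately have "((\<lambda>n::nat. f (int n) + f (- 1 - int n)) has_sum (infsum f {0..} + infsum f {..<0})) UNIV"
    by (rule has_sum_add)
  moreover have "infsum f UNIV = infsum f {0..} + infsum f {..<0}"
  proof -
    have "UNIV = {0..} \<union> {..<(0::int)}" "{0..} \<inter> {..<(0::int)} = {}" by auto
    then show ?thesis
      using infsum_Un_disjoint[OF s1 s2] by auto
  qed
  ultimately show ?thesis by simp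
qed

text \<open>Reflection about 0, where \<open>int_has_sum_pair1\<close> reflects about -1/2. The two
  pairings serve sums centred at an integer and at a half-integer; here the fixed point 0 is left
  over and is subtracted.\<close>

lemma int_has_sum_pair0:
  fixes f :: "int \<Rightarrow> real"
  assumes "f summable_on UNIV"
  shows "((\<lambda>n::nat. f (1 + int n) + f (- 1 - int n)) has_sum (infsum f UNIV - f 0)) UNIV"
proof -
  have b1: "bij_betw (\<lambda>n. 1 + int n) UNIV {0<..}"
    by (rule bij_betwI[where g = "\<lambda>k. nat (k - 1)"]) auto
  have b2: "bij_betw (\<lambda>n. - 1 - int n) UNIV {..<0}"
    by (rule bij_betwI[where g = "\<lambda>k. nat (- 1 - k)"]) auto
  have s1: "f summable_on {0<..}" and s2: "f summable_on {..<0}" and s3: "f summable_on -{0}"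
    using assms summable_on_subset_banach by blast+
  have "((\<lambda>n. f (1 + int n)) has_sum infsum f {0<..}) UNIV"
    using has_sum_reindex_bij_betw[OF b1, of f] s1 by (simp add: summable_iff_has_sum_infsum)
  moreover have "((\<lambda>n. f (- 1 - int n)) has_sum infsum f {..<0}) UNIV"
    using has_sum_reindex_bij_betw[OF b2, of f] s2 by (simp add: summable_iff_has_sum_infsum)
  ultimately have "((\<lambda>n::nat. f (1 + int n) + f (- 1 - int n)) has_sum (infsum f {0<..} + infsum f {..<0})) UNIV"
    by (rule has_sum_add)
  moreover have "infsum f UNIV = f 0 + infsum f (-{0})"
    using infsum_Un_disjoint[of f "{0}" "-{0}"] s3 by auto
  moreover have "infsum f (-{0}) = infsum f {0<..} + infsum f {..<0}"
  proof -
    have e: "- {0} = {0<..} \<union> {..<(0::int)}" and "{0<..} \<inter> {..<(0::int)} = {}" by auto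
    show ?thesis
      unfolding e by (rule infsum_Un_disjoint) fact+
  qed
  ultimately show ?thesis by simp
qed

lemma int_geometric_has_sum:
  fixes r :: real
  assumes "0 \<le> r" "r < 1"
  shows "((\<lambda>n::int. r ^ nat \<bar>n\<bar>) has_sum ((1 + r) / (1 - r))) UNIV"
proof -
  let ?f = "\<lambda>n::int. r ^ nat \<bar>n\<bar>"
  have g: "((\<lambda>n::nat. r ^ n) has_sum (1 / (1 - r))) UNIV"
    using assms geometric_sums[of r] by (intro sums_nonneg_imp_has_sum) auto
  have b1: "bij_betw int UNIV {0..}"
    by (rule bij_betwI[where g = nat]) auto
  have b2: "bij_betw (\<lambda>n. - 1 - int n) UNIV {..<0}"
    by (rule bij_betwI[where g = "\<lambda>k. nat (- 1 - k)"]) auto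
  have 1: "(?f has_sum (1 / (1 - r))) {0..}"
    using has_sum_reindex_bij_betw[OF b1, of ?f "1 / (1 - r)"] g by simp
  have *: "?f (- 1 - int n) = r * r ^ n" for n
  proof -
    have "nat \<bar>- 1 - int n\<bar> = Suc n" by simp
    then show ?thesis by simp
  qed
  have 2: "(?f has_sum (r * (1 / (1 - r)))) {..<0}"
    using has_sum_reindex_bij_betw[OF b2, of ?f "r * (1 / (1 - r))"] has_sum_cmult_right[OF g, of r]
    unfolding * by blast
  have "UNIV = {0..} \<union> {..<(0::int)}" "{0..} \<inter> {..<(0::int)} = {}" by auto
  then have "(?f has_sum (1 / (1 - r) + r * (1 / (1 - r)))) UNIV"
    using has_sum_Un_disjoint[OF 1 2] by auto
  then show ?thesis by (simp add: add_divide_distrib)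
qed

text \<open>The shift costs only a constant factor, by n^2/2 \<le> (n + \<xi>)^2 + \<xi>^2, and |n|
  \<le> n^2 on the integers turns the Gaussian into a geometric majorant.\<close>

lemma gauss_le_geometric:
  fixes c \<xi> :: real and n :: int
  assumes "c > 0"
  shows "exp (- c * (of_int n + \<xi>)\<^sup>2) \<le> exp (c * \<xi>\<^sup>2) * exp (- c / 2) ^ nat \<bar>n\<bar>"
proof -
  have "(of_int n)\<^sup>2 / 2 \<le> (of_int n + \<xi>)\<^sup>2 + \<xi>\<^sup>2"
  proof -
    have "2 * ((of_int n + \<xi>)\<^sup>2 + \<xi>\<^sup>2) - (of_int n)\<^sup>2 = (of_int n + 2 * \<xi>)\<^sup>2"
      by (simp add: power2_eq_square algebra_simps)
    then show ?thesis using zero_le_power2[of "real_of_int n + 2 * \<xi>"] by argo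
  qed
  moreover have "\<bar>of_int n\<bar> \<le> (of_int n :: real)\<^sup>2"
  proof -
    have "\<bar>n\<bar> * 1 \<le> \<bar>n\<bar> * \<bar>n\<bar>"
      by (cases "n = 0") (simp, intro mult_left_mono, auto)
    then have "\<bar>n\<bar> \<le> n\<^sup>2" by (simp add: power2_eq_square)
    then show ?thesis by (metis of_int_abs of_int_le_iff of_int_power)
  qed
  ultimately have "\<bar>of_int n\<bar> / 2 \<le> (of_int n + \<xi>)\<^sup>2 + \<xi>\<^sup>2" by linarith
  then have "c * (\<bar>of_int n\<bar> / 2) \<le> c * ((of_int n + \<xi>)\<^sup>2 + \<xi>\<^sup>2)"
    using assms by (intro mult_left_mono) auto
  then have "- c * (of_int n + \<xi>)\<^sup>2 \<le> c * \<xi>\<^sup>2 + real (nat \<bar>n\<bar>) * (- c / 2)"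
    by (simp add: algebra_simps)
  then show ?thesis
    by (simp add: exp_of_nat_mult[symmetric] exp_add[symmetric])
qed

lemma gauss_summable:
  fixes c \<xi> :: real
  assumes "c > 0"
  shows "(\<lambda>n::int. exp (- c * (of_int n + \<xi>)\<^sup>2)) summable_on UNIV"
proof (rule summable_on_comparison_test)
  show "(\<lambda>n::int. exp (c * \<xi>\<^sup>2) * exp (- c / 2) ^ nat \<bar>n\<bar>) summable_on UNIV"
    using int_geometric_has_sum[of "exp (- c / 2)"] assms
    by (intro summable_on_cmult_right) (auto simp: summable_on_def)
qed (use gauss_le_geometric[OF assms] in auto)

text \<open>This is the characteristic function of the standard normal law at frequency 2 pi k /
  sqrt(2 pi s), rescaled by x -> sqrt(2 pi s) x; its real part carries the cosine.\<close>

lemma gauss_cos_integral: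
  fixes s k :: real
  assumes "s > 0"
  shows "has_bochner_integral lborel (\<lambda>x. exp (- (pi * s) * x\<^sup>2) * cos (2 * pi * k * x))
           (exp (- (pi / s) * k\<^sup>2) / sqrt s)"
proof -
  define t where "t = 2 * pi * k / sqrt (2 * pi * s)"
  have "char std_normal_distribution t = complex_of_real (exp (- (t^2) / 2))"
    by (simp add: char_std_normal_distribution)
  then have 1: "(CLINT x|std_normal_distribution. iexp (t * x)) = complex_of_real (exp (- (t^2) / 2))"
    by (simp add: char_def)
  have int: "integrable std_normal_distribution (\<lambda>x. iexp (t * x))"
    using real_dist_normal_dist
    by (intro prob_space.integrable_iexp) (auto simp: real_distribution_def)
  have "has_bochner_integral std_normal_distribution (\<lambda>x. iexp (t * x)) (complex_of_real (exp (- (t^2) / 2)))"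
    using int 1 by (simp add: has_bochner_integral_iff)
  then have "has_bochner_integral std_normal_distribution (\<lambda>x. Re (iexp (t * x))) (exp (- (t^2) / 2))"
    using has_bochner_integral_Re by fastforce
  then have "has_bochner_integral std_normal_distribution (\<lambda>x. cos (t * x)) (exp (- (t^2) / 2))"
    by (simp add: Re_exp)
  then have "has_bochner_integral lborel (\<lambda>x. std_normal_density x * cos (t * x)) (exp (- (t^2) / 2))"
    by (simp add: has_bochner_integral_iff integrable_density integral_density)
  then have 2: "has_bochner_integral lborel (\<lambda>x. std_normal_density (0 + sqrt (2 * pi * s) * x) * cos (t * (0 + sqrt (2 * pi * s) * x)))
      (exp (- (t^2) / 2) /\<^sub>R \<bar>sqrt (2 * pi * s)\<bar>)"
    using lborel_has_bochner_integral_real_affine_iff[of "sqrt (2 * pi * s)" "\<lambda>x. std_normal_density x * cos (t * x)" _ 0] assms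
    by simp
  have eq: "std_normal_density (0 + sqrt (2 * pi * s) * x) * cos (t * (0 + sqrt (2 * pi * s) * x))
     = (1 / sqrt (2 * pi)) * (exp (- (pi * s) * x\<^sup>2) * cos (2 * pi * k * x))" for x
    using assms by (simp add: std_normal_density_def t_def power_mult_distrib mult.assoc)
  have 3: "has_bochner_integral lborel (\<lambda>x. sqrt (2 * pi) * ((1 / sqrt (2 * pi)) * (exp (- (pi * s) * x\<^sup>2) * cos (2 * pi * k * x))))
      (sqrt (2 * pi) * (exp (- (t^2) / 2) /\<^sub>R \<bar>sqrt (2 * pi * s)\<bar>))"
    using has_bochner_integral_mult_right[OF 2[unfolded eq], of "sqrt (2 * pi)"] by simp
  have "t^2 / 2 = (pi / s) * k\<^sup>2"
    using assms by (simp add: t_def power_divide power_mult_distrib) (simp add: power2_eq_square)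
  then have "exp (- (t^2) / 2) = exp (- (pi / s) * k\<^sup>2)"
    by simp
  moreover have "sqrt (2 * pi) * (e /\<^sub>R \<bar>sqrt (2 * pi * s)\<bar>) = e / sqrt s" for e
  proof -
    have "sqrt (2 * pi * s) = sqrt (2 * pi) * sqrt s" by (simp add: real_sqrt_mult)
    moreover have "sqrt (2 * pi) > 0" "sqrt s > 0" using assms by auto
    ultimately show ?thesis by (simp add: field_simps del: real_sqrt_mult)
  qed
  ultimately have v: "sqrt (2 * pi) * (exp (- (t^2) / 2) /\<^sub>R \<bar>sqrt (2 * pi * s)\<bar>) = exp (- (pi / s) * k\<^sup>2) / sqrt s"
    by simp
  have "sqrt (2 * pi) * ((1 / sqrt (2 * pi)) * z) = z" for z
    by simp
  then show ?thesis using 3 unfolding v by simp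
qed

lemma has_sum_uniform_integral:
  fixes u :: "'a \<Rightarrow> real \<Rightarrow> real"
  assumes le: "\<And>n x. x \<in> {a..b} \<Longrightarrow> \<bar>u n x\<bar> \<le> M n" and M: "M summable_on UNIV"
    and c: "\<And>n. continuous_on {a..b} (u n)"
  shows "((\<lambda>n. integral {a..b} (u n)) has_sum integral {a..b} (\<lambda>x. \<Sum>\<^sub>\<infinity>n. u n x)) UNIV"
    and "continuous_on {a..b} (\<lambda>x. \<Sum>\<^sub>\<infinity>n. u n x)"
proof -
  have ul: "uniform_limit {a..b} (\<lambda>X y. \<Sum>x\<in>X. u x y) (\<lambda>y. \<Sum>\<^sub>\<infinity>x. u x y) (finite_subsets_at_top UNIV)"
    by (rule Weierstrass_m_test_general) (use le M in auto)
  show "continuous_on {a..b} (\<lambda>x. \<Sum>\<^sub>\<infinity>n. u n x)"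
    by (rule uniform_limit_theorem[OF _ ul]) (auto intro!: continuous_intros c always_eventually)
  obtain I J where IJ: "\<And>X. ((\<lambda>y. \<Sum>x\<in>X. u x y) has_integral I X) {a..b}"
    "((\<lambda>y. \<Sum>\<^sub>\<infinity>x. u x y) has_integral J) {a..b}" "(I \<longlongrightarrow> J) (finite_subsets_at_top UNIV)"
    by (rule uniform_limit_integral[OF ul]) (auto intro!: continuous_intros c)
  have "I X = (\<Sum>n\<in>X. integral {a..b} (u n))" if "finite X" for X
  proof -
    have "((\<lambda>y. \<Sum>x\<in>X. u x y) has_integral (\<Sum>n\<in>X. integral {a..b} (u n))) {a..b}"
      using that by (intro has_integral_sum integrable_integral integrable_continuous_real c)
    with IJ(1)[of X] show ?thesis by (rule has_integral_unique)
  qed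
  then have "\<forall>\<^sub>F X in finite_subsets_at_top UNIV. I X = (\<Sum>n\<in>X. integral {a..b} (u n))"
    by (intro eventually_finite_subsets_at_top_weakI) auto
  then have "((\<lambda>X. \<Sum>n\<in>X. integral {a..b} (u n)) \<longlongrightarrow> J) (finite_subsets_at_top UNIV)"
    using IJ(3) tendsto_cong by fastforce
  then show "((\<lambda>n. integral {a..b} (u n)) has_sum integral {a..b} (\<lambda>x. \<Sum>\<^sub>\<infinity>n. u n x)) UNIV"
    using IJ(2) by (simp add: has_sum_def integral_unique)
qed

text \<open>On [0, 1/2] the argument 2 pi x runs through [0, pi], where the cosine is injective, so
  polynomials in cos(2 pi x) separate points and are uniformly dense. Half a period is the right
  domain because it determines an even function of period 1, and there the cosines suffice.\<close>

lemma cos_coefficients_zero: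
  fixes D :: "real \<Rightarrow> real"
  assumes c: "continuous_on {0..1/2} D"
    and z: "\<And>k::nat. integral {0..1/2} (\<lambda>x. D x * cos (2 * pi * real k * x)) = 0"
    and x: "x \<in> {0..1/2}"
  shows "D x = 0"
proof -
  have io: "f integrable_on {0..1/2}" if "continuous_on {0..1/2} f" for f :: "real \<Rightarrow> real"
    using that by (rule integrable_continuous_real)
  have pz: "integral {0..1/2} (\<lambda>x. D x * poly p (cos (2 * pi * x)) * cos (2 * pi * real k * x)) = 0"
    for p :: "real poly" and k
  proof (induction p arbitrary: k)
    case 0
    then show ?case by simp
  next
    case (pCons a p)
    let ?P = "\<lambda>k x. D x * poly p (cos (2 * pi * x)) * cos (2 * pi * real k * x)"
    have cP: "continuous_on {0..1/2} (?P k)" for k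
      by (intro continuous_intros c)
    \<comment> \<open>The product formula produces the frequency k - 1; for k = 0 this would be -1,
      which evenness of the cosine replaces by 1.\<close>
    define k' where "k' = (if k = 0 then 1 else k - 1)"
    have cc: "cos (2 * pi * x) * cos (2 * pi * real k * x)
      = (cos (2 * pi * real (k + 1) * x) + cos (2 * pi * real k' * x)) / 2" for x
    proof -
      have "cos (2 * pi * real k' * x) = cos (2 * pi * real k * x - 2 * pi * x)"
        by (cases "k = 0") (auto simp: k'_def of_nat_diff algebra_simps)
      moreover have "cos (2 * pi * real (k + 1) * x) = cos (2 * pi * real k * x + 2 * pi * x)"
        by (simp add: algebra_simps)
      ultimately show ?thesis
        by (simp add: cos_add cos_diff)
    qed
    have e1: "(\<lambda>x. D x * poly (pCons a p) (cos (2 * pi * x)) * cos (2 * pi * real k * x))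
        = (\<lambda>x. a * (D x * cos (2 * pi * real k * x)) + (1/2 * ?P (k + 1) x + 1/2 * ?P k' x))"
    proof
      fix x
      have "D x * poly (pCons a p) (cos (2 * pi * x)) * cos (2 * pi * real k * x)
        = a * (D x * cos (2 * pi * real k * x)) + D x * poly p (cos (2 * pi * x)) * (cos (2 * pi * x) * cos (2 * pi * real k * x))"
        by (simp add: algebra_simps)
      then show "D x * poly (pCons a p) (cos (2 * pi * x)) * cos (2 * pi * real k * x)
        = a * (D x * cos (2 * pi * real k * x)) + (1/2 * ?P (k + 1) x + 1/2 * ?P k' x)"
        unfolding cc by (simp add: algebra_simps)
    qed
    have e2: "integral {0..1/2} (\<lambda>x. a * (D x * cos (2 * pi * real k * x)) + (1/2 * ?P (k + 1) x + 1/2 * ?P k' x))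
      = a * integral {0..1/2} (\<lambda>x. D x * cos (2 * pi * real k * x)) +
       (1/2 * integral {0..1/2} (?P (k + 1)) + 1/2 * integral {0..1/2} (?P k'))"
      by (subst integral_add integral_mult_right, intro io continuous_intros c, intro io continuous_intros c)+
         simp
    show ?case unfolding e1 e2 z pCons.IH by simp
  qed
  have pz0: "integral {0..1/2} (\<lambda>x. D x * poly p (cos (2 * pi * x))) = 0" for p
    using pz[of p 0] by simp
  define B where "B = integral {0..1/2} (\<lambda>x. \<bar>D x\<bar>)"
  have B: "B \<ge> 0" unfolding B_def by (rule integral_nonneg) (auto intro!: io continuous_intros c)
  have small: "integral {0..1/2} (\<lambda>x. (D x)\<^sup>2) \<le> e * B" if e: "e > 0" for e
  proof -
    have "\<exists>g. (\<exists>p. \<forall>x. g x = poly p (cos (2 * pi * x))) \<and> (\<forall>x \<in> {0..1/2}. \<bar>D x - g x\<bar> < e)"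
    proof (rule Stone_Weierstrass_HOL)
      show "\<exists>p. \<forall>x. c = poly p (cos (2 * pi * x))" for c
        by (rule exI[of _ "[:c:]"]) simp
      show "continuous_on {0..1/2} f" if f: "\<exists>p. \<forall>x. f x = poly p (cos (2 * pi * x))" for f
      proof -
        obtain p where "f = (\<lambda>x. poly p (cos (2 * pi * x)))" using f by auto
        then show ?thesis by (auto intro!: continuous_intros)
      qed
      show "\<exists>p. \<forall>x. f x + g x = poly p (cos (2 * pi * x))"
        if "(\<exists>p. \<forall>x. f x = poly p (cos (2 * pi * x))) \<and> (\<exists>p. \<forall>x. g x = poly p (cos (2 * pi * x)))" for f g
        using that by (metis poly_add)
      show "\<exists>p. \<forall>x. f x * g x = poly p (cos (2 * pi * x))"
        if "(\<exists>p. \<forall>x. f x = poly p (cos (2 * pi * x))) \<and> (\<exists>p. \<forall>x. g x = poly p (cos (2 * pi * x)))" for f g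
        using that by (metis poly_mult)
      show "\<exists>f. (\<exists>p. \<forall>x. f x = poly p (cos (2 * pi * x))) \<and> f x \<noteq> f y"
        if "x \<in> {0..1/2} \<and> y \<in> {0..1/2} \<and> x \<noteq> y" for x y :: real
      proof (intro exI conjI allI)
        show "cos (2 * pi * x) = poly [:0, 1:] (cos (2 * pi * x))" for x by simp
        show "cos (2 * pi * x) \<noteq> cos (2 * pi * y)"
          using that cos_inj_pi[of "2 * pi * x" "2 * pi * y"] by (auto simp: mult_le_cancel_left)
      qed
    qed (use c e in auto)
    then obtain p where p: "\<And>x. x \<in> {0..1/2} \<Longrightarrow> \<bar>D x - poly p (cos (2 * pi * x))\<bar> < e"
      by metis
    \<comment> \<open>\<open>D\<close> is orthogonal to the approximating polynomial in the cosine,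
      so only the error of the approximation remains next to one factor \<open>D\<close>.\<close>
    have "integral {0..1/2} (\<lambda>x. (D x)\<^sup>2)
      = integral {0..1/2} (\<lambda>x. D x * (D x - poly p (cos (2 * pi * x))) + D x * poly p (cos (2 * pi * x)))"
      by (rule integral_cong) (simp add: power2_eq_square algebra_simps)
    also have "\<dots> = integral {0..1/2} (\<lambda>x. D x * (D x - poly p (cos (2 * pi * x))))"
      by (subst integral_add) (auto intro!: io continuous_intros c simp: pz0)
    also have "\<dots> \<le> integral {0..1/2} (\<lambda>x. e * \<bar>D x\<bar>)"
    proof (rule integral_le)
      fix x assume "x \<in> {0..1/2::real}"
      from p[OF this] have "\<bar>D x\<bar> * \<bar>D x - poly p (cos (2 * pi * x))\<bar> \<le> \<bar>D x\<bar> * e"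
        by (intro mult_left_mono) auto
      moreover have "D x * (D x - poly p (cos (2 * pi * x))) \<le> \<bar>D x\<bar> * \<bar>D x - poly p (cos (2 * pi * x))\<bar>"
        by (metis abs_ge_self abs_mult)
      ultimately show "D x * (D x - poly p (cos (2 * pi * x))) \<le> e * \<bar>D x\<bar>"
        by (simp add: mult.commute)
    qed (intro io continuous_intros c)+
    also have "\<dots> = e * B" unfolding B_def by simp
    finally show ?thesis .
  qed
  have "integral {0..1/2} (\<lambda>x. (D x)\<^sup>2) \<le> 0"
  proof (rule field_le_epsilon)
    fix e :: real assume e: "e > 0"
    have "integral {0..1/2} (\<lambda>x. (D x)\<^sup>2) \<le> (e / (B + 1)) * B"
      using small[of "e / (B + 1)"] e B by simp
    also have "\<dots> \<le> 0 + e" using e B by (simp add: field_simps)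
    finally show "integral {0..1/2} (\<lambda>x. (D x)\<^sup>2) \<le> 0 + e" .
  qed
  moreover have "integral {0..1/2} (\<lambda>x. (D x)\<^sup>2) \<ge> 0"
    by (rule integral_nonneg) (auto intro!: io continuous_intros c)
  ultimately have "integral {0..1/2} (\<lambda>x. (D x)\<^sup>2) = 0" by simp
  moreover have "(\<lambda>x. (D x)\<^sup>2) integrable_on {0..1/2}"
    by (intro io continuous_intros c)
  ultimately have "((\<lambda>x. (D x)\<^sup>2) has_integral 0) (cbox 0 (1/2))"
    using integrable_integral by fastforce
  then have "(D x)\<^sup>2 = 0"
    by (rule has_integral_0_cbox_imp_0[rotated 2]) (use x c in \<open>auto intro!: continuous_intros\<close>)
  then show ?thesis by simp
qed

text \<open>The periodised Gaussian, a Jacobi theta function of one variable. The shift \<xi> is an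
  argument because row m of the planar lattice is displaced by m x.\<close>

definition gauss_sum :: "real \<Rightarrow> real \<Rightarrow> real" where
  "gauss_sum c \<xi> = (\<Sum>\<^sub>\<infinity>n::int. exp (- c * (of_int n + \<xi>)\<^sup>2))"

lemma gauss_sum_plus_int: "gauss_sum c (\<xi> + of_int k) = gauss_sum c \<xi>"
proof -
  have "(\<Sum>\<^sub>\<infinity>n::int. exp (- c * (of_int n + (\<xi> + of_int k))\<^sup>2))
      = (\<Sum>\<^sub>\<infinity>n::int. exp (- c * (of_int (n + k) + \<xi>)\<^sup>2))"
    by (simp add: algebra_simps)
  also have "\<dots> = (\<Sum>\<^sub>\<infinity>n::int. exp (- c * (of_int n + \<xi>)\<^sup>2))"
    by (rule infsum_reindex_bij_betw) (rule bij_betwI[where g = "\<lambda>n. n - k"], auto)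
  finally show ?thesis by (simp add: gauss_sum_def)
qed

lemma gauss_sum_minus: "gauss_sum c (- \<xi>) = gauss_sum c \<xi>"
proof -
  have "(\<Sum>\<^sub>\<infinity>n::int. exp (- c * (of_int n + - \<xi>)\<^sup>2))
      = (\<Sum>\<^sub>\<infinity>n::int. exp (- c * (of_int (- n) + \<xi>)\<^sup>2))"
    by (simp add: power2_commute)
  also have "\<dots> = (\<Sum>\<^sub>\<infinity>n::int. exp (- c * (of_int n + \<xi>)\<^sup>2))"
    by (rule infsum_reindex_bij_betw) (rule bij_betwI[where g = uminus], auto)
  finally show ?thesis by (simp add: gauss_sum_def)
qed

lemma cos_of_int_shift: "cos (2 * pi * real k * (of_int n + x)) = cos (2 * pi * real k * x)"
proof -
  have "2 * pi * real k * (of_int n + x) = 2 * pi * of_int (int k * n) + 2 * pi * real k * x"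
    by (simp add: algebra_simps)
  then show ?thesis
    using cos.plus_of_int[of "2 * pi * real k * x" "int k * n"]
    by (simp add: cos_add cos_int_2pin sin_int_2pin algebra_simps)
qed

text \<open>Unfolding: the n-th summand contributes the integral of \<open>h\<close> over
  [n, n + 1/2]. Evenness of \<open>h\<close> carries the interval belonging to -1 - n to
  [n + 1/2, n + 1], so the pairs tile the half line, and the total is half of the integral over the
  real line.\<close>

lemma gauss_sum_cos_integral:
  assumes s: "s > 0"
  shows "integral {0..1/2} (\<lambda>x. gauss_sum (pi * s) x * cos (2 * pi * real k * x))
    = exp (- (pi / s) * (real k)\<^sup>2) / sqrt s / 2"
    and "continuous_on {0..1/2} (gauss_sum (pi * s))"
proof -
  define h where "h = (\<lambda>x. exp (- (pi * s) * x\<^sup>2) * cos (2 * pi * real k * x))"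
  define I where "I = exp (- (pi / s) * (real k)\<^sup>2) / sqrt s"
  define M where "M = (\<lambda>n::int. exp (pi * s * (1/2)\<^sup>2) * exp (- (pi * s) / 2) ^ nat \<bar>n\<bar>)"
  have ch: "continuous_on A h" for A unfolding h_def by (intro continuous_intros)
  have hi: "h integrable_on {a..b}" for a b by (rule integrable_continuous_real[OF ch])
  have hu: "(h has_integral I) UNIV"
    using gauss_cos_integral[OF s, of "real k"] has_integral_integral_lborel[of h]
    by (simp add: h_def I_def has_bochner_integral_iff)
  have M: "M summable_on UNIV"
    unfolding M_def using int_geometric_has_sum[of "exp (- (pi * s) / 2)"] s
    by (intro summable_on_cmult_right) (auto simp: summable_on_def)
  have gM: "exp (- (pi * s) * (of_int n + x)\<^sup>2) \<le> M n" if "x \<in> {0..1/2}" for n x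
  proof -
    have "exp (- (pi * s) * (of_int n + x)\<^sup>2) \<le> exp (pi * s * x\<^sup>2) * exp (- (pi * s) / 2) ^ nat \<bar>n\<bar>"
      using gauss_le_geometric[of "pi * s" n x] s by simp
    also have "\<dots> \<le> M n"
      unfolding M_def using that s
      by (intro mult_right_mono) (auto intro!: mult_left_mono power_mono)
    finally show ?thesis .
  qed
  show "continuous_on {0..1/2} (gauss_sum (pi * s))"
    unfolding gauss_sum_def[abs_def]
    by (rule has_sum_uniform_integral(2)[where M = M]) (use gM M in \<open>auto intro!: continuous_intros\<close>)
  have "\<bar>exp (- (pi * s) * (of_int n + x)\<^sup>2) * cos (2 * pi * real k * x)\<bar> \<le> M n" if "x \<in> {0..1/2}" for n x
  proof -
    have "\<bar>exp (- (pi * s) * (of_int n + x)\<^sup>2) * cos (2 * pi * real k * x)\<bar> \<le> exp (- (pi * s) * (of_int n + x)\<^sup>2) * 1"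
      unfolding abs_mult by (intro mult_mono) auto
    with gM[OF that, of n] show ?thesis by simp
  qed
  then have "((\<lambda>n::int. integral {0..1/2} (\<lambda>x. exp (- (pi * s) * (of_int n + x)\<^sup>2) * cos (2 * pi * real k * x)))
      has_sum integral {0..1/2} (\<lambda>x. \<Sum>\<^sub>\<infinity>n::int. exp (- (pi * s) * (of_int n + x)\<^sup>2) * cos (2 * pi * real k * x))) UNIV"
    (is "(?T has_sum ?S) UNIV")
    by (intro has_sum_uniform_integral(1)[where M = M] M continuous_intros)
  moreover have "?S = integral {0..1/2} (\<lambda>x. gauss_sum (pi * s) x * cos (2 * pi * real k * x))"
    unfolding gauss_sum_def by (simp add: infsum_cmult_left')
  moreover have T: "?T n = integral {of_int n .. of_int n + 1/2} h" for n
  proof -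
    have "?T n = integral {0..1/2} (h \<circ> ((+) (of_int n)))"
      unfolding h_def comp_def cos_of_int_shift by simp
    also have "\<dots> = integral {of_int n .. of_int n + 1/2} h"
      by (subst integral_shift_Icc_real) (simp add: add.commute)
    finally show ?thesis .
  qed
  ultimately have hs: "((\<lambda>n::int. integral {of_int n .. of_int n + 1/2} h) has_sum
      integral {0..1/2} (\<lambda>x. gauss_sum (pi * s) x * cos (2 * pi * real k * x))) UNIV"
    by simp
  define S where "S = integral {0..1/2} (\<lambda>x. gauss_sum (pi * s) x * cos (2 * pi * real k * x))"
  have hev: "h (- x) = h x" for x by (simp add: h_def)
  have pair: "integral {of_int (int n) .. of_int (int n) + 1/2} h + integral {of_int (- 1 - int n) .. of_int (- 1 - int n) + 1/2} h
      = integral {real n..real n + 1} h" for n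
  proof -
    have "integral {of_int (- 1 - int n) .. of_int (- 1 - int n) + 1/2} h = integral {real n + 1/2..real n + 1} h"
    proof -
      have e: "{of_int (- 1 - int n) .. of_int (- 1 - int n) + 1/2} = {- (real n + 1)..- (real n + 1/2)}"
        by (simp add: algebra_simps)
      show ?thesis
        unfolding e using Henstock_Kurzweil_Integration.integral_reflect_real[of "real n + 1" "real n + 1/2" h] hev by simp
    qed
    then show ?thesis
      using Henstock_Kurzweil_Integration.integral_combine[of "real n" "real n + 1/2" "real n + 1" h] hi by simp
  qed
  have "((\<lambda>n. integral {real n..real n + 1} h) has_sum S) UNIV"
    using int_has_sum_pair1[OF has_sum_imp_summable[OF hs]]
    unfolding pair infsumI[OF hs] S_def .
  then have sums: "(\<lambda>n. integral {real n..real n + 1} h) sums S"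
    by (rule has_sum_imp_sums)
  have part: "(\<Sum>n<N. integral {real n..real n + 1} h) = integral {0..real N} h" for N
  proof (induction N)
    case (Suc N)
    then show ?case
      using Henstock_Kurzweil_Integration.integral_combine[of 0 "real N" "real N + 1" h] hi by (simp add: add.commute)
  qed simp
  have lim1: "(\<lambda>N. integral {0..real N} h) \<longlonglongrightarrow> S"
    using sums unfolding sums_def part .
  \<comment> \<open>The integral over the whole line is read off from the symmetric intervals, which
    eventually contain any given ball.\<close>
  have lim2: "(\<lambda>N. integral {- real N..real N} h) \<longlonglongrightarrow> I"
  proof (rule LIMSEQ_I)
    fix e :: real assume "e > 0"
    then obtain B where B: "B > 0"
      "\<And>a b. ball 0 B \<subseteq> cbox a b \<Longrightarrow> norm (integral (cbox a b) h - I) < e"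
      using hu[unfolded has_integral_alt'] by auto
    obtain N0 where N0: "B \<le> real N0" using real_arch_simple by blast
    show "\<exists>N0. \<forall>N\<ge>N0. norm (integral {- real N..real N} h - I) < e"
    proof (intro exI allI impI)
      fix N assume "N0 \<le> N"
      then have "ball 0 B \<subseteq> cbox (- real N) (real N)" using N0 by (auto simp: dist_real_def)
      from B(2)[OF this] show "norm (integral {- real N..real N} h - I) < e"
        by simp
    qed
  qed
  have "integral {- real N..real N} h = 2 * integral {0..real N} h" for N
    using Henstock_Kurzweil_Integration.integral_combine[of "- real N" 0 "real N" h] hi
      Henstock_Kurzweil_Integration.integral_reflect_real[of "real N" 0 h] hev by simp
  then have "I = 2 * S"
    using LIMSEQ_unique[OF lim2] tendsto_mult_left[OF lim1, of 2] by simp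
  then show "integral {0..1/2} (\<lambda>x. gauss_sum (pi * s) x * cos (2 * pi * real k * x)) = exp (- (pi / s) * (real k)\<^sup>2) / sqrt s / 2"
    by (simp add: S_def I_def)
qed

lemma cos_orthogonal:
  "integral {0..1/2} (\<lambda>x. cos (2 * pi * of_int j * x) * cos (2 * pi * real k * x))
    = (if j = int k then 1/4 else 0) + (if j = - int k then 1/4 else 0)"
proof -
  have c: "((\<lambda>x. cos (2 * pi * of_int l * x)) has_integral (if l = 0 then 1/2 else 0)) {0..1/2}" for l :: int
  proof (cases "l = 0")
    case False
    have "((\<lambda>x. cos (2 * pi * of_int l * x)) has_integral
        (sin (2 * pi * of_int l * (1/2)) / (2 * pi * of_int l) - sin (2 * pi * of_int l * 0) / (2 * pi * of_int l))) {0..1/2}"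
      using False
      by (intro fundamental_theorem_of_calculus)
         (auto intro!: derivative_eq_intros simp flip: has_real_derivative_iff_has_vector_derivative)
    moreover have "sin (2 * pi * of_int l * (1/2)) = 0"
      using sin_npi_int[of l] by (simp add: mult.commute)
    ultimately show ?thesis using False by simp
  next
    case True
    then show ?thesis using has_integral_const_real[of "1::real" 0 "1/2"] by simp
  qed
  have "(\<lambda>x. cos (2 * pi * of_int j * x) * cos (2 * pi * real k * x))
    = (\<lambda>x. (cos (2 * pi * of_int (j - int k) * x) + cos (2 * pi * of_int (j + int k) * x)) * (1/2))"
    by (simp add: cos_times_cos algebra_simps add_divide_distrib)
  moreover have "((\<lambda>x. (cos (2 * pi * of_int (j - int k) * x) + cos (2 * pi * of_int (j + int k) * x)) * (1/2))
    has_integral ((if j - int k = 0 then 1/2 else 0) + (if j + int k = 0 then 1/2 else 0)) * (1/2)) {0..1/2}"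
    by (intro has_integral_mult_left has_integral_add c)
  ultimately show ?thesis
    by (auto dest!: integral_unique)
qed

lemma has_sum_single_point: "((\<lambda>j. if j = a then c else (0::real)) has_sum c) UNIV"
  by (rule has_sum_finite_neutralI[of "{a}"]) auto

text \<open>Both sides are even with period 1 and continuous on [0, 1/2], and their cosine
  coefficients agree; so they coincide on [0, 1/2] and then everywhere. Comparing coefficients
  replaces a convergence proof for the Fourier series of the periodised Gaussian.\<close>

lemma gauss_sum_poisson:
  assumes s: "s > 0"
  shows "gauss_sum (pi * s) \<xi> = (\<Sum>\<^sub>\<infinity>j::int. exp (- (pi / s) * (of_int j)\<^sup>2) * cos (2 * pi * of_int j * \<xi>)) / sqrt s"
proof -
  define e where "e = (\<lambda>j::int. exp (- (pi / s) * (of_int j)\<^sup>2))"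
  define g where "g = (\<lambda>x. \<Sum>\<^sub>\<infinity>j::int. e j * cos (2 * pi * of_int j * x))"
  define D where "D = (\<lambda>x. gauss_sum (pi * s) x - g x / sqrt s)"
  have e0: "e j \<ge> 0" for j by (simp add: e_def)
  have M: "e summable_on UNIV"
    using gauss_summable[of "pi / s" 0] s by (simp add: e_def)
  have le: "\<bar>e j * cos t\<bar> \<le> e j" for j t
  proof -
    have "\<bar>e j * cos t\<bar> \<le> e j * 1" unfolding abs_mult using e0 by (intro mult_mono) auto
    then show ?thesis by simp
  qed
  have gc: "continuous_on {0..1/2} g"
    unfolding g_def by (rule has_sum_uniform_integral(2)[where M = e]) (use le M in \<open>auto intro!: continuous_intros\<close>)
  have fc: "continuous_on {0..1/2} (gauss_sum (pi * s))"
    by (rule gauss_sum_cos_integral(2)[OF s])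
  have gi: "integral {0..1/2} (\<lambda>x. g x * cos (2 * pi * real k * x)) = e (int k) / 2" for k
  proof -
    let ?u = "\<lambda>j x. e j * cos (2 * pi * of_int j * x) * cos (2 * pi * real k * x)"
    have "((\<lambda>j. integral {0..1/2} (?u j)) has_sum integral {0..1/2} (\<lambda>x. \<Sum>\<^sub>\<infinity>j. ?u j x)) UNIV"
    proof (rule has_sum_uniform_integral(1)[where M = e])
      show "\<bar>?u j x\<bar> \<le> e j" for j x
      proof -
        have "\<bar>?u j x\<bar> \<le> e j * 1" unfolding abs_mult[of "e j * cos (2 * pi * of_int j * x)"]
          using le e0 by (intro mult_mono) auto
        then show ?thesis by simp
      qed
    qed (auto intro!: continuous_intros M)
    moreover have "(\<lambda>x. \<Sum>\<^sub>\<infinity>j. ?u j x) = (\<lambda>x. g x * cos (2 * pi * real k * x))"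
      by (simp add: g_def infsum_cmult_left')
    moreover have "integral {0..1/2} (?u j) = (if j = int k then e (int k) / 4 else 0) + (if j = - int k then e (int k) / 4 else 0)" for j
    proof -
      have "integral {0..1/2} (?u j) = e j * ((if j = int k then 1/4 else 0) + (if j = - int k then 1/4 else 0))"
        unfolding mult.assoc integral_mult_right cos_orthogonal[symmetric] by simp
      moreover have "e (- int k) = e (int k)" by (simp add: e_def)
      ultimately show ?thesis by (auto simp: distrib_left)
    qed
    moreover have "((\<lambda>j. (if j = int k then e (int k) / 4 else 0) + (if j = - int k then e (int k) / 4 else 0)) has_sum (e (int k) / 4 + e (int k) / 4)) UNIV"
      by (intro has_sum_add has_sum_single_point)
    ultimately show ?thesis
      by (auto dest: has_sum_unique)
  qed
  have D0: "D x = 0" if "x \<in> {0..1/2}" for x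
  proof (rule cos_coefficients_zero[OF _ _ that])
    show "continuous_on {0..1/2} D"
      unfolding D_def using s by (intro continuous_intros fc gc) auto
    fix k
    have "(\<lambda>x. D x * cos (2 * pi * real k * x)) = (\<lambda>x. gauss_sum (pi * s) x * cos (2 * pi * real k * x)
        - (g x * cos (2 * pi * real k * x)) / sqrt s)"
      by (simp add: D_def algebra_simps)
    moreover have "integral {0..1/2} (\<lambda>x. gauss_sum (pi * s) x * cos (2 * pi * real k * x)
        - (g x * cos (2 * pi * real k * x)) / sqrt s) = exp (- (pi / s) * (real k)\<^sup>2) / sqrt s / 2 - e (int k) / 2 / sqrt s"
      using s by (subst integral_diff)
        (auto intro!: integrable_continuous_real continuous_intros fc gc simp: gi gauss_sum_cos_integral(1)[OF s])
    ultimately show "integral {0..1/2} (\<lambda>x. D x * cos (2 * pi * real k * x)) = 0"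
      by (simp add: e_def)
  qed
  have gp: "g (x + of_int n) = g x" for x n
  proof -
    have "cos (2 * pi * of_int j * (x + of_int n)) = cos (2 * pi * of_int j * x)" for j
    proof -
      have "2 * pi * of_int j * (x + of_int n) = 2 * pi * of_int j * x + 2 * pi * of_int (j * n)"
        by (simp add: algebra_simps)
      then show ?thesis
        by (simp only: cos_add cos_int_2pin sin_int_2pin)
    qed
    then show ?thesis by (simp add: g_def)
  qed
  have gm: "g (- x) = g x" for x by (simp add: g_def)
  have Dp: "D (x + of_int n) = D x" for x n by (simp add: D_def gp gauss_sum_plus_int)
  have Dm: "D (- x) = D x" for x by (simp add: D_def gm gauss_sum_minus)
  have "D \<xi> = 0"
  proof -
    define r where "r = \<xi> + of_int (- round \<xi>)"
    have "\<bar>r\<bar> \<le> 1/2" using of_int_round_abs_le[of \<xi>] by (simp add: r_def abs_minus_commute)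
    then have "D \<bar>r\<bar> = 0" by (intro D0) auto
    then have "D r = 0" using Dm[of r] by (cases "r \<ge> 0") auto
    then show ?thesis using Dp[of \<xi> "- round \<xi>"] by (simp add: r_def)
  qed
  then show ?thesis by (simp add: D_def g_def e_def)
qed

section \<open>Spatial and Fourier expansions of the theta function\<close>

lemma summable_on_abs_le:
  fixes f g :: "'a \<Rightarrow> real"
  assumes "f summable_on A" "\<And>x. x \<in> A \<Longrightarrow> \<bar>g x\<bar> \<le> f x"
  shows "g summable_on A"
proof (rule abs_summable_summable)
  show "(\<lambda>x. norm (g x)) summable_on A"
    by (rule summable_on_comparison_test[OF assms(1)]) (use assms(2) in auto)
qed

lemma has_sum_real_diff:
  fixes f g :: "'a \<Rightarrow> real"
  assumes "(f has_sum a) A" "(g has_sum b) A"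
  shows "((\<lambda>x. f x - g x) has_sum (a - b)) A"
  using has_sum_add[OF assms(1) has_sum_cmult_right[OF assms(2), of "-1"]] by simp

lemma int_even_has_sum:
  fixes f :: "int \<Rightarrow> real"
  assumes s: "(f has_sum S) UNIV" and e: "\<And>n. f (- n) = f n"
  shows "((\<lambda>n::nat. f (int n)) has_sum ((S - f 0) / 2)) {1..}"
proof -
  have eq: "f (1 + int n) + f (- 1 - int n) = 2 * f (int (Suc n))" for n
    using e[of "int (Suc n)"] by (simp add: algebra_simps)
  have "((\<lambda>n::nat. 2 * f (int (Suc n))) has_sum (S - f 0)) UNIV"
    using int_has_sum_pair0[OF has_sum_imp_summable[OF s]] infsumI[OF s] unfolding eq by simp
  then have "((\<lambda>n::nat. 1/2 * (2 * f (int (Suc n)))) has_sum (1/2 * (S - f 0))) UNIV"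
    by (rule has_sum_cmult_right)
  then have "((\<lambda>n::nat. f (int (Suc n))) has_sum ((S - f 0) / 2)) UNIV"
    by simp
  moreover have "bij_betw Suc UNIV {1..}"
    by (rule bij_betwI[where g = "\<lambda>n. n - 1"]) auto
  ultimately show ?thesis
    using has_sum_reindex_bij_betw[of Suc UNIV "{1..}" "\<lambda>n. f (int n)"] by blast
qed

lemma gauss_summable_int: "(c::real) > 0 \<Longrightarrow> (\<lambda>n::int. exp (- c * (of_int n)\<^sup>2)) summable_on UNIV"
  using gauss_summable[of c 0] by simp

lemma gauss_summable_nat:
  fixes c :: real
  assumes "c > 0"
  shows "(\<lambda>n::nat. exp (- c * (real n)\<^sup>2)) summable_on {1..}"
  using has_sum_imp_summable[OF int_even_has_sum[OF has_sum_infsum[OF gauss_summable_int[OF assms]]]] by simp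

text \<open>In the dual series every cosine is at most 1, so the value at shift 0 bounds all shifts.
  This uniformity makes the row sums of the theta series summable.\<close>

lemma gauss_sum_bounded:
  assumes c: "c > 0"
  obtains G where "\<And>\<xi>. gauss_sum c \<xi> \<le> G"
proof -
  define s where "s = c / pi"
  have s: "s > 0" "c = pi * s" using c by (auto simp: s_def)
  define e where "e = (\<lambda>j::int. exp (- (pi / s) * (of_int j)\<^sup>2))"
  have es: "e summable_on UNIV"
    using gauss_summable_int[of "pi / s"] s by (simp add: e_def)
  have le: "e j * cos u \<le> e j" "\<bar>e j * cos u\<bar> \<le> e j" for j u
  proof -
    have "\<bar>e j * cos u\<bar> \<le> e j * 1" unfolding abs_mult by (intro mult_mono) (auto simp: e_def)
    then show "\<bar>e j * cos u\<bar> \<le> e j" "e j * cos u \<le> e j" by auto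
  qed
  have "gauss_sum c \<xi> \<le> infsum e UNIV / sqrt s" for \<xi>
  proof -
    have "(\<lambda>j. e j * cos (2 * pi * of_int j * \<xi>)) summable_on UNIV"
      by (rule summable_on_abs_le[OF es le(2)])
    then have "infsum (\<lambda>j. e j * cos (2 * pi * of_int j * \<xi>)) UNIV \<le> infsum e UNIV"
      using le(1) es by (intro infsum_mono) auto
    then show ?thesis
      unfolding s(2) gauss_sum_poisson[OF s(1)] e_def using s(1) by (intro divide_right_mono) auto
  qed
  then show ?thesis by (rule that)
qed

lemma gauss_sum_has_sum:
  "c > 0 \<Longrightarrow> ((\<lambda>n::int. exp (- c * (of_int n + \<xi>)\<^sup>2)) has_sum gauss_sum c \<xi>) UNIV"
  unfolding gauss_sum_def by (intro has_sum_infsum gauss_summable)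

lemma gauss_sum_nonneg: "gauss_sum c \<xi> \<ge> 0"
  unfolding gauss_sum_def by (rule infsum_nonneg) auto

lemma theta_term:
  assumes "y > 0"
  shows "exp (- pi * \<alpha> * (cmod (of_int m * Complex x y + of_int n))\<^sup>2 / Im (Complex x y))
    = exp (- (pi * \<alpha> * y) * (of_int m)\<^sup>2) * exp (- (pi * \<alpha> / y) * (of_int n + of_int m * x)\<^sup>2)"
proof -
  have "(cmod (of_int m * Complex x y + of_int n))\<^sup>2 = (of_int n + of_int m * x)\<^sup>2 + (of_int m * y)\<^sup>2"
    by (simp add: cmod_power2 add.commute)
  then show ?thesis
    using assms by (simp add: exp_add[symmetric] power2_eq_square field_simps)
qed

lemma theta_summable_aux:
  assumes "\<alpha> > 0" "y > 0"
  shows "(\<lambda>m::int. exp (- (pi * \<alpha> * y) * (of_int m)\<^sup>2) * gauss_sum (pi * \<alpha> / y) (of_int m * x)) summable_on UNIV"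
proof -
  obtain G where G: "\<And>\<xi>. gauss_sum (pi * \<alpha> / y) \<xi> \<le> G"
    using gauss_sum_bounded[of "pi * \<alpha> / y"] assms by auto
  show ?thesis
  proof (rule summable_on_comparison_test)
    show "(\<lambda>m::int. exp (- (pi * \<alpha> * y) * (of_int m)\<^sup>2) * G) summable_on UNIV"
      using assms by (intro summable_on_cmult_left gauss_summable_int) simp
  qed (use G gauss_sum_nonneg in auto)
qed

lemma theta_summable:
  assumes "\<alpha> > 0" "Im z > 0"
  shows "(\<lambda>(m, n). exp (- pi * \<alpha> * (cmod (of_int m * z + of_int n))\<^sup>2 / Im z)) summable_on (UNIV :: (int \<times> int) set)"
proof -
  obtain x y where z: "z = Complex x y" by (cases z)
  have y: "y > 0" using assms z by simp
  have "(\<lambda>(m, n). exp (- pi * \<alpha> * (cmod (of_int m * z + of_int n))\<^sup>2 / Im z)) summable_on Sigma (UNIV :: int set) (\<lambda>_. UNIV :: int set)"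
  proof (rule summable_on_SigmaI)
    fix m :: int
    show "((\<lambda>n. case (m, n) of (m, n) \<Rightarrow> exp (- pi * \<alpha> * (cmod (of_int m * z + of_int n))\<^sup>2 / Im z)) has_sum
      exp (- (pi * \<alpha> * y) * (of_int m)\<^sup>2) * gauss_sum (pi * \<alpha> / y) (of_int m * x)) UNIV"
      unfolding prod.case z theta_term[OF y] using y assms
      by (intro has_sum_cmult_right gauss_sum_has_sum) auto
  qed (use theta_summable_aux[OF assms(1) y] in auto)
  then show ?thesis by simp
qed

lemma theta_has_sum:
  assumes "\<alpha> > 0" "Im z > 0"
  shows "((\<lambda>(m, n). exp (- pi * \<alpha> * (cmod (of_int m * z + of_int n))\<^sup>2 / Im z)) has_sum theta \<alpha> z) (UNIV :: (int \<times> int) set)"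
  unfolding theta_def by (rule has_sum_infsum[OF theta_summable[OF assms]])

lemma theta_spatial:
  assumes "\<alpha> > 0" "y > 0"
  shows "((\<lambda>m::int. exp (- (pi * \<alpha> * y) * (of_int m)\<^sup>2) * gauss_sum (pi * \<alpha> / y) (of_int m * x)) has_sum theta \<alpha> (Complex x y)) UNIV"
proof (rule has_sum_SigmaD)
  show "((\<lambda>(m, n). exp (- pi * \<alpha> * (cmod (of_int m * Complex x y + of_int n))\<^sup>2 / Im (Complex x y))) has_sum theta \<alpha> (Complex x y))
     (Sigma (UNIV :: int set) (\<lambda>_. UNIV :: int set))"
    using theta_has_sum[of \<alpha> "Complex x y"] assms by simp
  show "((\<lambda>n. case (m, n) of (m, n) \<Rightarrow> exp (- pi * \<alpha> * (cmod (of_int m * Complex x y + of_int n))\<^sup>2 / Im (Complex x y))) has_sum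
      exp (- (pi * \<alpha> * y) * (of_int m)\<^sup>2) * gauss_sum (pi * \<alpha> / y) (of_int m * x)) UNIV" for m :: int
    unfolding prod.case theta_term[OF assms(2)] using assms
    by (intro has_sum_cmult_right gauss_sum_has_sum) auto
qed

definition ntheta :: "real \<Rightarrow> real \<Rightarrow> real \<Rightarrow> real" where
  "ntheta t x y = exp (t / 2) * theta (exp t) (Complex x y)"

text \<open>The size of frequency n in row m after Poisson summation in the column index. It is
  unchanged when m and n are exchanged and t is negated, which is where the evenness in t comes
  from.\<close>

definition fmode :: "real \<Rightarrow> real \<Rightarrow> nat \<Rightarrow> nat \<Rightarrow> real" where
  "fmode y t m n = exp (- (pi * y) * (exp t * (real m)\<^sup>2 + exp (- t) * (real n)\<^sup>2))"

lemma fmode_eq: "fmode y t m n = exp (- (pi * y * exp t) * (real m)\<^sup>2) * exp (- (pi * y * exp (- t)) * (real n)\<^sup>2)"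
  by (simp add: fmode_def exp_add[symmetric] algebra_simps)

lemma fmode_pos: "fmode y t m n > 0" by (simp add: fmode_def)

lemma fmode_summable:
  assumes y: "y > 0"
  shows "(\<lambda>(m, n). fmode y t m n) summable_on ({1..} \<times> {1..})"
proof (rule summable_on_SigmaI)
  have b: "(\<lambda>n. exp (- (pi * y * exp (- t)) * (real n)\<^sup>2)) summable_on {1..}"
    using y by (intro gauss_summable_nat) simp
  show "((\<lambda>n. case (m, n) of (m, n) \<Rightarrow> fmode y t m n) has_sum
      exp (- (pi * y * exp t) * (real m)\<^sup>2) * infsum (\<lambda>n. exp (- (pi * y * exp (- t)) * (real n)\<^sup>2)) {1..}) {1..}" for m
    unfolding prod.case fmode_eq by (intro has_sum_cmult_right has_sum_infsum b)
  show "(\<lambda>m. exp (- (pi * y * exp t) * (real m)\<^sup>2) * infsum (\<lambda>n. exp (- (pi * y * exp (- t)) * (real n)\<^sup>2)) {1..}) summable_on {1..}"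
    using y by (intro summable_on_cmult_left gauss_summable_nat) simp
qed (auto intro: less_imp_le fmode_pos)

lemma fmode_summable_cos:
  assumes y: "y > 0" and d: "\<And>m n. \<bar>d m n\<bar> \<le> 1"
  shows "(\<lambda>(m, n). fmode y t m n * d m n) summable_on ({1..} \<times> {1..})"
proof -
  have "fmode y t m n * \<bar>d m n\<bar> \<le> fmode y t m n * 1" for m n
    using d[of m n] less_imp_le[OF fmode_pos, of y t m n] by (intro mult_left_mono) auto
  then show ?thesis
    using fmode_pos[of y t]
    by (intro summable_on_abs_le[OF fmode_summable[OF y, of t]]) (auto simp: abs_mult abs_of_pos)
qed

definition gauss_tail :: "real \<Rightarrow> real" where
  "gauss_tail c = (\<Sum>\<^sub>\<infinity>n::nat\<in>{1..}. exp (- c * (real n)\<^sup>2))"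

lemma gauss_tail_has_sum: "0 < c \<Longrightarrow> ((\<lambda>n::nat. exp (- c * (real n)\<^sup>2)) has_sum gauss_tail c) {1..}"
  unfolding gauss_tail_def by (intro has_sum_infsum gauss_summable_nat)

text \<open>The coefficients are a parameter so that a single point, a difference of two points, a
  change of sign and a corrected (1,1) coefficient can all be treated alike.\<close>

definition offdiag_sum :: "real \<Rightarrow> real \<Rightarrow> (nat \<Rightarrow> nat \<Rightarrow> real) \<Rightarrow> real" where
  "offdiag_sum y t d = (\<Sum>\<^sub>\<infinity>(m, n)\<in>{1..}\<times>{1..}. fmode y t m n * d m n)"

text \<open>Poisson summation in n, row by row. The factor sqrt(y / e^t) it produces cancels e^(t/2)
  up to sqrt y. Folding the signs of m and n gives multiplicity 2 on the axes and 4 off them; the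
  axis part does not depend on x.\<close>

lemma ntheta_fourier:
  assumes y: "y > 0"
  shows "ntheta t x y = sqrt y * (1 + 2 * gauss_tail (pi * y * exp t)
     + 2 * gauss_tail (pi * y * exp (- t))
     + 4 * offdiag_sum y t (\<lambda>m n. cos (2 * pi * real m * real n * x)))"
proof -
  define a where "a = (\<lambda>m::int. exp (- (pi * y * exp t) * (of_int m)\<^sup>2))"
  define b where "b = (\<lambda>m::int. exp (- (pi * y * exp (- t)) * (of_int m)\<^sup>2))"
  define g where "g = (\<lambda>m::int. \<Sum>\<^sub>\<infinity>j. b j * cos (2 * pi * of_int j * (of_int m * x)))"
  have bs: "b summable_on UNIV" unfolding b_def using y by (intro gauss_summable_int) simp
  have as: "a summable_on UNIV" unfolding a_def using y by (intro gauss_summable_int) simp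
  have le: "\<bar>b j * cos u\<bar> \<le> b j" for j u
  proof -
    have "\<bar>b j * cos u\<bar> \<le> b j * 1" unfolding abs_mult by (intro mult_mono) (auto simp: b_def)
    then show "\<bar>b j * cos u\<bar> \<le> b j" by auto
  qed
  have gs: "((\<lambda>j. b j * cos (2 * pi * of_int j * (of_int m * x))) has_sum g m) UNIV" for m
    unfolding g_def by (intro has_sum_infsum summable_on_abs_le[OF bs le])
  have sq: "sqrt (exp t) = exp (t / 2)" 
    by (rule real_sqrt_unique) (auto simp: power2_eq_square exp_add[symmetric])
  have gsum: "gauss_sum (pi * exp t / y) (of_int m * x) = g m * sqrt y / exp (t / 2)" for m
    using gauss_sum_poisson[of "exp t / y" "of_int m * x"] y
    by (simp add: g_def b_def real_sqrt_divide sq exp_minus field_simps)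
  define S where "S = ntheta t x y / sqrt y"
  have "((\<lambda>m. exp (t/2) / sqrt y * (exp (- (pi * exp t * y) * (of_int m)\<^sup>2) * gauss_sum (pi * exp t / y) (of_int m * x))) has_sum
     (exp (t/2) / sqrt y * theta (exp t) (Complex x y))) UNIV"
    by (rule has_sum_cmult_right[OF theta_spatial]) (use y in auto)
  moreover have "exp (t/2) / sqrt y * (exp (- (pi * exp t * y) * (of_int m)\<^sup>2) * gauss_sum (pi * exp t / y) (of_int m * x)) = a m * g m" for m
    using y unfolding gsum a_def by (simp add: mult_ac)
  ultimately have G: "((\<lambda>m. a m * g m) has_sum S) UNIV"
    by (simp add: S_def ntheta_def)
  define A where "A = (\<Sum>\<^sub>\<infinity>n\<in>{1::nat..}. a (int n))"
  define B where "B = (\<Sum>\<^sub>\<infinity>n\<in>{1::nat..}. b (int n))"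
  have ge: "g (- m) = g m" for m by (simp add: g_def)
  have G1: "((\<lambda>m::nat. a (int m) * g (int m)) has_sum ((S - a 0 * g 0) / 2)) {1..}"
    by (rule int_even_has_sum[OF G]) (simp add: ge, simp add: a_def)
  have g1: "((\<lambda>j::nat. b (int j) * cos (2 * pi * of_int (int j) * (of_int m * x))) has_sum ((g m - 1) / 2)) {1..}" for m
    using int_even_has_sum[OF gs, of m] by (simp add: b_def)
  have A: "((\<lambda>n. a (int n)) has_sum A) {1::nat..}"
    unfolding A_def using has_sum_imp_summable[OF int_even_has_sum[OF has_sum_infsum[OF as]]] 
    by (auto intro!: has_sum_infsum simp: a_def)
  have B: "g 0 = 1 + 2 * B"
    using infsumI[OF g1[of 0]] by (simp add: B_def)
  have off: "((\<lambda>(m, n). fmode y t m n * cos (2 * pi * real m * real n * x)) has_sum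
      (((S - a 0 * g 0) / 2 - A) / 2)) ({1..} \<times> {1..})"
  proof (rule has_sum_SigmaI)
    show "((\<lambda>n. case (m, n) of (m, n) \<Rightarrow> fmode y t m n * cos (2 * pi * real m * real n * x)) has_sum
       (a (int m) * ((g (int m) - 1) / 2))) {1..}" for m
      using has_sum_cmult_right[OF g1[of "int m"], of "a (int m)"]
      by (simp add: fmode_eq a_def b_def mult_ac)
    have "((\<lambda>m. 1/2 * (a (int m) * g (int m) - a (int m))) has_sum (1/2 * ((S - a 0 * g 0) / 2 - A))) {1..}"
      by (intro has_sum_cmult_right has_sum_real_diff G1 A)
    then show "((\<lambda>m. a (int m) * ((g (int m) - 1) / 2)) has_sum (((S - a 0 * g 0) / 2 - A) / 2)) {1..}"
      by (simp add: algebra_simps diff_divide_distrib add_divide_distrib)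
    show "(\<lambda>(m, n). fmode y t m n * cos (2 * pi * real m * real n * x)) summable_on {1..} \<times> {1..}"
      by (rule fmode_summable_cos[OF y]) simp
  qed
  have "S = 1 + 2 * A + 2 * B + 4 * offdiag_sum y t (\<lambda>m n. cos (2 * pi * real m * real n * x))"
    unfolding offdiag_sum_def infsumI[OF off] B by (simp add: a_def field_simps)
  then show ?thesis
    using y by (simp add: S_def A_def B_def a_def b_def gauss_tail_def field_simps)
qed

section \<open>Monotonicity of the off-diagonal Fourier modes\<close>

lemma pi_gt_314: "pi > 314 / 100"
proof -
  have lo: "arctan x \<ge> x - x ^ 3 / 3" if "x \<ge> 0" for x :: real
  proof -
    have "(\<lambda>x. arctan x - (x - x ^ 3 / 3)) 0 \<le> (\<lambda>x. arctan x - (x - x ^ 3 / 3)) x"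
    proof (rule DERIV_nonneg_imp_nondecreasing[OF that])
      fix u :: real
      have "1 - u\<^sup>2 \<le> inverse (1 + u\<^sup>2)"
      proof -
        have "(1 - u\<^sup>2) * (1 + u\<^sup>2) \<le> 1" by (simp add: algebra_simps)
        moreover have "1 + u\<^sup>2 > 0" by (simp add: add_pos_nonneg)
        ultimately show ?thesis by (simp add: inverse_eq_divide pos_le_divide_eq)
      qed
      then show "\<exists>d. ((\<lambda>x. arctan x - (x - x ^ 3 / 3)) has_real_derivative d) (at u) \<and> 0 \<le> d"
        by (intro exI[of _ "inverse (1 + u\<^sup>2) - (1 - u\<^sup>2)"]) (auto intro!: derivative_eq_intros)
    qed
    then show ?thesis by simp
  qed
  have hi: "arctan x \<le> x" if "x \<ge> 0" for x :: real
  proof -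
    have "(\<lambda>x. x - arctan x) 0 \<le> (\<lambda>x. x - arctan x) x"
    proof (rule DERIV_nonneg_imp_nondecreasing[OF that])
      fix u :: real
      have "inverse (1 + u\<^sup>2) \<le> 1" by (rule inverse_le_1_iff[THEN iffD2]) simp
      then show "\<exists>d. ((\<lambda>x. x - arctan x) has_real_derivative d) (at u) \<and> 0 \<le> d"
        by (intro exI[of _ "1 - inverse (1 + u\<^sup>2)"]) (auto intro!: derivative_eq_intros)
    qed
    then show ?thesis by simp
  qed
  \<comment> \<open>The cubic lower bound at 1/5 and the linear upper bound at 1/239 in Machin's
    formula already give about 3.1406.\<close>
  have "pi / 4 \<ge> 4 * (1/5 - (1/5)^3/3) - 1/239"
    using lo[of "1/5"] hi[of "1/239"] machin by simp
  then show ?thesis by (simp add: power3_eq_cube)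
qed

text \<open>1.105 = 1 + 1/10 + 1/200 is the quadratic Taylor bound for exp(1/10). Most numerical
  bounds below are reduced to a power of this rational number, which the simplifier
  evaluates.\<close>

lemma exp_ge_power:
  fixes x :: real
  assumes "real n / 10 \<le> x"
  shows "(1105 / 1000) ^ n \<le> exp x"
proof -
  have "(1105 / 1000 :: real) \<le> exp (1/10)"
    using exp_lower_Taylor_quadratic[of "1/10::real"] by (simp add: power2_eq_square)
  then have "(1105 / 1000 :: real) ^ n \<le> exp (1/10) ^ n"
    by (intro power_mono) auto
  also have "\<dots> = exp (real n / 10)" by (simp add: exp_of_nat_mult[symmetric])
  also have "\<dots> \<le> exp x" using assms by simp
  finally show ?thesis .
qed

lemma exp_minus_le_power:
  fixes x :: real
  assumes "real n / 10 \<le> x"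
  shows "exp (- x) \<le> 1 / (1105 / 1000) ^ n"
  using exp_ge_power[OF assms] by (simp add: exp_minus inverse_eq_divide frac_le del: power_divide)

text \<open>A single mode is not monotone in $t$ near $t = 0$; since the expansion is invariant under $t \mapsto -t$, the sum of
  the modes $(m,n)$ and $(n,m)$ has derivative of order $\sinh t$ and can be compared with the mode $(1,1)$.\<close>

definition fpair :: "real \<Rightarrow> nat \<Rightarrow> nat \<Rightarrow> real \<Rightarrow> real" where
  "fpair y m n t = fmode y t m n + fmode y t n m"

definition fpair_deriv :: "real \<Rightarrow> nat \<Rightarrow> nat \<Rightarrow> real \<Rightarrow> real" where
  "fpair_deriv y m n t = - (pi * y) * ((exp t * (real m)\<^sup>2 - exp (- t) * (real n)\<^sup>2) * fmode y t m n
     + (exp t * (real n)\<^sup>2 - exp (- t) * (real m)\<^sup>2) * fmode y t n m)"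

lemma fpair_has_deriv: "(fpair y m n has_real_derivative fpair_deriv y m n t) (at t)"
  unfolding fpair_def[abs_def] fmode_def
  by (rule derivative_eq_intros refl | simp)+ (simp add: fpair_deriv_def fmode_def algebra_simps)

lemma fpair_deriv_commute: "fpair_deriv y m n t = fpair_deriv y n m t"
  by (simp add: fpair_deriv_def algebra_simps)

lemma fmode_swap:
  "fmode y t n m = fmode y t m n * exp (- (2 * (pi * y * ((real n)\<^sup>2 - (real m)\<^sup>2) * sinh t)))"
proof -
  have "2 * sinh t = exp t - exp (- t)" by (simp add: sinh_field_def)
  then have "2 * (pi * y * ((real n)\<^sup>2 - (real m)\<^sup>2) * sinh t) = pi * y * ((real n)\<^sup>2 - (real m)\<^sup>2) * (exp t - exp (- t))"
    by simp
  then show ?thesis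
    unfolding fmode_def exp_add[symmetric] by (simp add: algebra_simps)
qed

text \<open>Two competing effects for m \<le> n and t \<ge> 0: the difference of swapped modes
  pushes the pair up, the sum pulls it down. By \<open>fmode_swap\<close> the difference also
  vanishes like sinh t, so both effects are comparable with the derivative of the mode
  (1,1).\<close>

lemma fpair_deriv_hyperbolic:
  "fpair_deriv y m n t = pi * y * (((real n)\<^sup>2 - (real m)\<^sup>2) * cosh t * (fmode y t m n - fmode y t n m)
     - ((real m)\<^sup>2 + (real n)\<^sup>2) * sinh t * (fmode y t m n + fmode y t n m))"
  by (simp add: fpair_deriv_def cosh_field_def sinh_field_def field_simps)

lemma fpair_deriv_lower:
  assumes "y > 0" "t \<ge> 0" "m \<le> n"
  shows "- fpair_deriv y m n t \<le> 2 * pi * y * sinh t * (((real m)\<^sup>2 + (real n)\<^sup>2) * fmode y t m n)"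
proof -
  have q: "(real n)\<^sup>2 - (real m)\<^sup>2 \<ge> 0" using assms by (simp add: power_mono)
  have s: "sinh t \<ge> 0" "cosh t \<ge> 0" using assms by auto
  have le: "fmode y t n m \<le> fmode y t m n"
    unfolding fmode_swap[of y t n m] using q s assms fmode_pos[of y t m n] by simp
  have "((real n)\<^sup>2 - (real m)\<^sup>2) * cosh t * (fmode y t m n - fmode y t n m) \<ge> 0"
    using q s le by simp
  moreover have "((real m)\<^sup>2 + (real n)\<^sup>2) * sinh t * (fmode y t m n + fmode y t n m)
      \<le> ((real m)\<^sup>2 + (real n)\<^sup>2) * sinh t * (2 * fmode y t m n)"
    using s le by (intro mult_left_mono) auto
  ultimately have "- fpair_deriv y m n t \<le> pi * y * (((real m)\<^sup>2 + (real n)\<^sup>2) * sinh t * (2 * fmode y t m n))"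
    unfolding fpair_deriv_hyperbolic mult_minus_right[symmetric] using assms by (intro mult_left_mono) auto
  then show ?thesis by (simp add: algebra_simps)
qed

text \<open>Two bounds for two ranges of t. The first suffices once cosh t is at most a multiple of
  sinh t; the second extracts the factor sinh t needed near t = 0 from 1 - exp(-x) \<le> x.\<close>

lemma fpair_deriv_upper:
  assumes "y > 0" "t \<ge> 0" "m \<le> n"
  defines "q \<equiv> (real n)\<^sup>2 - (real m)\<^sup>2"
  shows "fpair_deriv y m n t \<le> pi * y * (q * cosh t * fmode y t m n)"
    and "fpair_deriv y m n t \<le> 2 * pi * y * sinh t * (pi * y * q\<^sup>2 * cosh t * fmode y t m n)"
proof -
  have q: "q \<ge> 0" using assms by (simp add: power_mono)
  have s: "sinh t \<ge> 0" "cosh t \<ge> 0" using assms by auto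
  have "q * cosh t * (fmode y t m n - fmode y t n m) - ((real m)\<^sup>2 + (real n)\<^sup>2) * sinh t * (fmode y t m n + fmode y t n m)
    \<le> q * cosh t * (fmode y t m n - fmode y t n m)"
    using s fmode_pos[of y t] by (simp add: less_imp_le)
  then have 1: "fpair_deriv y m n t \<le> pi * y * (q * cosh t * (fmode y t m n - fmode y t n m))"
    unfolding fpair_deriv_hyperbolic q_def[symmetric] using assms by (intro mult_left_mono) auto
  have "q * cosh t * (fmode y t m n - fmode y t n m) \<le> q * cosh t * fmode y t m n"
    using q s less_imp_le[OF fmode_pos[of y t n m]] by (intro mult_left_mono) auto
  then have "pi * y * (q * cosh t * (fmode y t m n - fmode y t n m)) \<le> pi * y * (q * cosh t * fmode y t m n)"
    by (rule mult_left_mono) (use assms in auto)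
  with 1 show "fpair_deriv y m n t \<le> pi * y * (q * cosh t * fmode y t m n)" by linarith
  have "fmode y t m n - fmode y t n m = fmode y t m n * (1 - exp (- (2 * (pi * y * q * sinh t))))"
    unfolding fmode_swap[of y t n m] q_def by (simp add: algebra_simps)
  also have "\<dots> \<le> fmode y t m n * (2 * (pi * y * q * sinh t))"
    using exp_ge_add_one_self[of "- (2 * (pi * y * q * sinh t))"] fmode_pos[of y t m n]
    by (intro mult_left_mono) auto
  finally have "q * cosh t * (fmode y t m n - fmode y t n m) \<le> q * cosh t * (fmode y t m n * (2 * (pi * y * q * sinh t)))"
    using q s by (intro mult_left_mono) auto
  then have "pi * y * (q * cosh t * (fmode y t m n - fmode y t n m)) \<le> pi * y * (q * cosh t * (fmode y t m n * (2 * (pi * y * q * sinh t))))"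
    by (rule mult_left_mono) (use assms in auto)
  moreover have "pi * y * (q * cosh t * (fmode y t m n * (2 * (pi * y * q * sinh t))))
      = 2 * pi * y * sinh t * (pi * y * q\<^sup>2 * cosh t * fmode y t m n)"
    by (simp add: power2_eq_square)
  ultimately show "fpair_deriv y m n t \<le> 2 * pi * y * sinh t * (pi * y * q\<^sup>2 * cosh t * fmode y t m n)"
    using 1 by linarith
qed

section \<open>Weights of the modes relative to the mode (1,1)\<close>

lemma fmode_ratio:
  "fmode y t m n = fmode y t 1 1 * (exp (- (pi * y * exp t) * ((real m)\<^sup>2 - 1)) * exp (- (pi * y * exp (- t)) * ((real n)\<^sup>2 - 1)))"
  by (simp add: fmode_def exp_add[symmetric] algebra_simps)

text \<open>Equality holds at exp t = 3/2, where cosh t = 13/12 and sinh t = 5/12; the same cut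
  produces the constant in \<open>cosh_le_13_12\<close>.\<close>

lemma cosh_le_sinh:
  fixes t :: real
  assumes "3/2 \<le> exp t"
  shows "cosh t \<le> 26/10 * sinh t"
proof -
  have "(3/2) * (3/2) \<le> exp t * exp t" using assms by (intro mult_mono) auto
  then show ?thesis
    by (simp add: cosh_field_def sinh_field_def exp_minus field_simps power2_eq_square)
qed

lemma cosh_le_13_12:
  fixes t :: real
  assumes "t \<ge> 0" "exp t \<le> 3/2"
  shows "cosh t \<le> 13/12"
proof -
  have "1 \<le> exp t" using assms(1) by simp
  then have "2/3 \<le> exp t" by linarith
  then have "(exp t - 3/2) * (exp t - 2/3) \<le> 0" using assms(2) by (intro mult_nonpos_nonneg) auto
  then show ?thesis
    by (simp add: cosh_field_def exp_minus field_simps power2_eq_square)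
qed

text \<open>With m = k + 1 one has m^2 \<le> 4^k and m^2 - 1 \<ge> 2 k, so exp(2 z) \<ge> 16 leaves
  4^(-k). The bound on z is 3.14 * 0.6.\<close>

lemma m_weight_bound:
  fixes z :: real and m :: nat
  assumes z: "1884/1000 \<le> z" and m: "1 \<le> m"
  shows "(real m)\<^sup>2 * exp (- z * ((real m)\<^sup>2 - 1)) \<le> 4 / 4 ^ m"
proof -
  obtain k where k: "m = Suc k" using m by (cases m) auto
  have 1: "(real m)\<^sup>2 \<le> 4 ^ k"
  proof -
    have "real (Suc k) \<le> 2 ^ k"
      by (metis of_nat_le_iff of_nat_numeral of_nat_power Suc_leI less_exp)
    then have "(real (Suc k))\<^sup>2 \<le> (2 ^ k)\<^sup>2" by (intro power_mono) auto
    moreover have "(2 ^ k)\<^sup>2 = (4::real) ^ k" by (simp add: power2_eq_square power_mult_distrib[symmetric])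
    ultimately show ?thesis by (simp add: k)
  qed
  have "(1105/1000) ^ 37 \<le> exp (2 * z)" using z by (intro exp_ge_power) simp
  then have 16: "16 \<le> exp (2 * z)" by (rule order_trans[rotated]) (simp add: power_divide)
  have "real k * 2 \<le> (real m)\<^sup>2 - 1" by (simp add: k power2_eq_square algebra_simps)
  then have "z * (real k * 2) \<le> z * ((real m)\<^sup>2 - 1)" using z by (intro mult_left_mono) auto
  then have "exp (- z * ((real m)\<^sup>2 - 1)) \<le> exp (real k * - (2 * z))" by (simp add: algebra_simps)
  also have "\<dots> = exp (- (2 * z)) ^ k" by (rule exp_of_nat_mult)
  also have "\<dots> \<le> (1/16) ^ k"
    using 16 by (intro power_mono) (auto simp: exp_minus inverse_eq_divide frac_le)
  finally have 2: "exp (- z * ((real m)\<^sup>2 - 1)) \<le> (1/16) ^ k" .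
  have "(real m)\<^sup>2 * exp (- z * ((real m)\<^sup>2 - 1)) \<le> 4 ^ k * (1/16) ^ k"
    using 1 2 by (intro mult_mono) auto
  also have "\<dots> = 4 / 4 ^ m" using power_mult_distrib[of 4 "4::real" k] by (simp add: k power_divide)
  finally show ?thesis .
qed

text \<open>For n = k + 3, n^2 - 1 \<ge> 8 + 7 k. The ratio 1/28 = 1/7 * 1/4 pays for a polynomial
  that grows at most like 7^k and still leaves 4^(-k).\<close>

lemma n_weight_exp_bound:
  fixes c :: real and n :: nat
  assumes c: "1 \<le> c" and n: "3 \<le> n"
  shows "exp (- c * ((real n)\<^sup>2 - 1)) \<le> exp (- (8 * c)) * (1/28) ^ (n - 3)"
proof -
  obtain k where k: "n = k + 3" using n le_Suc_ex by (metis add.commute)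
  have "real k * 1 \<le> real k * real k" by (cases k) auto
  then have "8 + 7 * real k \<le> (real n)\<^sup>2 - 1" by (simp add: k power2_eq_square algebra_simps)
  then have "c * (8 + 7 * real k) \<le> c * ((real n)\<^sup>2 - 1)" using c by (intro mult_left_mono) auto
  then have "exp (- c * ((real n)\<^sup>2 - 1)) \<le> exp (- (8 * c) + real k * - (7 * c))" by (simp add: algebra_simps)
  also have "\<dots> = exp (- (8 * c)) * exp (- (7 * c)) ^ k" unfolding exp_add exp_of_nat_mult ..
  also have "\<dots> \<le> exp (- (8 * c)) * (1/28) ^ k"
  proof -
    have "exp (- (7 * c)) \<le> 1 / (1105/1000) ^ 70" using c by (intro exp_minus_le_power) simp
    also have "\<dots> \<le> 1/28" by (simp add: power_divide)
    finally show ?thesis by (intro mult_left_mono power_mono) auto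
  qed
  finally show ?thesis by (simp add: k)
qed

lemma n_weight_bound_large:
  fixes c :: real and n :: nat
  assumes c: "108/100 \<le> c" and n: "3 \<le> n"
  shows "26/10 * (real n) ^ 4 * exp (- c * ((real n)\<^sup>2 - 1)) \<le> (15/4) / 4 ^ n"
proof -
  obtain k where k: "n = k + 3" using n le_Suc_ex by (metis add.commute)
  have p: "(real (k + 3)) ^ 4 \<le> 81 * 7 ^ k"
  proof (induction k)
    case (Suc k)
    have "(real (Suc k + 3)) ^ 4 \<le> (4/3 * real (k + 3)) ^ 4" by (intro power_mono) auto
    also have "\<dots> = (4/3) ^ 4 * (real (k + 3)) ^ 4" by (rule power_mult_distrib)
    also have "\<dots> \<le> 7 * (real (k + 3)) ^ 4" by (intro mult_right_mono) (auto simp: power_divide)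
    finally show ?case using Suc by simp
  qed simp
  have "exp (- (8 * c)) \<le> 1 / (1105/1000) ^ 86" using c by (intro exp_minus_le_power) simp
  then have e: "exp (- (8 * c)) \<le> 19/100000" by (rule order_trans) (simp add: power_divide)
  have "26/10 * (real n) ^ 4 * exp (- c * ((real n)\<^sup>2 - 1)) \<le> 26/10 * (81 * 7 ^ k) * (exp (- (8 * c)) * (1/28) ^ k)"
    using p n_weight_exp_bound[OF _ n, of c] c by (intro mult_mono) (auto simp: k)
  also have "\<dots> \<le> 26/10 * (81 * 7 ^ k) * (19/100000 * (1/28) ^ k)"
    using e by (intro mult_left_mono mult_right_mono) auto
  also have "\<dots> = 26/10 * 81 * 19/100000 / 4 ^ k"
    using power_mult_distrib[of 7 "4::real" k] by (simp add: power_divide)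
  also have "\<dots> \<le> (15/4) / 4 ^ n" by (simp add: k power_add field_simps)
  finally show ?thesis .
qed

text \<open>The weight now carries a factor Y, but Y exp(-2/3 Y N) decreases in Y on the range
  considered, so only the endpoint Y0 has to be evaluated. 576 is the value of n^2 (n^2 - 1)^2 at n
  = 3.\<close>

lemma n_weight_bound_small:
  fixes Y c :: real and n :: nat
  assumes Y: "1884/1000 \<le> Y" and n: "3 \<le> n"
  shows "13/12 * Y * ((real n)\<^sup>2 * ((real n)\<^sup>2 - 1)\<^sup>2) * exp (- (2/3 * Y) * ((real n)\<^sup>2 - 1)) \<le> (15/4) / 4 ^ n"
proof -
  define Y0 :: real where "Y0 = 1884/1000"
  obtain k where k: "n = k + 3" using n le_Suc_ex by (metis add.commute)
  define N where "N = (real n)\<^sup>2 - 1"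
  have N: "8 \<le> N" using n power_mono[of 3 "real n" 2] by (simp add: N_def)
  have p: "(real (k + 3))\<^sup>2 * ((real (k + 3))\<^sup>2 - 1)\<^sup>2 \<le> 576 * 7 ^ k"
  proof (induction k)
    case (Suc k)
    define r where "r = real k + 3"
    \<comment> \<open>Since (r + 1)^2 - 1 = r (r + 2) and r^2 - 1 = (r - 1)(r + 1), the growth
      factor of the weight is ((r + 2)/(r - 1))^2, largest at r = 3.\<close>
    have "(r + 2)\<^sup>2 \<le> 7 * (r - 1)\<^sup>2"
    proof -
      have "2 * (r + 2) \<le> 5 * (r - 1)" by (simp add: r_def)
      then have "(2 * (r + 2))\<^sup>2 \<le> (5 * (r - 1))\<^sup>2" by (intro power_mono) (auto simp: r_def)
      then have "4 * (r + 2)\<^sup>2 \<le> 25 * (r - 1)\<^sup>2" unfolding power_mult_distrib by simp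
      then show ?thesis using zero_le_power2[of "r - 1"] by linarith
    qed
    then have "(r * (r + 1))\<^sup>2 * (r + 2)\<^sup>2 \<le> (r * (r + 1))\<^sup>2 * (7 * (r - 1)\<^sup>2)" by (intro mult_left_mono) auto
    then have "(r + 1)\<^sup>2 * ((r + 1)\<^sup>2 - 1)\<^sup>2 \<le> 7 * (r\<^sup>2 * (r\<^sup>2 - 1)\<^sup>2)"
      by (simp add: power2_eq_square algebra_simps)
    then show ?case using Suc by (simp add: r_def add_ac)
  qed simp
  have "exp (- (8 * (2/3 * Y0))) \<le> 1 / (1105/1000) ^ 100" by (intro exp_minus_le_power) (simp add: Y0_def)
  then have e: "exp (- (8 * (2/3 * Y0))) \<le> 4615/100000000" by (rule order_trans) (simp add: power_divide)
  have "Y * exp (- (2/3 * Y) * N) \<le> Y0 * exp (- (2/3 * Y0) * N)"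
  proof -
    have "Y / Y0 \<le> exp (Y / Y0 - 1)" using exp_ge_add_one_self[of "Y / Y0 - 1"] by simp
    also have "\<dots> \<le> exp ((2/3 * N) * (Y - Y0))"
    proof -
      have "Y / Y0 - 1 = (1 / Y0) * (Y - Y0)" by (simp add: Y0_def field_simps)
      also have "\<dots> \<le> (2/3 * N) * (Y - Y0)" using N Y by (intro mult_right_mono) (auto simp: Y0_def)
      finally show ?thesis by simp
    qed
    finally have "Y / Y0 * exp (- (2/3 * Y) * N) \<le> exp ((2/3 * N) * (Y - Y0)) * exp (- (2/3 * Y) * N)"
      by (intro mult_right_mono) auto
    also have "\<dots> = exp (- (2/3 * Y0) * N)" unfolding exp_add[symmetric] by (simp add: field_simps)
    finally show ?thesis by (simp add: Y0_def field_simps)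
  qed
  also have "\<dots> \<le> Y0 * (exp (- (8 * (2/3 * Y0))) * (1/28) ^ k)"
    using n_weight_exp_bound[OF _ n, of "2/3 * Y0"] by (intro mult_left_mono) (auto simp: Y0_def N_def k)
  also have "\<dots> \<le> Y0 * (4615/100000000 * (1/28) ^ k)"
    using e by (intro mult_left_mono mult_right_mono) (auto simp: Y0_def)
  finally have 1: "Y * exp (- (2/3 * Y) * N) \<le> Y0 * (4615/100000000 * (1/28) ^ k)" .
  have p': "(real n)\<^sup>2 * N\<^sup>2 \<le> 576 * 7 ^ k" using p by (simp add: k N_def)
  have "13/12 * Y * ((real n)\<^sup>2 * N\<^sup>2) * exp (- (2/3 * Y) * N)
      = 13/12 * (((real n)\<^sup>2 * N\<^sup>2) * (Y * exp (- (2/3 * Y) * N)))" by simp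
  also have "\<dots> \<le> 13/12 * ((576 * 7 ^ k) * (Y0 * (4615/100000000 * (1/28) ^ k)))"
    by (rule mult_left_mono, rule mult_mono[OF p' 1]) (use Y in auto)
  also have "\<dots> = 13/12 * 576 * Y0 * 4615/100000000 / 4 ^ k"
    using power_mult_distrib[of 7 "4::real" k] by (simp add: power_divide)
  also have "\<dots> \<le> (15/4) / 4 ^ n" by (simp add: k power_add field_simps Y0_def)
  finally show ?thesis by (simp add: N_def)
qed

lemma pi_y_ge: "6/10 \<le> y \<Longrightarrow> 1884/1000 \<le> pi * y"
  using mult_mono[of "314/100" pi "6/10" y] pi_gt_314 by simp

text \<open>For m < n, m^2 + n^2 \<le> (m + n)^2 \<le> (n^2 - m^2)^2, so the weight of the upper
  bound also dominates the lower one.\<close>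

lemma fpair_deriv_bound_small:
  assumes y: "6/10 \<le> y" and t: "0 \<le> t" "exp t \<le> 3/2" and mn: "m < n"
  shows "\<bar>fpair_deriv y m n t\<bar> \<le> 2 * pi * y * sinh t * (13/12 * (pi * y) * ((real n)\<^sup>2 - (real m)\<^sup>2)\<^sup>2 * fmode y t m n)"
proof -
  define q where "q = (real n)\<^sup>2 - (real m)\<^sup>2"
  have q: "(real m)\<^sup>2 + (real n)\<^sup>2 \<le> q\<^sup>2"
  proof -
    have "1 * (real n + real m) \<le> (real n - real m) * (real n + real m)" using mn by (intro mult_right_mono) auto
    then have "(real n + real m)\<^sup>2 \<le> q\<^sup>2" by (intro power_mono) (auto simp: q_def power2_eq_square algebra_simps)
    moreover have "(real m)\<^sup>2 + (real n)\<^sup>2 \<le> (real n + real m)\<^sup>2" by (simp add: power2_eq_square algebra_simps)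
    ultimately show ?thesis by linarith
  qed
  have "1 * q\<^sup>2 \<le> (13/12 * (pi * y)) * q\<^sup>2" using pi_y_ge[OF y] by (intro mult_right_mono) auto
  with q have "(real m)\<^sup>2 + (real n)\<^sup>2 \<le> 13/12 * (pi * y) * q\<^sup>2" by simp
  then have "((real m)\<^sup>2 + (real n)\<^sup>2) * fmode y t m n \<le> 13/12 * (pi * y) * q\<^sup>2 * fmode y t m n"
    by (intro mult_right_mono less_imp_le[OF fmode_pos])
  then have "2 * pi * y * sinh t * (((real m)\<^sup>2 + (real n)\<^sup>2) * fmode y t m n) \<le> 2 * pi * y * sinh t * (13/12 * (pi * y) * q\<^sup>2 * fmode y t m n)"
    by (rule mult_left_mono) (use y t in auto)
  with fpair_deriv_lower[of y t m n] y t mn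
  have lo: "- fpair_deriv y m n t \<le> 2 * pi * y * sinh t * (13/12 * (pi * y) * q\<^sup>2 * fmode y t m n)" by linarith
  have "(pi * y * q\<^sup>2 * fmode y t m n) * cosh t \<le> (pi * y * q\<^sup>2 * fmode y t m n) * (13/12)"
    by (intro mult_left_mono cosh_le_13_12 t) (use y less_imp_le[OF fmode_pos] in auto)
  then have "pi * y * q\<^sup>2 * cosh t * fmode y t m n \<le> 13/12 * (pi * y) * q\<^sup>2 * fmode y t m n"
    by (simp add: mult_ac)
  then have "2 * pi * y * sinh t * (pi * y * q\<^sup>2 * cosh t * fmode y t m n) \<le> 2 * pi * y * sinh t * (13/12 * (pi * y) * q\<^sup>2 * fmode y t m n)"
    by (rule mult_left_mono) (use y t in auto)
  with fpair_deriv_upper(2)[of y t m n] y t mn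
  have "fpair_deriv y m n t \<le> 2 * pi * y * sinh t * (13/12 * (pi * y) * q\<^sup>2 * fmode y t m n)"
    unfolding q_def by linarith
  with lo show ?thesis unfolding q_def by (intro abs_leI)
qed

lemma fpair_deriv_upper_large:
  assumes y: "6/10 \<le> y" and t: "0 \<le> t" "3/2 \<le> exp t" and mn: "m \<le> n"
  shows "fpair_deriv y m n t \<le> 2 * pi * y * sinh t * (13/10 * ((real n)\<^sup>2 - (real m)\<^sup>2) * fmode y t m n)"
proof -
  define q where "q = (real n)\<^sup>2 - (real m)\<^sup>2"
  have q: "0 \<le> q" using mn by (simp add: q_def power_mono)
  have "(pi * y * q * fmode y t m n) * cosh t \<le> (pi * y * q * fmode y t m n) * (26/10 * sinh t)"
    by (intro mult_left_mono cosh_le_sinh t) (use y q less_imp_le[OF fmode_pos] in auto)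
  moreover have "pi * y * (q * cosh t * fmode y t m n) = (pi * y * q * fmode y t m n) * cosh t" by simp
  moreover have "(pi * y * q * fmode y t m n) * (26/10 * sinh t) = 2 * pi * y * sinh t * (13/10 * q * fmode y t m n)" by simp
  ultimately show ?thesis
    using fpair_deriv_upper(1)[of y t m n] y t mn unfolding q_def by linarith
qed

lemma fpair_deriv_bound_large:
  assumes y: "6/10 \<le> y" and t: "0 \<le> t" "3/2 \<le> exp t" and mn: "m \<le> n"
  shows "\<bar>fpair_deriv y m n t\<bar> \<le> 2 * pi * y * sinh t * (13/10 * ((real m)\<^sup>2 + (real n)\<^sup>2) * fmode y t m n)"
proof -
  have "2 * pi * y * sinh t * (13/10 * ((real n)\<^sup>2 - (real m)\<^sup>2) * fmode y t m n)
      \<le> 2 * pi * y * sinh t * (13/10 * ((real m)\<^sup>2 + (real n)\<^sup>2) * fmode y t m n)"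
    by (rule mult_left_mono, rule mult_right_mono) (use y t less_imp_le[OF fmode_pos] in auto)
  moreover have "2 * pi * y * sinh t * (((real m)\<^sup>2 + (real n)\<^sup>2) * fmode y t m n)
      \<le> 2 * pi * y * sinh t * (13/10 * ((real m)\<^sup>2 + (real n)\<^sup>2) * fmode y t m n)"
    by (rule mult_left_mono, rule mult_right_mono) (use y t less_imp_le[OF fmode_pos] in auto)
  ultimately show ?thesis
    using fpair_deriv_upper_large[OF assms] fpair_deriv_lower[of y t m n] y t mn by (intro abs_leI) linarith+
qed

text \<open>The rate in n is controlled by the end of the regime, 3.14 * 10/29 > 1.08; the rate in m
  is controlled by the least height, 3.14 * 6/10.\<close>

lemma regime_rates:
  assumes y: "6/10 \<le> y" and t: "0 \<le> t" "exp t \<le> 29/10 * y"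
  shows "1884/1000 \<le> pi * y * exp t" and "108/100 \<le> pi * y * exp (- t)"
    and "exp t \<le> 3/2 \<Longrightarrow> 2/3 * (pi * y) \<le> pi * y * exp (- t)"
proof -
  have "1884/1000 \<le> pi * y * 1" using pi_y_ge[OF y] by simp
  also have "\<dots> \<le> pi * y * exp t" using y t by (intro mult_left_mono) auto
  finally show "1884/1000 \<le> pi * y * exp t" .
  have "10/29 \<le> y * exp (- t)" using t by (simp add: exp_minus field_simps)
  then have "314/100 * (10/29) \<le> pi * (y * exp (- t))" using pi_gt_314 by (intro mult_mono) auto
  then show "108/100 \<le> pi * y * exp (- t)" by simp
  assume "exp t \<le> 3/2"
  then have "2/3 \<le> exp (- t)" by (simp add: exp_minus field_simps)
  then have "pi * y * (2/3) \<le> pi * y * exp (- t)" using y by (intro mult_left_mono) auto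
  then show "2/3 * (pi * y) \<le> pi * y * exp (- t)" by simp
qed

text \<open>The factor m^2 n^2 is the growth permitted to the coefficients. The bound 15 / 4^(m+n)
  is 4 / 4^m from the decay in m times (15/4) / 4^n from the decay in n. The latter is available for
  n \<ge> 3, which leaves only the pair (2,2) to be estimated by hand.\<close>

lemma fpair_deriv_weighted_bound:
  assumes y: "6/10 \<le> y" and t: "0 \<le> t" "exp t \<le> 29/10 * y"
    and mn: "1 \<le> m" "m \<le> n" "(m, n) \<noteq> (1, 1)" "(m, n) \<noteq> (1, 2)"
  shows "(real m)\<^sup>2 * (real n)\<^sup>2 * \<bar>fpair_deriv y m n t\<bar> \<le> 15 / 4 ^ (m + n) * (2 * pi * y * sinh t * fmode y t 1 1)"
proof -
  note r = regime_rates[OF y t]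
  define P where "P = exp (- (pi * y * exp t) * ((real m)\<^sup>2 - 1))"
  define Q where "Q = exp (- (pi * y * exp (- t)) * ((real n)\<^sup>2 - 1))"
  define J where "J = 2 * pi * y * sinh t * fmode y t 1 1"
  have J: "J \<ge> 0" unfolding J_def using y t less_imp_le[OF fmode_pos] by simp
  have fmode: "fmode y t m n = fmode y t 1 1 * (P * Q)" unfolding P_def Q_def by (rule fmode_ratio)
  have P0: "P > 0" "Q > 0" by (auto simp: P_def Q_def)
  have pm: "(real m)\<^sup>2 * P \<le> 4 / 4 ^ m" unfolding P_def by (rule m_weight_bound[OF r(1) mn(1)])
  have n1: "(real n)\<^sup>2 - 1 \<ge> 0" using mn by simp
  have concl: ?thesis if V: "\<bar>fpair_deriv y m n t\<bar> \<le> 2 * pi * y * sinh t * (V * fmode y t m n)" and nV: "(real n)\<^sup>2 * V * Q \<le> (15/4) / 4 ^ n" for V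
  proof -
    have "(real m)\<^sup>2 * (real n)\<^sup>2 * \<bar>fpair_deriv y m n t\<bar> \<le> (real m)\<^sup>2 * (real n)\<^sup>2 * (2 * pi * y * sinh t * (V * fmode y t m n))"
      by (rule mult_left_mono[OF V]) simp
    also have "\<dots> = J * (((real m)\<^sup>2 * P) * ((real n)\<^sup>2 * V * Q))"
      unfolding fmode J_def by (simp only: mult_ac)
    also have "\<dots> \<le> J * ((4 / 4 ^ m) * ((15/4) / 4 ^ n))"
    proof (rule mult_left_mono[OF _ J])
      have "((real m)\<^sup>2 * P) * ((real n)\<^sup>2 * V * Q) \<le> ((real m)\<^sup>2 * P) * ((15/4) / 4 ^ n)"
        by (rule mult_left_mono[OF nV]) (use P0 in auto)
      also have "\<dots> \<le> (4 / 4 ^ m) * ((15/4) / 4 ^ n)"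
        by (rule mult_right_mono[OF pm]) simp
      finally show "((real m)\<^sup>2 * P) * ((real n)\<^sup>2 * V * Q) \<le> (4 / 4 ^ m) * ((15/4) / 4 ^ n)" .
    qed
    also have "\<dots> = 15 / 4 ^ (m + n) * (2 * pi * y * sinh t * fmode y t 1 1)"
      by (simp add: J_def power_add)
    finally show ?thesis .
  qed
  show ?thesis
  proof (cases "n \<ge> 3")
    case True
    show ?thesis
    proof (cases "exp t \<le> 3/2")
      case A: True
      have "Q \<le> exp (- (2/3 * (pi * y)) * ((real n)\<^sup>2 - 1))"
        unfolding Q_def using mult_right_mono[OF r(3)[OF A] n1] by simp
      have mn': "m < n \<or> m = n" using mn by auto
      \<comment> \<open>One weight for m < n and for m = n: it covers (n^2 - m^2)^2 as m \<ge> 1,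
        and also the 2 n^2 of the diagonal as n \<ge> 3.\<close>
      define V where "V = 13/12 * (pi * y) * ((real n)\<^sup>2 - 1)\<^sup>2"
      have py: "1884/1000 \<le> pi * y" by (rule pi_y_ge[OF y])
      have "(real n)\<^sup>2 * V * Q \<le> (real n)\<^sup>2 * V * exp (- (2/3 * (pi * y)) * ((real n)\<^sup>2 - 1))"
        using \<open>Q \<le> _\<close> by (rule mult_left_mono) (use y in \<open>auto simp: V_def\<close>)
      also have "\<dots> = 13/12 * (pi * y) * ((real n)\<^sup>2 * ((real n)\<^sup>2 - 1)\<^sup>2) * exp (- (2/3 * (pi * y)) * ((real n)\<^sup>2 - 1))"
        by (simp add: V_def mult_ac)
      also have "\<dots> \<le> (15/4) / 4 ^ n" by (rule n_weight_bound_small[OF py True])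
      finally have nV: "(real n)\<^sup>2 * V * Q \<le> (15/4) / 4 ^ n" .
      have "\<bar>fpair_deriv y m n t\<bar> \<le> 2 * pi * y * sinh t * (V * fmode y t m n)"
      proof (cases "m < n")
        case lt: True
        have "((real n)\<^sup>2 - (real m)\<^sup>2)\<^sup>2 \<le> ((real n)\<^sup>2 - 1)\<^sup>2"
          using mn by (intro power_mono) (auto simp: power_mono)
        then have "13/12 * (pi * y) * ((real n)\<^sup>2 - (real m)\<^sup>2)\<^sup>2 \<le> V"
          unfolding V_def by (rule mult_left_mono) (use y in auto)
        then have "2 * pi * y * sinh t * (13/12 * (pi * y) * ((real n)\<^sup>2 - (real m)\<^sup>2)\<^sup>2 * fmode y t m n) \<le> 2 * pi * y * sinh t * (V * fmode y t m n)"
          by (intro mult_left_mono mult_right_mono less_imp_le[OF fmode_pos]) (use y t in auto)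
        with fpair_deriv_bound_small[OF y t(1) A lt] show ?thesis by linarith
      next
        case False
        then have m: "m = n" using mn by simp
        have "fpair_deriv y m n t \<le> 0" unfolding fpair_deriv_hyperbolic m using y t less_imp_le[OF fmode_pos[of y t n n]]
          by (simp add: mult_nonneg_nonneg)
        moreover have "((real m)\<^sup>2 + (real n)\<^sup>2) \<le> V"
        proof -
          have "9 \<le> (real n)\<^sup>2" using True power_mono[of 3 "real n" 2] by simp
          then have "2 * (real n)\<^sup>2 \<le> 8 * ((real n)\<^sup>2 - 1)" by simp
          also have "\<dots> \<le> ((real n)\<^sup>2 - 1) * ((real n)\<^sup>2 - 1)" using \<open>9 \<le> (real n)\<^sup>2\<close> by (intro mult_right_mono) auto
          also have "\<dots> = 1 * ((real n)\<^sup>2 - 1)\<^sup>2" by (simp add: power2_eq_square)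
          also have "\<dots> \<le> V" unfolding V_def by (rule mult_right_mono) (use py in auto)
          finally show ?thesis by (simp add: m)
        qed
        then have "2 * pi * y * sinh t * (((real m)\<^sup>2 + (real n)\<^sup>2) * fmode y t m n) \<le> 2 * pi * y * sinh t * (V * fmode y t m n)"
          by (intro mult_left_mono mult_right_mono less_imp_le[OF fmode_pos]) (use y t in auto)
        ultimately show ?thesis using fpair_deriv_lower[of y t m n] y t mn by linarith
      qed
      from concl[OF this nV] show ?thesis .
    next
      case False
      define V where "V = 26/10 * (real n)\<^sup>2"
      have "(real n)\<^sup>2 * V * Q = 26/10 * (real n) ^ 4 * Q" by (simp add: V_def power4_eq_xxxx power2_eq_square)
      also have "\<dots> \<le> (15/4) / 4 ^ n" unfolding Q_def by (rule n_weight_bound_large[OF r(2) True])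
      finally have nV: "(real n)\<^sup>2 * V * Q \<le> (15/4) / 4 ^ n" .
      have "(real m)\<^sup>2 \<le> (real n)\<^sup>2" using mn by (intro power_mono) auto
      then have "13/10 * ((real m)\<^sup>2 + (real n)\<^sup>2) \<le> V" by (simp add: V_def)
      then have "2 * pi * y * sinh t * (13/10 * ((real m)\<^sup>2 + (real n)\<^sup>2) * fmode y t m n) \<le> 2 * pi * y * sinh t * (V * fmode y t m n)"
        by (intro mult_left_mono mult_right_mono less_imp_le[OF fmode_pos]) (use y t in auto)
      with fpair_deriv_bound_large[of y t m n] y t mn False have "\<bar>fpair_deriv y m n t\<bar> \<le> 2 * pi * y * sinh t * (V * fmode y t m n)"
        by linarith
      from concl[OF this nV] show ?thesis .
    qed
  next
    case False
    then have mn2: "m = 2" "n = 2" using mn by (cases n; cases m; force)+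
    have "fpair_deriv y 2 2 t \<le> 0" unfolding fpair_deriv_hyperbolic using y t less_imp_le[OF fmode_pos[of y t 2 2]]
      by (simp add: mult_nonneg_nonneg)
    then have V: "\<bar>fpair_deriv y m n t\<bar> \<le> 2 * pi * y * sinh t * (8 * fmode y t m n)"
      using fpair_deriv_lower[of y t 2 2] y t by (simp add: mn2)
    \<comment> \<open>For m = n = 2 the two exponents combine to 6 pi y cosh t. The target is 16 * 8
      * P * Q \<le> 15/256, with 16 from m^2 n^2 and 8 from m^2 + n^2.\<close>
    have "P * Q \<le> 2 / 10000"
    proof -
      have c: "cosh t \<ge> 1" by (rule cosh_real_ge_1)
      have "P * Q = exp (- (6 * (pi * y) * cosh t))"
        by (simp add: P_def Q_def mn2 exp_add[symmetric] cosh_field_def algebra_simps)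
      also have "\<dots> \<le> 1 / (1105/1000) ^ 113"
      proof (rule exp_minus_le_power)
        have "113/10 \<le> 6 * (pi * y) * 1" using pi_y_ge[OF y] by simp
        also have "\<dots> \<le> 6 * (pi * y) * cosh t" using c y by (intro mult_left_mono) auto
        finally show "real 113 / 10 \<le> 6 * (pi * y) * cosh t" by simp
      qed
      also have "\<dots> \<le> 2 / 10000" by (simp add: power_divide)
      finally show ?thesis .
    qed
    then have "16 * 8 * (P * Q) \<le> 15 / 4 ^ (m + n)" by (simp add: mn2)
    then have "J * (16 * 8 * (P * Q)) \<le> J * (15 / 4 ^ (m + n))" by (rule mult_left_mono[OF _ J])
    moreover have "(real m)\<^sup>2 * (real n)\<^sup>2 * \<bar>fpair_deriv y m n t\<bar> \<le> J * (16 * 8 * (P * Q))"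
      using mult_left_mono[OF V, of "(real m)\<^sup>2 * (real n)\<^sup>2"] unfolding fmode by (simp add: J_def mn2 mult_ac)
    ultimately show ?thesis by (simp add: J_def mult.commute)
  qed
qed

text \<open>The pair $(1,2)$ is the critical one: a coefficient down to $-4$ times that of the mode $(1,1)$ must be absorbed
  when it is negative, but only up to once that coefficient when it is positive.\<close>

lemma fpair_deriv_12:
  assumes y: "6/10 \<le> y" and t: "0 \<le> t" "exp t \<le> 29/10 * y"
  shows "4 * (- fpair_deriv y 1 2 t) \<le> 82/100 * (2 * pi * y * sinh t * fmode y t 1 1)"
    and "fpair_deriv y 1 2 t \<le> 82/100 * (2 * pi * y * sinh t * fmode y t 1 1)"
proof -
  note r = regime_rates[OF y t]
  define Q where "Q = exp (- (3 * (pi * y * exp (- t))))"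
  define J where "J = 2 * pi * y * sinh t * fmode y t 1 1"
  have J: "J \<ge> 0" unfolding J_def using y t less_imp_le[OF fmode_pos] by simp
  have fmode: "fmode y t 1 2 = fmode y t 1 1 * Q"
    using fmode_ratio[of y t 1 2] by (simp add: Q_def mult_ac)
  have Q0: "Q > 0" by (simp add: Q_def)
  \<comment> \<open>41/1000 is what makes 4 * 5 * Q at most 82/100, where 5 = 1^2 + 2^2.\<close>
  have "Q \<le> 1 / (1105/1000) ^ 32"
    unfolding Q_def by (rule exp_minus_le_power) (use r(2) in simp)
  also have "\<dots> \<le> 41/1000" by (simp add: power_divide)
  finally have Q: "Q \<le> 41/1000" .
  have "4 * (- fpair_deriv y 1 2 t) \<le> 4 * (2 * pi * y * sinh t * (5 * fmode y t 1 2))"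
    using fpair_deriv_lower[of y t 1 2] y t by simp
  also have "\<dots> = J * (20 * Q)" unfolding fmode J_def by (simp add: mult_ac)
  also have "\<dots> \<le> J * (82/100)" using Q by (intro mult_left_mono J) auto
  finally show "4 * (- fpair_deriv y 1 2 t) \<le> 82/100 * (2 * pi * y * sinh t * fmode y t 1 1)"
    by (simp add: J_def mult.commute)
  have V: "fpair_deriv y 1 2 t \<le> 82/100 * J" if "fpair_deriv y 1 2 t \<le> 2 * pi * y * sinh t * (V * fmode y t 1 2)" "V * Q \<le> 82/100" for V
  proof -
    have "fpair_deriv y 1 2 t \<le> J * (V * Q)" using that(1) unfolding fmode J_def by (simp add: mult_ac)
    also have "\<dots> \<le> J * (82/100)" using that(2) by (intro mult_left_mono J)
    finally show ?thesis by (simp add: mult.commute)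
  qed
  show "fpair_deriv y 1 2 t \<le> 82/100 * (2 * pi * y * sinh t * fmode y t 1 1)"
    unfolding J_def[symmetric]
  proof (cases "exp t \<le> 3/2")
    case A: True
    have py: "1884/1000 \<le> pi * y" by (rule pi_y_ge[OF y])
    have "Q \<le> exp (- (2 * (pi * y)))" unfolding Q_def using r(3)[OF A] by simp
    then have "(pi * y) * Q \<le> (pi * y) * exp (- (2 * (pi * y)))" using y by (intro mult_left_mono) auto
    also have "\<dots> \<le> 1884/1000 * exp (- (2 * (1884/1000)))"
    proof -
      define u where "u = pi * y - 1884/1000"
      have u: "u \<ge> 0" using py by (simp add: u_def)
      have "1 + u \<le> exp u" by (rule exp_ge_add_one_self)
      also have "\<dots> \<le> exp (2 * u)" using u by simp
      finally have "(1884/1000 + u) * exp (- (2 * u)) \<le> 1884/1000 * exp (2 * u) * exp (- (2 * u))"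
        using u by (intro mult_right_mono) auto
      also have "\<dots> = 1884/1000" by (simp add: exp_add[symmetric])
      finally have "(1884/1000 + u) * exp (- (2 * u)) * E \<le> 1884/1000 * E"
        if "E \<ge> 0" for E using that by (rule mult_right_mono)
      then have le: "(1884/1000 + u) * exp (- (2 * u)) * exp (- (2 * (1884/1000))) \<le> 1884/1000 * exp (- (2 * (1884/1000)))"
        by simp
      have "- (2 * (pi * y)) = - (2 * u) + - (2 * (1884/1000))" by (simp add: u_def)
      then have "pi * y * exp (- (2 * (pi * y))) = (1884/1000 + u) * exp (- (2 * u)) * exp (- (2 * (1884/1000)))"
        by (simp only: exp_add) (simp add: u_def)
      with le show ?thesis by (simp only:)
    qed
    also have "\<dots> \<le> 1884/1000 * (1 / (1105/1000) ^ 37)"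
      by (intro mult_left_mono exp_minus_le_power) auto
    also have "\<dots> \<le> 48/1000" by (simp add: power_divide)
    finally have "pi * y * Q \<le> 48/1000" .
    moreover have "13/12 * (pi * y) * 9 * Q = 117/12 * (pi * y * Q)" by simp
    ultimately have "13/12 * (pi * y) * 9 * Q \<le> 82/100" by linarith
    then show "fpair_deriv y 1 2 t \<le> 82/100 * J"
      using fpair_deriv_bound_small[OF y t(1) A, of 1 2] by (intro V[of "13/12 * (pi * y) * 9"]) auto
  next
    case False
    have "fpair_deriv y 1 2 t \<le> 2 * pi * y * sinh t * (13/10 * ((real 2)\<^sup>2 - (real 1)\<^sup>2) * fmode y t 1 2)"
      using False by (intro fpair_deriv_upper_large[OF y t(1)]) auto
    then show "fpair_deriv y 1 2 t \<le> 82/100 * J"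
      using Q by (intro V[of "39/10"]) auto
  qed
qed

text \<open>This is how termwise increments are added up: c is the reference increment, and in the
  applications the total weight W is negative.\<close>

lemma has_sum_le_diff:
  fixes f g w :: "'a \<Rightarrow> real"
  assumes "(f has_sum F) A" "(g has_sum G) A" "(w has_sum W) A"
    and "\<And>i. i \<in> A \<Longrightarrow> f i - g i \<le> w i * c"
  shows "F - G \<le> W * c"
  by (rule has_sum_mono[OF has_sum_real_diff[OF assms(1,2)] has_sum_cmult_left[OF assms(3)]]) (use assms(4) in auto)

lemma geometric_has_sum_from_1:
  assumes "0 \<le> r" "r < (1::real)"
  shows "((\<lambda>n::nat. r ^ n) has_sum (r / (1 - r))) {1..}"
proof -
  have "((\<lambda>n::nat. r * r ^ n) has_sum (r * (1 / (1 - r)))) UNIV"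
    using assms geometric_sums[of r]
    by (intro has_sum_cmult_right sums_nonneg_imp_has_sum) auto
  moreover have "bij_betw Suc UNIV {1..}"
    by (rule bij_betwI[where g = "\<lambda>n. n - 1"]) auto
  ultimately show ?thesis
    using has_sum_reindex_bij_betw[of Suc UNIV "{1..}" "\<lambda>n. r ^ n"] by simp
qed

lemma fmode_11_antimono: "0 < y \<Longrightarrow> 0 \<le> s \<Longrightarrow> s \<le> t \<Longrightarrow> fmode y t 1 1 \<le> fmode y s 1 1"
  and fmode_11_strict: "0 < y \<Longrightarrow> 0 \<le> s \<Longrightarrow> s < t \<Longrightarrow> fmode y t 1 1 < fmode y s 1 1"
proof -
  have eq: "fmode y t 1 1 = exp (- (2 * pi * y * cosh t))" for t
    by (simp add: fmode_def cosh_field_def algebra_simps)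
  show "0 < y \<Longrightarrow> 0 \<le> s \<Longrightarrow> s \<le> t \<Longrightarrow> fmode y t 1 1 \<le> fmode y s 1 1"
    unfolding eq using cosh_real_nonneg_le_iff[of s t] by simp
  show "0 < y \<Longrightarrow> 0 \<le> s \<Longrightarrow> s < t \<Longrightarrow> fmode y t 1 1 < fmode y s 1 1"
    unfolding eq using cosh_real_nonneg_less_iff[of s t] by simp
qed

text \<open>The modes other than $(1,1)$ have total weight below $1$ relative to it: $82/100$ from the two modes with $mn = 2$,
  the rest from the geometric majorant $\frac{15}{2} 4^{-(m+n)}$.\<close>

lemma offdiagonal_antimono:
  fixes d :: "nat \<Rightarrow> nat \<Rightarrow> real"
  assumes y: "6/10 \<le> y" and st: "0 \<le> s" "s \<le> t" "exp t \<le> 29/10 * y"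
    and sym: "\<And>m n. d m n = d n m"
    and bd: "\<And>m n. 1 \<le> m \<Longrightarrow> 1 \<le> n \<Longrightarrow> \<bar>d m n\<bar> \<le> (real m)\<^sup>2 * (real n)\<^sup>2 * d 1 1"
    and d12: "d 1 2 \<le> d 1 1"
    and summ: "\<And>u. (\<lambda>(m, n). fmode y u m n * d m n) summable_on ({1..} \<times> {1..})"
  shows "(\<Sum>\<^sub>\<infinity>(m, n)\<in>{1..}\<times>{1..}. fmode y t m n * d m n) - (\<Sum>\<^sub>\<infinity>(m, n)\<in>{1..}\<times>{1..}. fmode y s m n * d m n)
    \<le> - (d 1 1 * (fmode y s 1 1 - fmode y t 1 1)) / 100"
proof -
  let ?A = "{1::nat..} \<times> {1::nat..}"
  define S where "S = (\<lambda>u. \<Sum>\<^sub>\<infinity>(m, n)\<in>?A. fmode y u m n * d m n)"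
  define c where "c = d 1 1 * (fmode y s 1 1 - fmode y t 1 1)"
  \<comment> \<open>Corrections to the geometric majorant, whose values 15/32 and 15/128 are taken
    out: the resulting weights are -1 at (1,1) and 41/100 at (1,2) and (2,1), the latter being half
    of 82/100 because each pair is counted twice.\<close>
  define e where "e = (\<lambda>(m::nat, n::nat). if (m, n) = (1, 1) then - 1 - 15/32 else
      if (m, n) = (1, 2) \<or> (m, n) = (2, 1) then 41/100 - 15/128 else (0::real))"
  define w where "w = (\<lambda>(m::nat, n::nat). 15/2 * ((1/4) ^ m * (1/4) ^ n) + e (m, n))"
  have d11: "0 \<le> d 1 1" using bd[of 1 1] by simp
  have y0: "0 < y" using y by simp
  have c0: "0 \<le> c" unfolding c_def using fmode_11_antimono[OF y0 st(1,2)] d11 by simp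
  have S: "((\<lambda>(m, n). 1/2 * (d m n * fpair y m n u)) has_sum S u) ?A" for u
  proof -
    have 1: "((\<lambda>(m, n). fmode y u m n * d m n) has_sum S u) ?A"
      unfolding S_def by (rule has_sum_infsum[OF summ])
    then have "((\<lambda>(m, n). fmode y u n m * d n m) has_sum S u) ?A"
      using has_sum_swap[THEN iffD1, OF 1] by simp
    from has_sum_cmult_right[OF has_sum_add[OF 1 this], of "1/2"]
    have "((\<lambda>i. 1/2 * ((case i of (m, n) \<Rightarrow> fmode y u m n * d m n) + (case i of (m, n) \<Rightarrow> fmode y u n m * d n m))) has_sum S u) ?A"
      by simp
    moreover have "(\<lambda>i. 1/2 * ((case i of (m, n) \<Rightarrow> fmode y u m n * d m n) + (case i of (m, n) \<Rightarrow> fmode y u n m * d n m)))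
       = (\<lambda>(m, n). 1/2 * (d m n * fpair y m n u))"
      by (auto simp: fpair_def fun_eq_iff sym[of _ _] algebra_simps split: prod.split)
    ultimately show ?thesis by simp
  qed
  have g: "((\<lambda>(m, n). (1/4) ^ m * (1/4) ^ n) has_sum (1/3 * (1/3 :: real))) ?A"
  proof (rule has_sum_SigmaI)
    show "((\<lambda>n. case (m, n) of (m, n) \<Rightarrow> (1/4) ^ m * (1/4) ^ n) has_sum ((1/4) ^ m * (1/3 :: real))) {1::nat..}" for m :: nat
      unfolding prod.case using geometric_has_sum_from_1[of "1/4"] by (intro has_sum_cmult_right) simp
    show g1: "((\<lambda>m::nat. (1/4) ^ m * (1/3 :: real)) has_sum (1/3 * (1/3))) {1..}"
      using geometric_has_sum_from_1[of "1/4"] by (intro has_sum_cmult_left) simp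
    show "(\<lambda>(m, n). (1/4) ^ m * (1/4 :: real) ^ n) summable_on ?A"
    proof (rule summable_on_SigmaI)
      show "((\<lambda>n. case (m, n) of (m, n) \<Rightarrow> (1/4) ^ m * (1/4) ^ n) has_sum ((1/4) ^ m * (1/3 :: real))) {1::nat..}" for m :: nat
        unfolding prod.case using geometric_has_sum_from_1[of "1/4"] by (intro has_sum_cmult_right) simp
      show "(\<lambda>m::nat. (1/4) ^ m * (1/3 :: real)) summable_on {1..}"
        by (rule has_sum_imp_summable[OF g1])
    qed auto
  qed
  have e: "(e has_sum (- 1 - 15/32 + (41/100 - 15/128) + (41/100 - 15/128))) ?A"
    by (rule has_sum_finite_neutralI[of "{(1,1), (1,2), (2,1)}"]) (auto simp: e_def split: if_splits)
  have w: "(w has_sum (15/2 * (1/3 * (1/3)) + (- 1 - 15/32 + (41/100 - 15/128) + (41/100 - 15/128)))) ?A"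
    using has_sum_add[OF has_sum_cmult_right[OF g, of "15/2"] e]
    by (simp add: w_def case_prod_unfold)
  have wsym: "w (m, n) = w (n, m)" for m n
    by (auto simp: w_def e_def)
  have key: "d m n * fpair_deriv y m n u \<le> 2 * w (m, n) * d 1 1 * (2 * pi * y * sinh u * fmode y u 1 1)"
    if "1 \<le> m" "m \<le> n" "0 \<le> u" "u \<le> t" for m n u
  proof -
    define P where "P = 2 * pi * y * sinh u * fmode y u 1 1"
    have P: "P \<ge> 0" unfolding P_def using y that less_imp_le[OF fmode_pos] by simp
    have eu: "exp u \<le> 29/10 * y" using that st by (meson exp_le_cancel_iff order_trans)
    consider "(m, n) = (1, 1)" | "(m, n) = (1, 2)" | "(m, n) \<noteq> (1, 1)" "(m, n) \<noteq> (1, 2)" by blast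
    then show ?thesis
    proof cases
      case 1
      have "fpair_deriv y 1 1 u = - 2 * P" by (simp add: fpair_deriv_hyperbolic P_def)
      then show ?thesis using 1 by (simp add: w_def e_def P_def)
    next
      case 2
      have K: "4 * (- fpair_deriv y 1 2 u) \<le> 82/100 * P" "fpair_deriv y 1 2 u \<le> 82/100 * P"
        using fpair_deriv_12[OF y that(3) eu] by (simp_all add: P_def)
      have "d 1 2 * fpair_deriv y 1 2 u \<le> d 1 1 * (82/100 * P)"
      proof (cases "0 \<le> d 1 2")
        case True
        have "d 1 2 * fpair_deriv y 1 2 u \<le> d 1 2 * (82/100 * P)" by (rule mult_left_mono[OF K(2) True])
        also have "\<dots> \<le> d 1 1 * (82/100 * P)" using d12 P by (intro mult_right_mono) auto
        finally show ?thesis .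
      next
        case False
        have "- d 1 2 \<le> 4 * d 1 1" using bd[of 1 2] by simp
        have "d 1 2 * fpair_deriv y 1 2 u = (- d 1 2) * (- fpair_deriv y 1 2 u)" by simp
        also have "\<dots> \<le> (- d 1 2) * (82/100 * P / 4)" using K(1) False by (intro mult_left_mono) auto
        also have "\<dots> \<le> (4 * d 1 1) * (82/100 * P / 4)" using \<open>- d 1 2 \<le> 4 * d 1 1\<close> P by (intro mult_right_mono) auto
        finally show ?thesis by (simp add: mult_ac)
      qed
      then have "d 1 2 * fpair_deriv y 1 2 u \<le> 2 * (41/100) * d 1 1 * P" by (simp add: mult_ac)
      moreover have "m = 1" "n = 2" using 2 by auto
      moreover have "w (1, 2) = 41/100" by (simp add: w_def e_def power2_eq_square)
      ultimately show ?thesis unfolding P_def by metis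
    next
      case 3
      have "(m, n) \<noteq> (2, 1)" using that by auto
      with 3 have wv: "w (m, n) = 15/2 / 4 ^ (m + n)" by (simp add: w_def e_def power_add power_divide)
      have "d m n * fpair_deriv y m n u \<le> \<bar>d m n\<bar> * \<bar>fpair_deriv y m n u\<bar>" by (metis abs_ge_self abs_mult)
      also have "\<dots> \<le> ((real m)\<^sup>2 * (real n)\<^sup>2 * d 1 1) * \<bar>fpair_deriv y m n u\<bar>"
        using that by (intro mult_right_mono bd) auto
      also have "\<dots> = d 1 1 * ((real m)\<^sup>2 * (real n)\<^sup>2 * \<bar>fpair_deriv y m n u\<bar>)" by simp
      also have "\<dots> \<le> d 1 1 * (15 / 4 ^ (m + n) * P)"
        unfolding P_def by (intro mult_left_mono fpair_deriv_weighted_bound[OF y that(3) eu that(1,2) 3] d11)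
      finally show ?thesis by (simp add: wv P_def mult_ac)
    qed
  qed
  have diff: "1/2 * (d m n * fpair y m n t) - 1/2 * (d m n * fpair y m n s) \<le> w (m, n) * c"
    if "1 \<le> m" "1 \<le> n" for m n
  proof -
    \<comment> \<open>Adding this multiple of the mode (1,1) makes a single pair nonincreasing, so
      the derivative bound \<open>key\<close> becomes a bound on increments.\<close>
    define f where "f = (\<lambda>u. 1/2 * (d m n * fpair y m n u) + w (m, n) * d 1 1 * (1/2 * fpair y 1 1 u))"
    have "f t \<le> f s"
    proof (rule DERIV_nonpos_imp_nonincreasing[OF st(2)])
      fix u assume u: "s \<le> u" "u \<le> t"
      have "(f has_real_derivative (1/2 * (d m n * fpair_deriv y m n u) + w (m, n) * d 1 1 * (1/2 * fpair_deriv y 1 1 u))) (at u)"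
        unfolding f_def by (auto intro!: derivative_eq_intros fpair_has_deriv)
      moreover have "d m n * fpair_deriv y m n u \<le> 2 * w (m, n) * d 1 1 * (2 * pi * y * sinh u * fmode y u 1 1)"
      proof (cases "m \<le> n")
        case True
        then show ?thesis using key that u st by simp
      next
        case False
        then show ?thesis using key[of n m u] that u st sym[of m n] fpair_deriv_commute[of y m n u] wsym[of m n] by simp
      qed
      moreover have "1/2 * fpair_deriv y 1 1 u = - (2 * pi * y * sinh u * fmode y u 1 1)" by (simp add: fpair_deriv_hyperbolic)
      ultimately show "\<exists>D. (f has_real_derivative D) (at u) \<and> D \<le> 0"
        by (intro exI conjI) (assumption, simp)
    qed
    moreover have "fpair y 1 1 u = 2 * fmode y u 1 1" for u by (simp add: fpair_def)
    ultimately show ?thesis by (simp add: f_def c_def algebra_simps)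
  qed
  have "S t - S s \<le> (15/2 * (1/3 * (1/3)) + (- 1 - 15/32 + (41/100 - 15/128) + (41/100 - 15/128))) * c"
    by (rule has_sum_le_diff[OF S S w]) (use diff in auto)
  also have "\<dots> \<le> (- (1/100)) * c" by (rule mult_right_mono[OF _ c0]) simp
  finally show ?thesis by (simp add: S_def c_def)
qed

section \<open>The two moves for small parameters\<close>

lemma fmode_summable_bounded:
  assumes y: "y > 0" and d: "\<And>m n. \<bar>d m n\<bar> \<le> B"
  shows "(\<lambda>(m, n). fmode y t m n * d m n) summable_on ({1..} \<times> {1..})"
proof -
  have "(\<lambda>(m, n). fmode y t m n * (B + 1) * (1 / (B + 1) * d m n)) summable_on ({1..} \<times> {1..})"
  proof -
    have B: "0 \<le> B" using d[of 0 0] by simp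
    have "\<bar>1 / (B + 1) * d m n\<bar> \<le> 1" for m n using d[of m n] B by (simp add: abs_mult field_simps)
    from fmode_summable_cos[where d = "\<lambda>m n. 1 / (B + 1) * d m n", OF y this, of t]
    have "(\<lambda>i. (B + 1) * (case i of (m, n) \<Rightarrow> fmode y t m n * (1 / (B + 1) * d m n))) summable_on ({1..} \<times> {1..})"
      by (rule summable_on_cmult_right)
    then show ?thesis by (simp add: case_prod_unfold mult_ac)
  qed
  moreover have "0 \<le> B" using d[of 0 0] by simp
  ultimately show ?thesis by (simp add: mult.assoc)
qed

lemma offdiag_sum_has_sum:
  assumes "y > 0" "\<And>m n. \<bar>d m n\<bar> \<le> B"
  shows "((\<lambda>(m, n). fmode y t m n * d m n) has_sum offdiag_sum y t d) ({1..} \<times> {1..})"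
  unfolding offdiag_sum_def by (rule has_sum_infsum[OF fmode_summable_bounded[OF assms]])

lemma offdiag_sum_diff:
  assumes "y > 0" "\<And>m n. \<bar>d m n\<bar> \<le> B" "\<And>m n. \<bar>e m n\<bar> \<le> C"
  shows "offdiag_sum y t d - offdiag_sum y t e = offdiag_sum y t (\<lambda>m n. d m n - e m n)"
proof -
  have "((\<lambda>i. (case i of (m, n) \<Rightarrow> fmode y t m n * d m n) - (case i of (m, n) \<Rightarrow> fmode y t m n * e m n)) has_sum (offdiag_sum y t d - offdiag_sum y t e)) ({1..} \<times> {1..})"
    by (intro has_sum_real_diff offdiag_sum_has_sum[where B = B] offdiag_sum_has_sum[where B = C] assms)
  then show ?thesis
    unfolding offdiag_sum_def[of _ _ "\<lambda>m n. d m n - e m n"]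
    by (intro infsumI[symmetric]) (simp add: case_prod_unfold algebra_simps)
qed

lemma offdiag_sum_antimono:
  fixes d :: "nat \<Rightarrow> nat \<Rightarrow> real"
  assumes "6/10 \<le> y" and "0 \<le> s" "s \<le> t" "exp t \<le> 29/10 * y"
    and "\<And>m n. d m n = d n m"
    and "\<And>m n. 1 \<le> m \<Longrightarrow> 1 \<le> n \<Longrightarrow> \<bar>d m n\<bar> \<le> (real m)\<^sup>2 * (real n)\<^sup>2 * d 1 1"
    and "d 1 2 \<le> d 1 1" "\<And>m n. \<bar>d m n\<bar> \<le> B"
  shows "offdiag_sum y t d - offdiag_sum y s d \<le> - (d 1 1 * (fmode y s 1 1 - fmode y t 1 1)) / 100"
proof -
  have "0 < y" using assms(1) by simp
  then show ?thesis
    unfolding offdiag_sum_def by (intro offdiagonal_antimono[OF assms(1-7)] fmode_summable_bounded[OF _ assms(8)])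
qed

lemma abs_sin_nat_mult_le: "\<bar>sin (real k * x)\<bar> \<le> real k * \<bar>sin x\<bar>"
proof (induction k)
  case (Suc k)
  have "sin (real (Suc k) * x) = sin (real k * x) * cos x + cos (real k * x) * sin x"
    by (simp add: distrib_right sin_add algebra_simps)
  also have "\<bar>\<dots>\<bar> \<le> \<bar>sin (real k * x)\<bar> * \<bar>cos x\<bar> + \<bar>cos (real k * x)\<bar> * \<bar>sin x\<bar>"
    by (metis abs_mult abs_triangle_ineq)
  also have "\<dots> \<le> \<bar>sin (real k * x)\<bar> * 1 + 1 * \<bar>sin x\<bar>"
    by (intro add_mono mult_mono) auto
  finally show ?case using Suc by (simp add: distrib_right)
qed simp

text \<open>The difference is twice a product of two sines, each at most k |cos(\<theta>/2)|, and 2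
  cos^2(\<theta>/2) = 1 + cos \<theta>. With k = m n this gives exactly the growth m^2 n^2 that the
  off-diagonal estimate admits.\<close>

lemma cos_nat_mult_diff_le:
  "\<bar>cos (real k * \<theta>) - cos (real k * pi)\<bar> \<le> (real k)\<^sup>2 * (1 + cos \<theta>)"
proof -
  have "cos (real k * \<theta>) - cos (real k * pi) = 2 * sin (real k * ((\<theta> + pi) / 2)) * sin (real k * ((pi - \<theta>) / 2))"
    unfolding cos_diff_cos by (simp add: algebra_simps add_divide_distrib diff_divide_distrib)
  then have "\<bar>cos (real k * \<theta>) - cos (real k * pi)\<bar> = 2 * (\<bar>sin (real k * ((\<theta> + pi) / 2))\<bar> * \<bar>sin (real k * ((pi - \<theta>) / 2))\<bar>)"
    by (simp add: abs_mult)
  also have "\<dots> \<le> 2 * ((real k * \<bar>sin ((\<theta> + pi) / 2)\<bar>) * (real k * \<bar>sin ((pi - \<theta>) / 2)\<bar>))"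
    by (intro mult_left_mono mult_mono abs_sin_nat_mult_le) auto
  also have "\<bar>sin ((\<theta> + pi) / 2)\<bar> = \<bar>cos (\<theta> / 2)\<bar>"
    by (simp add: add_divide_distrib sin_add)
  also have "\<bar>sin ((pi - \<theta>) / 2)\<bar> = \<bar>cos (\<theta> / 2)\<bar>"
    by (simp add: diff_divide_distrib sin_diff)
  also have "2 * ((real k * \<bar>cos (\<theta> / 2)\<bar>) * (real k * \<bar>cos (\<theta> / 2)\<bar>)) = (real k)\<^sup>2 * (2 * (cos (\<theta> / 2))\<^sup>2)"
    by (simp add: power2_eq_square abs_mult_self_eq mult_ac)
  also have "2 * (cos (\<theta> / 2))\<^sup>2 = 1 + cos \<theta>"
    using cos_double_cos[of "\<theta> / 2"] by simp
  finally show ?thesis .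
qed

text \<open>The axis modes cancel since they do not see x. What is left has coefficients cos(2 pi m
  n x) - cos(pi m n); at m n = 2 they are at most 0, so the critical pair (1,2) falls under the
  admissible sign pattern.\<close>

lemma x_move_fourier:
  assumes y: "6/10 \<le> y" and st: "0 \<le> s" "s \<le> t" "exp t \<le> 29/10 * y"
  shows "(ntheta t x y - ntheta t (1/2) y) - (ntheta s x y - ntheta s (1/2) y)
     \<le> - (sqrt y * 4 * ((1 + cos (2 * pi * x)) * (fmode y s 1 1 - fmode y t 1 1)) / 100)"
proof -
  define d where "d = (\<lambda>(m::nat) (n::nat). cos (2 * pi * real m * real n * x) - cos (2 * pi * real m * real n * (1/2)))"
  have y0: "0 < y" using y by simp
  have ntheta: "ntheta u x y - ntheta u (1/2) y = sqrt y * (4 * offdiag_sum y u d)" for u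
    unfolding ntheta_fourier[OF y0] d_def by (subst offdiag_sum_diff[OF y0, of _ 1 _ 1, symmetric]) (auto simp: algebra_simps)
  have d11: "d 1 1 = 1 + cos (2 * pi * x)" by (simp add: d_def)
  have d_eq: "d m n = cos (real (m * n) * (2 * pi * x)) - cos (real (m * n) * pi)" for m n
    by (simp add: d_def mult_ac)
  have "offdiag_sum y t d - offdiag_sum y s d \<le> - (d 1 1 * (fmode y s 1 1 - fmode y t 1 1)) / 100"
  proof (rule offdiag_sum_antimono[OF y st, where B = 2])
    show "d m n = d n m" for m n by (simp add: d_def mult_ac)
    show "\<bar>d m n\<bar> \<le> (real m)\<^sup>2 * (real n)\<^sup>2 * d 1 1" for m n
      using cos_nat_mult_diff_le[of "m * n" "2 * pi * x"] unfolding d_eq[of m n] d11 by (simp add: power_mult_distrib)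
    have "d 1 2 = cos (2 * pi * 2 * x) - 1" by (simp add: d_def)
    also have "\<dots> \<le> 0" by simp
    also have "0 \<le> d 1 1" unfolding d11 using cos_ge_minus_one[of "2 * pi * x"] by linarith
    finally show "d 1 2 \<le> d 1 1" .
    show "\<bar>d m n\<bar> \<le> 2" for m n
      unfolding d_def using abs_cos_le_one[of "2 * pi * real m * real n * x"] abs_cos_le_one[of "2 * pi * real m * real n * (1/2)"]
      by linarith
  qed
  then have "sqrt y * 4 * (offdiag_sum y t d - offdiag_sum y s d) \<le> sqrt y * 4 * (- (d 1 1 * (fmode y s 1 1 - fmode y t 1 1)) / 100)"
    using y0 by (intro mult_left_mono) auto
  moreover have "sqrt y * 4 * (offdiag_sum y t d - offdiag_sum y s d) = sqrt y * (4 * offdiag_sum y t d) - sqrt y * (4 * offdiag_sum y s d)"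
    by (simp add: algebra_simps)
  ultimately show ?thesis unfolding ntheta d11 by simp
qed

section \<open>The axis modes under halving of the height\<close>

lemma exp_minus_le_step:
  fixes x h :: real
  assumes "real n * h \<le> x" "0 \<le> h"
  shows "exp (- x) \<le> 1 / (1 + h + h\<^sup>2 / 2) ^ n"
proof -
  have p: "0 < 1 + h + h\<^sup>2 / 2" using assms by (simp add: add_pos_nonneg)
  have "(1 + h + h\<^sup>2 / 2) ^ n \<le> exp h ^ n"
    using p exp_lower_Taylor_quadratic[OF assms(2)] by (intro power_mono) auto
  also have "\<dots> = exp (real n * h)" by (simp add: exp_of_nat_mult)
  also have "\<dots> \<le> exp x" using assms by simp
  finally have "1 / exp x \<le> 1 / (1 + h + h\<^sup>2 / 2) ^ n"
    using p by (intro divide_left_mono) auto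
  then show ?thesis by (simp add: exp_minus inverse_eq_divide)
qed

text \<open>The modes $(0,n)$ and $(n,0)$ at height $y$ contribute twice the pair function at $Y$, divided by $n$, with $Y = n^2 y$.\<close>

definition axis_pair :: "real \<Rightarrow> real \<Rightarrow> real" where
  "axis_pair Y u = sqrt Y * (exp (- (pi * Y * exp u)) + exp (- (pi * Y * exp (- u))))"

text \<open>Collecting the two exponentials into one sinh shows the sign, that of pi Y sinh u - u,
  and puts the heights Y and Y/2 into a common form.\<close>

lemma axis_pair_deriv:
  "(axis_pair Y has_real_derivative (2 * pi * Y * sqrt Y * (exp (- (pi * Y * cosh u)) * sinh (pi * Y * sinh u - u)))) (at u)"
proof -
  have "(axis_pair Y has_real_derivative (sqrt Y * (exp (- (pi * Y * exp u)) * - (pi * Y * exp u) + exp (- (pi * Y * exp (- u))) * (pi * Y * exp (- u))))) (at u)"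
    unfolding axis_pair_def[abs_def] by (auto intro!: derivative_eq_intros)
  moreover have "exp (- (pi * Y * exp u)) * - (pi * Y * exp u) + exp (- (pi * Y * exp (- u))) * (pi * Y * exp (- u))
      = pi * Y * (exp (- (pi * Y * exp (- u)) - u) - exp (- (pi * Y * exp u) + u))"
  proof -
    have "exp (- (pi * Y * exp (- u)) - u) = exp (- (pi * Y * exp (- u))) * exp (- u)"
      by (simp add: exp_add[symmetric])
    moreover have "exp (- (pi * Y * exp u) + u) = exp (- (pi * Y * exp u)) * exp u" by (rule exp_add)
    ultimately show ?thesis by (simp only:) (simp add: algebra_simps)
  qed
  moreover have "exp (- (pi * Y * exp (- u)) - u) - exp (- (pi * Y * exp u) + u)
      = 2 * (exp (- (pi * Y * cosh u)) * sinh (pi * Y * sinh u - u))"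
  proof -
    have 1: "exp (- u) = cosh u - sinh u" "exp u = cosh u + sinh u" by (simp_all add: cosh_minus_sinh cosh_plus_sinh)
    have "2 * sinh (pi * Y * sinh u - u) = exp (pi * Y * sinh u - u) - exp (- (pi * Y * sinh u - u))"
      by (simp add: sinh_field_def)
    then have "2 * (exp (- (pi * Y * cosh u)) * sinh (pi * Y * sinh u - u))
       = exp (- (pi * Y * cosh u)) * (exp (pi * Y * sinh u - u) - exp (- (pi * Y * sinh u - u)))" by simp
    also have "\<dots> = exp (- (pi * Y * (cosh u - sinh u)) - u) - exp (- (pi * Y * (cosh u + sinh u)) + u)"
      by (simp add: right_diff_distrib exp_add[symmetric] algebra_simps)
    finally show ?thesis unfolding 1[symmetric] by simp
  qed
  ultimately show ?thesis by (simp add: mult_ac)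
qed

lemma sinh_ge_self: "0 \<le> x \<Longrightarrow> x \<le> sinh x" for x :: real
proof -
  assume "0 \<le> x"
  then have "(\<lambda>x. sinh x - x) 0 \<le> (\<lambda>x. sinh x - x) x"
  proof (rule DERIV_nonneg_imp_nondecreasing)
    fix u :: real
    show "\<exists>d. ((\<lambda>x. sinh x - x) has_real_derivative d) (at u) \<and> 0 \<le> d"
      using cosh_real_ge_1[of u] by (intro exI[of _ "cosh u - 1"]) (auto intro!: derivative_eq_intros)
  qed
  then show ?thesis by simp
qed

text \<open>The inequality between derivatives behind \<open>axis_pair_halving\<close>, common
  factors removed. With D = sinh(Z - u) the bracket on the left is (E1 + E2) D plus a small multiple
  of sinh u, where E1 and E2 are the two Gaussians at height Y/2, and sinh u is itself at most D /
  1.355. The margin is thin: 2.83 * 0.348 < 0.985.\<close>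

lemma axis_pair_key:
  assumes Y: "15/10 \<le> Y" and u: "0 \<le> u" "exp u \<le> Y"
  defines "W \<equiv> pi * Y * cosh u / 2" and "Z \<equiv> pi * Y * sinh u / 2"
  shows "2 * sqrt 2 * (exp (- W) * sinh (2 * Z - u) + 4 * sinh u * exp (- (3 * W))) \<le> sinh (Z - u)"
proof -
  define S where "S = sinh u"
  have S: "0 \<le> S" "u \<le> S" using u sinh_ge_self[of u] by (auto simp: S_def)
  have c: "2355/1000 \<le> pi * Y / 2" using mult_mono[of "314/100" pi "15/10" Y] pi_gt_314 Y by simp
  have W: "2355/1000 \<le> W"
  proof -
    have "2355/1000 \<le> pi * Y / 2 * 1" using c by simp
    also have "\<dots> \<le> pi * Y / 2 * cosh u" using Y cosh_real_ge_1[of u] by (intro mult_left_mono) auto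
    finally show ?thesis by (simp add: W_def)
  qed
  have Zu: "(1355/1000) * S \<le> Z - u"
  proof -
    have "2355/1000 * S \<le> pi * Y / 2 * S" using c S by (intro mult_right_mono) auto
    then show ?thesis using S by (simp add: Z_def S_def)
  qed
  then have Zu0: "0 \<le> Z - u" using S by (meson mult_nonneg_nonneg order_trans zero_le_divide_iff zero_le_numeral)
  define D where "D = sinh (Z - u)"
  have D: "(1355/1000) * S \<le> D" using Zu sinh_ge_self[OF Zu0] by (simp add: D_def)
  then have D0: "0 \<le> D" using S by linarith
  \<comment> \<open>The addition theorems for Z + (Z - u) and Z - (Z - u) = u eliminate the product
    of sinh Z and cosh(Z - u).\<close>
  have id: "sinh (2 * Z - u) = 2 * cosh Z * D + S"
    using sinh_add[of Z "Z - u"] sinh_diff[of Z "Z - u"] by (simp add: D_def S_def)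
  define E1 where "E1 = exp (- (pi * Y * exp (- u) / 2))"
  define E2 where "E2 = exp (- (pi * Y * exp u / 2))"
  have E: "exp (- W) * (2 * cosh Z) = E1 + E2"
  proof -
    have 1: "exp (- u) = cosh u - sinh u" "exp u = cosh u + sinh u" by (simp_all add: cosh_minus_sinh cosh_plus_sinh)
    have "exp (- W) * (2 * cosh Z) = exp (- W + Z) + exp (- W + - Z)"
      unfolding exp_add by (simp add: cosh_field_def algebra_simps)
    moreover have "- W + Z = - (pi * Y * exp (- u) / 2)" "- W + - Z = - (pi * Y * exp u / 2)"
      unfolding 1 W_def Z_def by (simp_all add: field_simps)
    ultimately show ?thesis by (simp add: E1_def E2_def)
  qed
  have r2: "2 * sqrt 2 \<le> 283/100"
  proof -
    have "sqrt 2 \<le> 1415/1000" by (rule real_le_lsqrt) (auto simp: power2_eq_square)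
    then show ?thesis by simp
  qed
  have "exp (- W) \<le> 1 / (1105/1000) ^ 23" using W by (intro exp_minus_le_power) simp
  also have "\<dots> \<le> 1007/10000" by (simp add: power_divide)
  finally have eW: "exp (- W) \<le> 1007/10000" .
  have "exp (- (3 * W)) \<le> 1 / (1105/1000) ^ 70" using W by (intro exp_minus_le_power) simp
  also have "\<dots> \<le> 1/1000" by (simp add: power_divide)
  finally have e3W: "exp (- (3 * W)) \<le> 1/1000" .
  \<comment> \<open>For exp u \<ge> 5/4 the bound on E1 comes from exp u \<le> Y, and E2 has already
    decayed; below 5/4 both follow from Y \<ge> 15/10.\<close>
  have E12: "E1 + E2 \<le> 27/100"
  proof (cases "5/4 \<le> exp u")
    case True
    have "1 / Y \<le> exp (- u)" using u Y by (simp add: exp_minus field_simps)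
    then have "1 \<le> Y * exp (- u)" using Y by (simp add: field_simps)
    then have "314/100 * 1 \<le> pi * (Y * exp (- u))" using pi_gt_314 by (intro mult_mono) auto
    then have "E1 \<le> 1 / (1 + 157/1000 + (157/1000)\<^sup>2 / 2) ^ 10"
      unfolding E1_def by (intro exp_minus_le_step) auto
    also have "\<dots> \<le> 21/100" by (simp add: power_divide power2_eq_square)
    finally have 1: "E1 \<le> 21/100" .
    have "2355/1000 * (5/4) \<le> pi * Y / 2 * exp u" using c True by (intro mult_mono) auto
    then have "E2 \<le> 1 / (1105/1000) ^ 29"
      unfolding E2_def by (intro exp_minus_le_power) simp
    also have "\<dots> \<le> 6/100" by (simp add: power_divide)
    finally show ?thesis using 1 by simp
  next
    case False
    then have "4/5 \<le> exp (- u)" by (simp add: exp_minus field_simps)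
    then have "2355/1000 * (4/5) \<le> pi * Y / 2 * exp (- u)" using c by (intro mult_mono) auto
    then have "E1 \<le> 1 / (1105/1000) ^ 18"
      unfolding E1_def by (intro exp_minus_le_power) simp
    also have "\<dots> \<le> 166/1000" by (simp add: power_divide)
    finally have 1: "E1 \<le> 166/1000" .
    have "2355/1000 * 1 \<le> pi * Y / 2 * exp u" using c u by (intro mult_mono) auto
    then have "E2 \<le> 1 / (1105/1000) ^ 23"
      unfolding E2_def by (intro exp_minus_le_power) simp
    also have "\<dots> \<le> 101/1000" by (simp add: power_divide)
    finally show ?thesis using 1 by simp
  qed
  have "exp (- W) * sinh (2 * Z - u) + 4 * S * exp (- (3 * W)) = (E1 + E2) * D + S * (exp (- W) + 4 * exp (- (3 * W)))"
    unfolding id E[symmetric] by (simp add: algebra_simps)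
  also have "\<dots> \<le> 27/100 * D + S * (1047/10000)"
    using E12 eW e3W D0 S by (intro add_mono mult_right_mono mult_left_mono) auto
  also have "\<dots> \<le> 27/100 * D + 1047/13550 * D" using D by simp
  finally have "exp (- W) * sinh (2 * Z - u) + 4 * S * exp (- (3 * W)) \<le> 348/1000 * D" using D0 by simp
  then have "2 * sqrt 2 * (exp (- W) * sinh (2 * Z - u) + 4 * S * exp (- (3 * W))) \<le> 2 * sqrt 2 * (348/1000 * D)"
    by (intro mult_left_mono) auto
  also have "\<dots> \<le> 283/100 * (348/1000 * D)" using r2 D0 by (intro mult_right_mono) auto
  also have "\<dots> \<le> D" using D0 by simp
  finally show ?thesis by (simp add: D_def S_def)
qed

text \<open>The term with \<open>fmode Y t 1 1\<close> is a reserve. At x = 1/2 the mode (1,1) has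
  coefficient -1, so its contribution grows with t, and the decrease of the axis modes has to pay
  for it.\<close>

lemma axis_pair_halving:
  assumes Y: "15/10 \<le> Y" and st: "0 \<le> s" "s \<le> t" "exp t \<le> Y"
  shows "axis_pair Y t - axis_pair (Y / 2) t - 4 * sqrt Y * fmode Y t 1 1 \<le> axis_pair Y s - axis_pair (Y / 2) s - 4 * sqrt Y * fmode Y s 1 1"
proof (rule DERIV_nonpos_imp_nonincreasing[OF st(2)])
  fix u assume u: "s \<le> u" "u \<le> t"
  have eu: "exp u \<le> Y" using u st by (meson exp_le_cancel_iff order_trans)
  define W where "W = pi * Y * cosh u / 2"
  define Z where "Z = pi * Y * sinh u / 2"
  have J: "((\<lambda>u. fmode Y u 1 1) has_real_derivative (- (2 * pi * Y * sinh u * exp (- (4 * W))))) (at u)"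
  proof -
    have eq: "(\<lambda>u. fmode Y u 1 1) = (\<lambda>u. exp (- (2 * pi * Y * cosh u)))"
    proof
      fix u
      have "- (pi * Y) * (exp u * (real 1)\<^sup>2 + exp (- u) * (real 1)\<^sup>2) = - (2 * pi * Y * cosh u)"
        by (simp add: cosh_field_def)
      then show "fmode Y u 1 1 = exp (- (2 * pi * Y * cosh u))" unfolding fmode_def by (simp only:)
    qed
    show ?thesis unfolding eq W_def by (auto intro!: derivative_eq_intros)
  qed
  have N1: "(axis_pair Y has_real_derivative (2 * pi * Y * sqrt Y * (exp (- (2 * W)) * sinh (2 * Z - u)))) (at u)"
    using axis_pair_deriv[of Y u] by (simp add: W_def Z_def)
  have N2: "(axis_pair (Y / 2) has_real_derivative (2 * pi * (Y / 2) * (sqrt Y / sqrt 2) * (exp (- W) * sinh (Z - u)))) (at u)"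
    using axis_pair_deriv[of "Y / 2" u] by (simp add: W_def Z_def real_sqrt_divide)
  have "2 * pi * Y * sqrt Y * (exp (- (2 * W)) * sinh (2 * Z - u)) - 2 * pi * (Y / 2) * (sqrt Y / sqrt 2) * (exp (- W) * sinh (Z - u))
       - 4 * sqrt Y * (- (2 * pi * Y * sinh u * exp (- (4 * W))))
     = 2 * pi * Y * sqrt Y * exp (- W) / (2 * sqrt 2) *
       (2 * sqrt 2 * (exp (- W) * sinh (2 * Z - u) + 4 * sinh u * exp (- (3 * W))) - sinh (Z - u))"
  proof -
    have e: "exp (- (2 * W)) = exp (- W) * exp (- W)" "exp (- (4 * W)) = exp (- W) * exp (- (3 * W))"
      by (simp_all add: exp_add[symmetric])
    show ?thesis unfolding e by (simp add: field_simps)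
  qed
  also have "\<dots> \<le> 0"
    using axis_pair_key[of Y u] Y st u eu unfolding W_def Z_def
    by (intro mult_nonneg_nonpos) auto
  finally have le: "2 * pi * Y * sqrt Y * (exp (- (2 * W)) * sinh (2 * Z - u)) - 2 * pi * (Y / 2) * (sqrt Y / sqrt 2) * (exp (- W) * sinh (Z - u))
       - 4 * sqrt Y * (- (2 * pi * Y * sinh u * exp (- (4 * W)))) \<le> 0" .
  show "\<exists>D. ((\<lambda>t. axis_pair Y t - axis_pair (Y / 2) t - 4 * sqrt Y * fmode Y t 1 1) has_real_derivative D) (at u) \<and> D \<le> 0"
    using DERIV_diff[OF DERIV_diff[OF N1 N2] DERIV_cmult[OF J, of "4 * sqrt Y"]] le by blast
qed

lemma axis_has_sum:
  assumes z: "0 < z"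
  shows "((\<lambda>n. 2 * axis_pair ((real n)\<^sup>2 * z) u / real n) has_sum
      (2 * sqrt z * (gauss_tail (pi * z * exp u) + gauss_tail (pi * z * exp (- u))))) {1..}"
proof -
  have "((\<lambda>n. 2 * sqrt z * (exp (- (pi * z * exp u) * (real n)\<^sup>2) + exp (- (pi * z * exp (- u)) * (real n)\<^sup>2))) has_sum
    (2 * sqrt z * (gauss_tail (pi * z * exp u) + gauss_tail (pi * z * exp (- u))))) {1..}"
    using z by (intro has_sum_cmult_right has_sum_add gauss_tail_has_sum) auto
  also have "?this \<longleftrightarrow> ?thesis"
  proof (rule has_sum_cong)
    fix n :: nat assume "n \<in> {1..}"
    then show "2 * sqrt z * (exp (- (pi * z * exp u) * (real n)\<^sup>2) + exp (- (pi * z * exp (- u)) * (real n)\<^sup>2)) = 2 * axis_pair ((real n)\<^sup>2 * z) u / real n"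
      by (simp add: axis_pair_def real_sqrt_mult mult_ac)
  qed
  finally show ?thesis .
qed

text \<open>At x = 1/2 the coefficient of (1,1) is cos pi = -1, so the decreasing sum is the one
  with negated coefficients; there (1,2) has coefficient -1, well below that of (1,1).\<close>

lemma offdiag_sum_half_strict_mono:
  assumes y: "6/10 \<le> y" and st: "0 \<le> s" "s < t" "exp t \<le> 29/10 * y"
  shows "offdiag_sum y s (\<lambda>m n. cos (2 * pi * real m * real n * (1/2))) < offdiag_sum y t (\<lambda>m n. cos (2 * pi * real m * real n * (1/2)))"
proof -
  define g where "g = (\<lambda>(m::nat) (n::nat). cos (2 * pi * real m * real n * (1/2)))"
  have gle: "\<bar>g m n\<bar> \<le> 1" for m n by (simp add: g_def)
  have gsym: "g m n = g n m" for m n by (simp add: g_def mult_ac)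
  have g11: "g 1 1 = - 1" and g12: "g 1 2 = 1" by (simp_all add: g_def)
  have y0: "0 < y" using y by simp
  have "offdiag_sum y t (\<lambda>m n. - g m n) - offdiag_sum y s (\<lambda>m n. - g m n) \<le> - (- g 1 1 * (fmode y s 1 1 - fmode y t 1 1)) / 100"
  proof (rule offdiag_sum_antimono[where B = 1])
    show "\<bar>- g m n\<bar> \<le> (real m)\<^sup>2 * (real n)\<^sup>2 * - g 1 1" if "1 \<le> m" "1 \<le> n" for m n
    proof -
      have "1 * 1 \<le> (real m)\<^sup>2 * (real n)\<^sup>2" using that by (intro mult_mono) auto
      then show ?thesis using gle[of m n] g11 by simp
    qed
  qed (use y st gsym g11 g12 gle in auto)
  moreover have "offdiag_sum y u (\<lambda>m n. - g m n) = - offdiag_sum y u g" for u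
    by (simp add: offdiag_sum_def case_prod_unfold infsum_uminus)
  moreover have "fmode y t 1 1 < fmode y s 1 1" by (rule fmode_11_strict) (use y0 st in auto)
  ultimately show ?thesis using g11 unfolding g_def[symmetric] by simp
qed

text \<open>The off-diagonal part at height y increases with t, against the claim; the one at y/2
  enters with a minus sign and helps. The coefficient -1 of (1,1) at height y is therefore split as
  1 - 2: with +1 the off-diagonal sum decreases, and the remaining -2 is exactly covered by the
  reserve in \<open>axis_pair_halving\<close> for n = 1.\<close>

lemma y_halving_fourier:
  assumes y: "15/10 \<le> y" and st: "0 \<le> s" "s < t" "exp t \<le> y"
  shows "ntheta t (1/2) y - ntheta t (1/2) (y / 2) < ntheta s (1/2) y - ntheta s (1/2) (y / 2)"
proof -
  define g where "g = (\<lambda>(m::nat) (n::nat). cos (2 * pi * real m * real n * (1/2)))"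
  have gle: "\<bar>g m n\<bar> \<le> 1" for m n by (simp add: g_def)
  have gsym: "g m n = g n m" for m n by (simp add: g_def mult_ac)
  have g11: "g 1 1 = - 1" and g12: "g 1 2 = 1" by (simp_all add: g_def)
  have st': "s \<le> t" using st by simp
  have y0: "0 < y" "0 < y / 2" using y by auto
  define a where "a = (\<lambda>u n. 2 * axis_pair ((real n)\<^sup>2 * y) u / real n - 2 * axis_pair ((real n)\<^sup>2 * y / 2) u / real n)"
  define A where "A = (\<lambda>u. infsum (a u) {1..})"
  have alg: "r * (1 + 2 * a1 + 2 * b1 + 4 * c1) - r' * (1 + 2 * a2 + 2 * b2 + 4 * c2)
      = (r - r') + (2 * r * (a1 + b1) - 2 * r' * (a2 + b2)) + r * (4 * c1) - r' * (4 * c2)" for r r' a1 b1 c1 a2 b2 c2 :: real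
    by (simp add: algebra_simps)
  have ntheta: "ntheta u (1/2) y - ntheta u (1/2) (y / 2) = (sqrt y - sqrt (y / 2)) + A u + sqrt y * (4 * offdiag_sum y u g) - sqrt (y / 2) * (4 * offdiag_sum (y / 2) u g)"
    and a: "(a u has_sum A u) {1..}" for u
  proof -
    have *: "(a u has_sum (2 * sqrt y * (gauss_tail (pi * y * exp u) + gauss_tail (pi * y * exp (- u)))
      - 2 * sqrt (y / 2) * (gauss_tail (pi * (y / 2) * exp u) + gauss_tail (pi * (y / 2) * exp (- u))))) {1..}"
      using has_sum_real_diff[OF axis_has_sum[OF y0(1), of u] axis_has_sum[OF y0(2), of u]] by (simp add: a_def[abs_def])
    then show "(a u has_sum A u) {1..}" unfolding A_def by (auto intro: has_sum_infsum has_sum_imp_summable)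
    show "ntheta u (1/2) y - ntheta u (1/2) (y / 2) = (sqrt y - sqrt (y / 2)) + A u + sqrt y * (4 * offdiag_sum y u g) - sqrt (y / 2) * (4 * offdiag_sum (y / 2) u g)"
      unfolding A_def infsumI[OF *] ntheta_fourier[OF y0(1)] ntheta_fourier[OF y0(2)] g_def by (rule alg)
  qed
  define J where "J = (\<lambda>u. fmode y u 1 1)"
  have J: "J t < J s" unfolding J_def by (rule fmode_11_strict) (use y0 st in auto)
  have N: "axis_pair Y t - axis_pair (Y / 2) t - (axis_pair Y s - axis_pair (Y / 2) s) \<le> 4 * sqrt Y * (fmode Y t 1 1 - fmode Y s 1 1)" if "y \<le> Y" for Y
    using axis_pair_halving[of Y s t] that y st by (simp add: algebra_simps)
  have term_le: "a t n - a s n \<le> (if n = 1 then 8 * sqrt y * (J t - J s) else 0)" if "n \<in> {1..}" for n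
  proof (cases "n = 1")
    case True
    then show ?thesis using N[of y] by (simp add: a_def J_def algebra_simps)
  next
    case False
    have n1: "1 \<le> (real n)\<^sup>2" using that by simp
    then have yY: "y \<le> (real n)\<^sup>2 * y" using y0 by simp
    have "4 * sqrt ((real n)\<^sup>2 * y) * (fmode ((real n)\<^sup>2 * y) t 1 1 - fmode ((real n)\<^sup>2 * y) s 1 1) \<le> 0"
      using fmode_11_antimono[of "(real n)\<^sup>2 * y" s t] less_le_trans[OF y0(1) yY] y0 st by (intro mult_nonneg_nonpos) auto
    with N[OF yY] have "axis_pair ((real n)\<^sup>2 * y) t - axis_pair ((real n)\<^sup>2 * y / 2) t - (axis_pair ((real n)\<^sup>2 * y) s - axis_pair ((real n)\<^sup>2 * y / 2) s) \<le> 0"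
      by linarith
    then have "(2 / real n) * (axis_pair ((real n)\<^sup>2 * y) t - axis_pair ((real n)\<^sup>2 * y / 2) t - (axis_pair ((real n)\<^sup>2 * y) s - axis_pair ((real n)\<^sup>2 * y / 2) s)) \<le> 0"
      by (intro mult_nonneg_nonpos) auto
    then show ?thesis using False by (simp add: a_def algebra_simps)
  qed
  have "((\<lambda>n::nat. if n = 1 then 8 * sqrt y * (J t - J s) else 0) has_sum (8 * sqrt y * (J t - J s))) {1..}"
    by (rule has_sum_finite_neutralI[of "{1}"]) auto
  with has_sum_mono[OF has_sum_real_diff[OF a[of t] a[of s]]] term_le
  have Ale: "A t - A s \<le> 8 * sqrt y * (J t - J s)" by fastforce
  define d where "d = (\<lambda>m n. g m n + (if m = 1 \<and> n = 1 then 2 else 0))"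
  have raw: "offdiag_sum y t d - offdiag_sum y s d \<le> - (d 1 1 * (fmode y s 1 1 - fmode y t 1 1)) / 100"
  proof (rule offdiag_sum_antimono[where B = 3])
    show "\<bar>d m n\<bar> \<le> (real m)\<^sup>2 * (real n)\<^sup>2 * d 1 1" if "1 \<le> m" "1 \<le> n" for m n
    proof -
      have "1 * 1 \<le> (real m)\<^sup>2 * (real n)\<^sup>2" using that by (intro mult_mono) auto
      then show ?thesis using gle[of m n] g11 by (auto simp: d_def)
    qed
    show "\<bar>d m n\<bar> \<le> 3" for m n using gle[of m n] by (auto simp: d_def)
  qed (use y st gsym g11 g12 in \<open>auto simp: d_def\<close>)
  have "d 1 1 = 1" using g11 by (simp add: d_def)
  from raw[unfolded this mult_1] have "offdiag_sum y t d - offdiag_sum y s d \<le> - (J s - J t) / 100" unfolding J_def .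
  also have "\<dots> \<le> 0" using J by simp
  finally have dle: "offdiag_sum y t d \<le> offdiag_sum y s d" by simp
  have gd: "offdiag_sum y u g = offdiag_sum y u d - 2 * J u" for u
  proof -
    have "offdiag_sum y u d - offdiag_sum y u g = offdiag_sum y u (\<lambda>m n. d m n - g m n)"
    proof (rule offdiag_sum_diff[OF y0(1), where B = 3 and C = 1])
      show "\<bar>d m n\<bar> \<le> 3" for m n using gle[of m n] by (auto simp: d_def)
    qed (rule gle)
    also have "\<dots> = 2 * J u"
      unfolding offdiag_sum_def
      by (rule infsumI, rule has_sum_finite_neutralI[of "{(1, 1)}"]) (auto simp: d_def J_def split: if_splits)
    finally show ?thesis by simp
  qed
  have glt: "offdiag_sum (y / 2) s g < offdiag_sum (y / 2) t g"
    unfolding g_def by (rule offdiag_sum_half_strict_mono) (use y st in auto)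
  have 1: "sqrt y * (4 * offdiag_sum y t g) - sqrt y * (4 * offdiag_sum y s g) \<le> - (8 * sqrt y * (J t - J s))"
  proof -
    have "4 * sqrt y * (offdiag_sum y t d - offdiag_sum y s d) \<le> 0"
      using dle y0 by (intro mult_nonneg_nonpos) auto
    then show ?thesis unfolding gd by (simp add: algebra_simps)
  qed
  have 2: "sqrt (y / 2) * (4 * offdiag_sum (y / 2) s g) < sqrt (y / 2) * (4 * offdiag_sum (y / 2) t g)"
    using glt y0 by (intro mult_strict_left_mono) auto
  show ?thesis unfolding ntheta using Ale 1 2 by linarith
qed

section \<open>The horizontal move for large parameters\<close>

lemma convex_midpoint_ge:
  fixes f f' f'' :: "real \<Rightarrow> real"
  assumes d1: "\<And>x. (f has_real_derivative f' x) (at x)" and d2: "\<And>x. (f' has_real_derivative f'' x) (at x)"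
    and pos: "\<And>x. a \<le> x \<Longrightarrow> 0 \<le> f'' x" and c: "0 \<le> \<eta>" "a \<le> c - \<eta>"
  shows "2 * f c \<le> f (c - \<eta>) + f (c + \<eta>)"
proof -
  have "convex_on {a..} f"
    by (rule f''_ge0_imp_convex[where f' = f' and f'' = f'']) (use d1 d2 pos in auto)
  from convex_onD[OF this, of "1/2" "c - \<eta>" "c + \<eta>"] c
  have "f (1/2 * (c - \<eta>) + 1/2 * (c + \<eta>)) \<le> 1/2 * f (c - \<eta>) + 1/2 * f (c + \<eta>)" by simp
  moreover have "1/2 * (c - \<eta>) + 1/2 * (c + \<eta>) = c" by (simp add: field_simps)
  ultimately show ?thesis by simp
qed

text \<open>With $\beta = \pi e^t/y$, the factor $\beta^2$ split off from the second difference of Gaussians leaves a decreasing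
  function of $\beta$ as soon as this weight is midpoint convex. The exponent $2$ is chosen because the second derivative
  then factors: it has the sign of $(2u+1)(u-1)$ with $u = \beta x^2$.\<close>

definition gauss_weight :: "real \<Rightarrow> real \<Rightarrow> real" where
  "gauss_weight \<beta> x = (2 + \<beta> * x\<^sup>2) * exp (- (\<beta> * x\<^sup>2))"

text \<open>Two points at distance c on either side of the origin, shifted together by \<eta>, end
  up at distances c - \<eta> and c + \<eta>; this is the change of their Gaussian sum.\<close>

definition gauss_diff :: "real \<Rightarrow> real \<Rightarrow> real \<Rightarrow> real" where
  "gauss_diff c \<eta> \<beta> = exp (- (\<beta> * (c - \<eta>)\<^sup>2)) + exp (- (\<beta> * (c + \<eta>)\<^sup>2)) - 2 * exp (- (\<beta> * c\<^sup>2))"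

definition gauss_diff_slope :: "real \<Rightarrow> real \<Rightarrow> real \<Rightarrow> real" where
  "gauss_diff_slope c \<eta> \<beta> = 2 * ((c\<^sup>2) * exp (- (\<beta> * c\<^sup>2))) - (c - \<eta>)\<^sup>2 * exp (- (\<beta> * (c - \<eta>)\<^sup>2)) - (c + \<eta>)\<^sup>2 * exp (- (\<beta> * (c + \<eta>)\<^sup>2))"

lemma gauss_diff_deriv: "(gauss_diff c \<eta> has_real_derivative gauss_diff_slope c \<eta> \<beta>) (at \<beta>)"
  unfolding gauss_diff_def[abs_def] gauss_diff_slope_def by (auto intro!: derivative_eq_intros simp: algebra_simps)

text \<open>The left side is nonnegative precisely when \<open>gauss_diff\<close> divided by
  \<beta>^2 has nonpositive derivative, for \<beta> > 0. It turns out to be a second difference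
  again, so that convexity in x decides about monotonicity in \<beta>.\<close>

lemma gauss_diff_weight: "2 * gauss_diff c \<eta> \<beta> - \<beta> * gauss_diff_slope c \<eta> \<beta> = gauss_weight \<beta> (c - \<eta>) + gauss_weight \<beta> (c + \<eta>) - 2 * gauss_weight \<beta> c"
  by (simp add: gauss_diff_def gauss_diff_slope_def gauss_weight_def algebra_simps)

text \<open>The second derivative is nonnegative where \<beta> x^2 \<ge> 1; for \<beta> \<ge> 9 this
  holds on x \<ge> 1/3, the origin of the threshold 1/3.\<close>

lemma gauss_weight_midpoint:
  assumes \<beta>: "9 \<le> \<beta>" and c: "0 \<le> \<eta>" "1/3 \<le> c - \<eta>"
  shows "2 * gauss_weight \<beta> c \<le> gauss_weight \<beta> (c - \<eta>) + gauss_weight \<beta> (c + \<eta>)"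
proof (rule convex_midpoint_ge[OF _ _ _ c])
  show "(gauss_weight \<beta> has_real_derivative (- 2 * \<beta> * x * (1 + \<beta> * x\<^sup>2) * exp (- (\<beta> * x\<^sup>2)))) (at x)" for x
    unfolding gauss_weight_def[abs_def] by (auto intro!: derivative_eq_intros simp: algebra_simps power2_eq_square)
  show "((\<lambda>x. - 2 * \<beta> * x * (1 + \<beta> * x\<^sup>2) * exp (- (\<beta> * x\<^sup>2))) has_real_derivative
     (2 * \<beta> * ((2 * (\<beta> * x\<^sup>2) + 1) * (\<beta> * x\<^sup>2 - 1)) * exp (- (\<beta> * x\<^sup>2)))) (at x)" for x
    by (auto intro!: derivative_eq_intros simp: algebra_simps power2_eq_square)
  show "0 \<le> 2 * \<beta> * ((2 * (\<beta> * x\<^sup>2) + 1) * (\<beta> * x\<^sup>2 - 1)) * exp (- (\<beta> * x\<^sup>2))" if "1/3 \<le> x" for x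
  proof -
    have "(1/3)\<^sup>2 \<le> x\<^sup>2" using that by (intro power_mono) auto
    then have "9 * (1/3)\<^sup>2 \<le> \<beta> * x\<^sup>2" using \<beta> by (intro mult_mono) auto
    then have "1 \<le> \<beta> * x\<^sup>2" by (simp add: power2_eq_square)
    then show ?thesis using \<beta> by simp
  qed
qed

lemma gauss_midpoint:
  assumes \<beta>: "9 \<le> \<beta>" and c: "0 \<le> \<eta>" "1/3 \<le> c - \<eta>"
  shows "0 \<le> gauss_diff c \<eta> \<beta>"
proof -
  have "2 * exp (- (\<beta> * c\<^sup>2)) \<le> exp (- (\<beta> * (c - \<eta>)\<^sup>2)) + exp (- (\<beta> * (c + \<eta>)\<^sup>2))"
  proof (rule convex_midpoint_ge[of "\<lambda>x. exp (- (\<beta> * x\<^sup>2))", OF _ _ _ c])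
    show "((\<lambda>x. exp (- (\<beta> * x\<^sup>2))) has_real_derivative (- 2 * \<beta> * x * exp (- (\<beta> * x\<^sup>2)))) (at x)" for x
      by (auto intro!: derivative_eq_intros simp: algebra_simps)
    show "((\<lambda>x. - 2 * \<beta> * x * exp (- (\<beta> * x\<^sup>2))) has_real_derivative
       (2 * \<beta> * (2 * (\<beta> * x\<^sup>2) - 1) * exp (- (\<beta> * x\<^sup>2)))) (at x)" for x
      by (auto intro!: derivative_eq_intros simp: algebra_simps power2_eq_square)
    show "0 \<le> 2 * \<beta> * (2 * (\<beta> * x\<^sup>2) - 1) * exp (- (\<beta> * x\<^sup>2))" if "1/3 \<le> x" for x
    proof -
      have "(1/3)\<^sup>2 \<le> x\<^sup>2" using that by (intro power_mono) auto
      then have "9 * (1/3)\<^sup>2 \<le> \<beta> * x\<^sup>2" using \<beta> by (intro mult_mono) auto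
      then have "1 \<le> \<beta> * x\<^sup>2" by (simp add: power2_eq_square)
      then show ?thesis using \<beta> by simp
    qed
  qed
  then show ?thesis by (simp add: gauss_diff_def)
qed

lemma gauss_weight_antimono:
  assumes "0 \<le> \<beta>" "0 \<le> x" "x \<le> z"
  shows "gauss_weight \<beta> z \<le> gauss_weight \<beta> x"
proof (rule DERIV_nonpos_imp_nonincreasing[OF assms(3)])
  fix u assume "x \<le> u" "u \<le> z"
  then have "- 2 * \<beta> * u * (1 + \<beta> * u\<^sup>2) * exp (- (\<beta> * u\<^sup>2)) \<le> 0" using assms by simp
  moreover have "(gauss_weight \<beta> has_real_derivative (- 2 * \<beta> * u * (1 + \<beta> * u\<^sup>2) * exp (- (\<beta> * u\<^sup>2)))) (at u)"
    unfolding gauss_weight_def[abs_def] by (auto intro!: derivative_eq_intros simp: algebra_simps power2_eq_square)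
  ultimately show "\<exists>y. (gauss_weight \<beta> has_real_derivative y) (at u) \<and> y \<le> 0" by blast
qed

text \<open>For centre 1/2 and a large shift the inner point leaves the convex region, but its value
  alone then outweighs twice the value at 1/2. Here v = \<beta> (1/4 - 1/9) is the difference of the
  exponents at 1/2 and 1/3, and 91/10 is just below 3.14 * 29/10.\<close>

lemma half_far:
  assumes \<beta>: "91/10 \<le> \<beta>" and x: "0 \<le> x" "x \<le> 1/3"
  shows "2 * gauss_weight \<beta> (1/2) \<le> gauss_weight \<beta> x" and "2 * exp (- (\<beta> * (1/2)\<^sup>2)) \<le> exp (- (\<beta> * x\<^sup>2))"
proof -
  define v where "v = 5 * \<beta> / 36"
  have v: "126/100 \<le> v" "\<beta> = 36 * v / 5" using \<beta> by (auto simp: v_def)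
  have ev: "1 + v + v\<^sup>2 / 2 \<le> exp v" using v by (intro exp_lower_Taylor_quadratic) auto
  have v2: "126/100 * v \<le> v\<^sup>2" unfolding power2_eq_square using v by (intro mult_right_mono) auto
  have v3: "126/100 * (126/100) \<le> v\<^sup>2" unfolding power2_eq_square using v by (intro mult_mono) auto
  have e: "exp (- (\<beta> * (1/2)\<^sup>2)) * exp v = exp (- (\<beta> * (1/3)\<^sup>2))"
    by (simp add: exp_add[symmetric] v_def power2_eq_square)
  have "2 * (2 + 9/5 * v) \<le> (2 + 4/5 * v) * (1 + v + v\<^sup>2 / 2)"
  proof -
    have "(2 + 4/5 * v) * (1 + v + v\<^sup>2 / 2) - 2 * (2 + 9/5 * v) = - 2 - 4/5 * v + 9/5 * v\<^sup>2 + 2/5 * (v * v\<^sup>2)"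
      by (simp add: power2_eq_square field_simps)
    moreover have "126/100 * v\<^sup>2 \<le> v * v\<^sup>2" using v by (intro mult_right_mono) auto
    ultimately show ?thesis using v2 v3 by argo
  qed
  also have "\<dots> \<le> (2 + 4/5 * v) * exp v" using ev v by (intro mult_left_mono) auto
  finally have "2 * (2 + 9/5 * v) * exp (- (\<beta> * (1/2)\<^sup>2)) \<le> (2 + 4/5 * v) * exp v * exp (- (\<beta> * (1/2)\<^sup>2))"
    by (rule mult_right_mono) simp
  then have "2 * gauss_weight \<beta> (1/2) \<le> gauss_weight \<beta> (1/3)"
    unfolding gauss_weight_def e[symmetric] by (simp add: v_def power2_eq_square algebra_simps)
  also have "\<dots> \<le> gauss_weight \<beta> x" using x \<beta> by (intro gauss_weight_antimono) auto
  finally show "2 * gauss_weight \<beta> (1/2) \<le> gauss_weight \<beta> x" .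
  have "2 \<le> exp v" using ev v v3 by simp
  then have "2 * exp (- (\<beta> * (1/2)\<^sup>2)) \<le> exp v * exp (- (\<beta> * (1/2)\<^sup>2))"
    by (rule mult_right_mono) simp
  also have "\<dots> = exp (- (\<beta> * (1/3)\<^sup>2))" using e by (simp add: mult.commute)
  also have "\<dots> \<le> exp (- (\<beta> * x\<^sup>2))" using x \<beta> by (auto intro!: mult_left_mono power_mono)
  finally show "2 * exp (- (\<beta> * (1/2)\<^sup>2)) \<le> exp (- (\<beta> * x\<^sup>2))" .
qed

text \<open>Either the whole stretch from c - \<eta> outwards lies in the convex region, or the
  centre is the innermost half-integer and \<open>half_far\<close> takes over.\<close>

definition diff_admissible :: "real \<Rightarrow> real \<Rightarrow> bool" where
  "diff_admissible c \<eta> \<longleftrightarrow> 0 \<le> \<eta> \<and> (1/3 \<le> c - \<eta> \<or> c = 1/2 \<and> \<eta> \<le> 1/2)"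

lemma diff_admissible_facts:
  assumes \<beta>: "91/10 \<le> \<beta>" and a: "diff_admissible c \<eta>"
  shows "0 \<le> gauss_diff c \<eta> \<beta>" and "\<beta> * gauss_diff_slope c \<eta> \<beta> \<le> 2 * gauss_diff c \<eta> \<beta>"
proof -
  have "0 \<le> gauss_diff c \<eta> \<beta> \<and> 2 * gauss_weight \<beta> c \<le> gauss_weight \<beta> (c - \<eta>) + gauss_weight \<beta> (c + \<eta>)"
  proof (cases "1/3 \<le> c - \<eta>")
    case True
    then show ?thesis using gauss_weight_midpoint[of \<beta> \<eta> c] gauss_midpoint[of \<beta> \<eta> c] a \<beta> by (simp add: diff_admissible_def)
  next
    case False
    then have c: "c = 1/2" "0 \<le> c - \<eta>" "c - \<eta> \<le> 1/3" using a by (auto simp: diff_admissible_def)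
    have 1: "0 \<le> gauss_weight \<beta> (1/2 + \<eta>)" using \<beta> by (simp add: gauss_weight_def)
    have 2: "0 \<le> exp (- (\<beta> * (1/2 + \<eta>)\<^sup>2))" by simp
    note 3 = half_far[OF \<beta> c(2,3)[unfolded c(1)]]
    show ?thesis unfolding gauss_diff_def c(1) using 1 2 3 by linarith
  qed
  then show "0 \<le> gauss_diff c \<eta> \<beta>" and "\<beta> * gauss_diff_slope c \<eta> \<beta> \<le> 2 * gauss_diff c \<eta> \<beta>"
    using gauss_diff_weight[of c \<eta> \<beta>] by auto
qed

text \<open>\<beta> stands for pi e^t / y and \<gamma> for the squared height of a row; sqrt \<beta>
  is e^(t/2) up to a factor depending on y only.\<close>

definition row_excess :: "real \<Rightarrow> real \<Rightarrow> real \<Rightarrow> real \<Rightarrow> real" where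
  "row_excess \<gamma> c \<eta> \<beta> = sqrt \<beta> * exp (- (\<beta> * \<gamma>)) * gauss_diff c \<eta> \<beta>"

lemma row_excess_deriv:
  assumes "0 < \<beta>"
  shows "(row_excess \<gamma> c \<eta> has_real_derivative (exp (- (\<beta> * \<gamma>)) / sqrt \<beta> * ((1/2 - \<beta> * \<gamma>) * gauss_diff c \<eta> \<beta> + \<beta> * gauss_diff_slope c \<eta> \<beta>))) (at \<beta>)"
proof -
  have s: "sqrt \<beta> \<noteq> 0" "sqrt \<beta> * sqrt \<beta> = \<beta>" using assms by auto
  have "(row_excess \<gamma> c \<eta> has_real_derivative ((inverse (sqrt \<beta>) / 2) * exp (- (\<beta> * \<gamma>)) * gauss_diff c \<eta> \<beta>
     + sqrt \<beta> * (exp (- (\<beta> * \<gamma>)) * - \<gamma>) * gauss_diff c \<eta> \<beta> + sqrt \<beta> * exp (- (\<beta> * \<gamma>)) * gauss_diff_slope c \<eta> \<beta>)) (at \<beta>)"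
    unfolding row_excess_def[abs_def] using assms
    by (auto intro!: derivative_eq_intros gauss_diff_deriv simp: algebra_simps)
  moreover have "(inverse r / 2) * E * R + r * (E * - \<gamma>) * R + r * E * D = E / r * ((1/2 - (r * r) * \<gamma>) * R + (r * r) * D)"
    if "r \<noteq> 0" for r E R D :: real
    using that by (simp add: field_simps)
  from this[OF s(1)] have "(inverse (sqrt \<beta>) / 2) * exp (- (\<beta> * \<gamma>)) * gauss_diff c \<eta> \<beta>
     + sqrt \<beta> * (exp (- (\<beta> * \<gamma>)) * - \<gamma>) * gauss_diff c \<eta> \<beta> + sqrt \<beta> * exp (- (\<beta> * \<gamma>)) * gauss_diff_slope c \<eta> \<beta>
     = exp (- (\<beta> * \<gamma>)) / sqrt \<beta> * ((1/2 - \<beta> * \<gamma>) * gauss_diff c \<eta> \<beta> + \<beta> * gauss_diff_slope c \<eta> \<beta>)"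
    unfolding s(2) .
  ultimately show ?thesis by (simp only:)
qed

text \<open>1/2 from sqrt \<beta> and 2 from the separated power of \<beta> add up to 5/2, which the
  decay rate \<beta> \<gamma> of the row has to beat.\<close>

lemma row_excess_deriv_le:
  assumes \<beta>: "91/10 \<le> \<beta>" and a: "diff_admissible c \<eta>"
  shows "exp (- (\<beta> * \<gamma>)) / sqrt \<beta> * ((1/2 - \<beta> * \<gamma>) * gauss_diff c \<eta> \<beta> + \<beta> * gauss_diff_slope c \<eta> \<beta>)
     \<le> exp (- (\<beta> * \<gamma>)) / sqrt \<beta> * (- (\<beta> * \<gamma> - 5/2) * gauss_diff c \<eta> \<beta>)"
  using diff_admissible_facts(2)[OF \<beta> a] \<beta> by (intro mult_left_mono) (auto simp: algebra_simps)

lemma row_excess_antimono: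
  assumes b: "91/10 \<le> b1" "b1 \<le> b2" and a: "diff_admissible c \<eta>" and g: "5/2 \<le> b1 * \<gamma>"
  shows "row_excess \<gamma> c \<eta> b2 \<le> row_excess \<gamma> c \<eta> b1"
proof (rule DERIV_nonpos_imp_nonincreasing[OF b(2)])
  fix \<beta> assume \<beta>: "b1 \<le> \<beta>" "\<beta> \<le> b2"
  have \<gamma>: "0 \<le> \<gamma>"
  proof (rule ccontr)
    assume "\<not> 0 \<le> \<gamma>"
    then have "b1 * \<gamma> < 0" using b by (intro mult_pos_neg) auto
    then show False using g by simp
  qed
  have "5/2 \<le> \<beta> * \<gamma>" using g mult_right_mono[OF \<beta>(1) \<gamma>] by linarith
  then have "exp (- (\<beta> * \<gamma>)) / sqrt \<beta> * (- (\<beta> * \<gamma> - 5/2) * gauss_diff c \<eta> \<beta>) \<le> 0"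
    using diff_admissible_facts(1)[of \<beta> c \<eta>] b \<beta> a by (intro mult_nonneg_nonpos mult_nonpos_nonneg) auto
  moreover have \<beta>9: "91/10 \<le> \<beta>" using b \<beta> by simp
  moreover have "0 < \<beta>" using \<beta>9 by simp
  ultimately show "\<exists>y. (row_excess \<gamma> c \<eta> has_real_derivative y) (at \<beta>) \<and> y \<le> 0"
    using row_excess_deriv[of \<beta> \<gamma> c \<eta>] order_trans[OF row_excess_deriv_le[OF \<beta>9 a, of \<gamma>]] by blast
qed

text \<open>A quantitative form of convexity, of the same order \<beta> \<delta>^2 as the loss in
  the even rows that it has to cover. With X = \<beta> \<delta> and w = \<beta> \<delta>^2 it says
  exp(-w) cosh X - 1 \<ge> w/10. This follows from cosh X \<ge> exp(11/10 w), which uses w \<le>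
  X^2/9 for small X and w \<le> X/2 for large X.\<close>

lemma gauss_diff_half_lower:
  assumes \<beta>: "9 \<le> \<beta>" and \<delta>: "0 \<le> \<delta>" "\<delta> \<le> 1/2"
  shows "1/5 * exp (- (\<beta> / 4)) * (\<beta> * \<delta>\<^sup>2) \<le> gauss_diff (1/2) \<delta> \<beta>"
proof -
  define X where "X = \<beta> * \<delta>"
  define w where "w = \<beta> * \<delta>\<^sup>2"
  have X0: "0 \<le> X" "0 \<le> w" using \<beta> \<delta> by (auto simp: X_def w_def)
  have "w * 9 \<le> w * \<beta>" using \<beta> X0 by (intro mult_left_mono) auto
  then have w9: "9 * w \<le> X\<^sup>2" by (simp add: w_def X_def power2_eq_square mult_ac)
  have wX: "w \<le> X / 2"
    using mult_left_mono[OF \<delta>(2), of X] X0 by (simp add: w_def X_def power2_eq_square mult_ac)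
  have cosh: "exp (11/10 * w) \<le> cosh X"
  proof (cases "X \<le> 2")
    case True
    define s where "s = X\<^sup>2"
    have s: "0 \<le> s" "s \<le> 4" using X0 True power_mono[of X 2 2] by (auto simp: s_def)
    define z where "z = 11/90 * s"
    have z: "0 \<le> z" "z < 1" using s by (auto simp: z_def)
    have "1 - z \<le> exp (- z)" using exp_ge_add_one_self[of "- z"] by simp
    then have "exp z * (1 - z) \<le> exp z * exp (- z)" by (intro mult_left_mono) auto
    then have "exp z \<le> 1 / (1 - z)" using z by (simp add: exp_add[symmetric] pos_le_divide_eq)
    also have "\<dots> \<le> 1 + s / 2"
    proof -
      have "s * s \<le> 4 * s" using s by (intro mult_right_mono) auto
      then have "1 \<le> (1 + s / 2) * (1 - z)" using s by (simp add: z_def algebra_simps)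
      then show ?thesis using z by (simp add: pos_divide_le_eq)
    qed
    also have "\<dots> \<le> cosh X"
    proof -
      have "(X / 2)\<^sup>2 \<le> (sinh (X / 2))\<^sup>2" using sinh_ge_self[of "X / 2"] X0 by (intro power_mono) auto
      moreover have "cosh X = 1 + 2 * (sinh (X / 2))\<^sup>2"
        using cosh_double[of "X / 2"] cosh_square_eq[of "X / 2"] by simp
      ultimately show ?thesis by (simp add: s_def power_divide)
    qed
    finally have "exp z \<le> cosh X" .
    moreover have "exp (11/10 * w) \<le> exp z" using w9 by (simp add: z_def s_def)
    ultimately show ?thesis by linarith
  next
    case False
    have "2 \<le> exp (9/20 * X)"
    proof -
      have "2 \<le> 1 + 9/10 + (9/10)\<^sup>2 / (2::real)" by (simp add: power2_eq_square)
      also have "\<dots> \<le> exp (9/10)" by (rule exp_lower_Taylor_quadratic) simp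
      also have "\<dots> \<le> exp (9/20 * X)" using False by simp
      finally show ?thesis .
    qed
    then have "exp (11/20 * X) * 2 \<le> exp (11/20 * X) * exp (9/20 * X)" by (intro mult_left_mono) auto
    also have "\<dots> = exp X" by (simp add: exp_add[symmetric])
    also have "\<dots> \<le> 2 * cosh X" by (simp add: cosh_field_def)
    finally have "exp (11/20 * X) \<le> cosh X" by simp
    moreover have "exp (11/10 * w) \<le> exp (11/20 * X)" using wX by simp
    ultimately show ?thesis by linarith
  qed
  have "1 + w / 10 \<le> exp (w / 10)" by (rule exp_ge_add_one_self)
  also have "\<dots> = exp (- w) * exp (11/10 * w)" by (simp add: exp_add[symmetric])
  also have "\<dots> \<le> exp (- w) * cosh X" using cosh by (intro mult_left_mono) auto
  finally have "w / 10 \<le> exp (- w) * cosh X - 1" by simp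
  then have "2 * exp (- (\<beta> / 4)) * (w / 10) \<le> 2 * exp (- (\<beta> / 4)) * (exp (- w) * cosh X - 1)"
    by (intro mult_left_mono) auto
  moreover have "gauss_diff (1/2) \<delta> \<beta> = 2 * exp (- (\<beta> / 4)) * (exp (- w) * cosh X - 1)"
  proof -
    have 1: "- (\<beta> * (1/2 - \<delta>)\<^sup>2) = - (\<beta> / 4) + (- w + X)" "- (\<beta> * (1/2 + \<delta>)\<^sup>2) = - (\<beta> / 4) + (- w + - X)"
      "- (\<beta> * (1/2)\<^sup>2) = - (\<beta> / 4)"
      by (simp_all add: w_def X_def power2_eq_square algebra_simps)
    show ?thesis unfolding gauss_diff_def 1 exp_add by (simp add: cosh_field_def algebra_simps)
  qed
  ultimately show ?thesis by (simp add: w_def)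
qed

text \<open>In v = \<beta> \<gamma> with \<gamma> \<ge> 36/100, the loss \<beta>/4 of the reference
  term is at most 25/36 v, and the subtracted 1 is the decay of row 1. Further 47/1000 = 1/5 *
  47/200, where 47/200 v \<le> v - 5/2 as soon as v \<ge> 327/100.\<close>

lemma m_deficit:
  fixes v :: real and m :: nat
  assumes v: "327/100 \<le> v" and m: "2 \<le> m"
  shows "(real m) ^ 4 * exp (- (((real m)\<^sup>2 - 25/36 - 1) * v)) \<le> 47/1000 / 2 ^ m"
proof -
  obtain k where k: "m = k + 2" using m le_Suc_ex by (metis add.commute)
  have p: "(real (k + 2)) ^ 4 \<le> 16 * 6 ^ k"
  proof (induction k)
    case (Suc k)
    have "(real (Suc k + 2)) ^ 4 \<le> (3/2 * real (k + 2)) ^ 4" by (intro power_mono) auto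
    also have "\<dots> = (3/2) ^ 4 * (real (k + 2)) ^ 4" by (rule power_mult_distrib)
    also have "\<dots> \<le> 6 * (real (k + 2)) ^ 4" by (intro mult_right_mono) (auto simp: power_divide)
    finally show ?case using Suc by simp
  qed simp
  have "83/36 + real k \<le> (real m)\<^sup>2 - 25/36 - 1"
    by (simp add: k power2_eq_square algebra_simps)
  then have "(83/36 + real k) * v \<le> ((real m)\<^sup>2 - 25/36 - 1) * v" using v by (intro mult_right_mono) auto
  then have "exp (- (((real m)\<^sup>2 - 25/36 - 1) * v)) \<le> exp (- (83/36 * v) + real k * (- v))" by (simp add: algebra_simps)
  also have "\<dots> = exp (- (83/36 * v)) * exp (- v) ^ k" unfolding exp_add exp_of_nat_mult ..
  also have "\<dots> \<le> 58/100000 * (1/12) ^ k"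
  proof (rule mult_mono)
    have "exp (- (83/36 * v)) \<le> 1 / (1105/1000) ^ 75" using v by (intro exp_minus_le_power) simp
    also have "\<dots> \<le> 58/100000" by (simp add: power_divide)
    finally show "exp (- (83/36 * v)) \<le> 58/100000" .
    have "exp (- v) \<le> 1 / (1105/1000) ^ 32" using v by (intro exp_minus_le_power) simp
    also have "\<dots> \<le> 1/12" by (simp add: power_divide)
    finally show "exp (- v) ^ k \<le> (1/12) ^ k" by (intro power_mono) auto
  qed auto
  finally have e: "exp (- (((real m)\<^sup>2 - 25/36 - 1) * v)) \<le> 58/100000 * (1/12) ^ k" .
  have "(real m) ^ 4 * exp (- (((real m)\<^sup>2 - 25/36 - 1) * v)) \<le> (16 * 6 ^ k) * (58/100000 * (1/12) ^ k)"
    using p e by (intro mult_mono) (auto simp: k)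
  also have "\<dots> = 928/100000 / 2 ^ k" using power_mult_distrib[of 6 "2::real" k] by (simp add: power_divide)
  also have "\<dots> \<le> 47/1000 / 2 ^ m" by (simp add: k field_simps)
  finally show ?thesis .
qed

text \<open>In even rows $x = 1/2$ is the worst place for the central Gaussian; this is the only contribution of the wrong sign.\<close>

definition row_dip :: "real \<Rightarrow> real \<Rightarrow> real \<Rightarrow> real" where
  "row_dip \<gamma> \<xi> \<beta> = sqrt \<beta> * exp (- (\<beta> * \<gamma>)) * (exp (- (\<beta> * \<xi>\<^sup>2)) - 1)"

lemma row_dip_deriv:
  assumes \<beta>: "0 < \<beta>" and \<gamma>: "0 \<le> \<gamma>"
  obtains D where "(row_dip \<gamma> \<xi> has_real_derivative D) (at \<beta>)"
    "D \<le> exp (- (\<beta> * \<gamma>)) / sqrt \<beta> * ((\<beta> * \<gamma>) * (\<beta> * \<xi>\<^sup>2))"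
proof
  define E where "E = exp (- (\<beta> * \<xi>\<^sup>2))"
  define D where "D = (inverse (sqrt \<beta>) / 2) * exp (- (\<beta> * \<gamma>)) * (E - 1)
     + sqrt \<beta> * (exp (- (\<beta> * \<gamma>)) * - \<gamma>) * (E - 1) + sqrt \<beta> * exp (- (\<beta> * \<gamma>)) * (E * - (\<xi>\<^sup>2))"
  show "(row_dip \<gamma> \<xi> has_real_derivative D) (at \<beta>)"
    unfolding row_dip_def[abs_def] D_def E_def using \<beta>
    by (auto intro!: derivative_eq_intros simp: algebra_simps add_divide_distrib diff_divide_distrib)
  have s: "sqrt \<beta> \<noteq> 0" "sqrt \<beta> * sqrt \<beta> = \<beta>" using \<beta> by auto
  have "(inverse r / 2) * X * (E - 1) + r * (X * - \<gamma>) * (E - 1) + r * X * (E * - (\<xi>\<^sup>2))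
      = X / r * (((r * r) * \<gamma> - 1/2) * (1 - E) - (r * r) * \<xi>\<^sup>2 * E)" if "r \<noteq> 0" for r X :: real
    using that by (simp add: field_simps)
  from this[OF s(1)] have "D = exp (- (\<beta> * \<gamma>)) / sqrt \<beta> * ((\<beta> * \<gamma> - 1/2) * (1 - E) - \<beta> * \<xi>\<^sup>2 * E)"
    unfolding D_def s(2) .
  also have "\<dots> \<le> exp (- (\<beta> * \<gamma>)) / sqrt \<beta> * ((\<beta> * \<gamma>) * (\<beta> * \<xi>\<^sup>2))"
  proof (rule mult_left_mono)
    have E1: "0 \<le> 1 - E" "1 - E \<le> \<beta> * \<xi>\<^sup>2" "0 \<le> E"
      using exp_ge_add_one_self[of "- (\<beta> * \<xi>\<^sup>2)"] \<beta> by (auto simp: E_def)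
    have "(\<beta> * \<gamma> - 1/2) * (1 - E) \<le> (\<beta> * \<gamma>) * (1 - E)" using E1 by (intro mult_right_mono) auto
    also have "\<dots> \<le> (\<beta> * \<gamma>) * (\<beta> * \<xi>\<^sup>2)" using E1 \<beta> \<gamma> by (intro mult_left_mono) auto
    finally show "(\<beta> * \<gamma> - 1/2) * (1 - E) - \<beta> * \<xi>\<^sup>2 * E \<le> (\<beta> * \<gamma>) * (\<beta> * \<xi>\<^sup>2)"
      using E1 \<beta> by (simp add: add_increasing2 diff_le_eq)
  qed (use \<beta> in auto)
  finally show "D \<le> exp (- (\<beta> * \<gamma>)) / sqrt \<beta> * ((\<beta> * \<gamma>) * (\<beta> * \<xi>\<^sup>2))" .
qed

text \<open>The shift in row m is at most m \<delta>, so the derivative of the dip carries m^4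
  \<beta> \<delta>^2 against a row factor exp(-v m^2). Row 1 gains at the order \<beta> \<delta>^2
  by \<open>gauss_diff_half_lower\<close>, and a share 2^(-m) of that gain is enough.\<close>

lemma row_dip_le_excess:
  assumes b: "91/10 \<le> b1" "b1 \<le> b2" and \<gamma>: "36/100 \<le> \<gamma>" and \<delta>: "0 \<le> \<delta>" "\<delta> \<le> 1/2"
    and m: "2 \<le> m" and \<xi>: "\<bar>\<xi>\<bar> \<le> real m * \<delta>"
  shows "row_dip (\<gamma> * (real m)\<^sup>2) \<xi> b2 - row_dip (\<gamma> * (real m)\<^sup>2) \<xi> b1 \<le> 1 / 2 ^ m * (row_excess \<gamma> (1/2) \<delta> b1 - row_excess \<gamma> (1/2) \<delta> b2)"
proof -
  define f where "f = (\<lambda>\<beta>. row_dip (\<gamma> * (real m)\<^sup>2) \<xi> \<beta> + 1 / 2 ^ m * row_excess \<gamma> (1/2) \<delta> \<beta>)"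
  have "f b2 \<le> f b1"
  proof (rule DERIV_nonpos_imp_nonincreasing[OF b(2)])
    fix \<beta> assume "b1 \<le> \<beta>" "\<beta> \<le> b2"
    then have \<beta>: "91/10 \<le> \<beta>" using b by simp
    define M where "M = (real m)\<^sup>2"
    define v where "v = \<beta> * \<gamma>"
    have v: "327/100 \<le> v" using mult_mono[of "91/10" \<beta> "36/100" \<gamma>] \<beta> \<gamma> by (simp add: v_def)
    have \<beta>v: "\<beta> / 4 \<le> 25/36 * v" using mult_left_mono[OF \<gamma>, of \<beta>] \<beta> by (simp add: v_def)
    have a: "diff_admissible (1/2) \<delta>" using \<delta> by (simp add: diff_admissible_def)
    obtain D where D: "(row_dip (\<gamma> * M) \<xi> has_real_derivative D) (at \<beta>)"
      "D \<le> exp (- (\<beta> * (\<gamma> * M))) / sqrt \<beta> * ((\<beta> * (\<gamma> * M)) * (\<beta> * \<xi>\<^sup>2))"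
      by (rule row_dip_deriv[of \<beta> "\<gamma> * M" \<xi>]) (use \<beta> \<gamma> in \<open>auto simp: M_def\<close>)
    define H where "H = exp (- v) / sqrt \<beta> * ((1/2 - v) * gauss_diff (1/2) \<delta> \<beta> + \<beta> * gauss_diff_slope (1/2) \<delta> \<beta>)"
    have H: "(row_excess \<gamma> (1/2) \<delta> has_real_derivative H) (at \<beta>)"
      using row_excess_deriv[of \<beta> \<gamma> "1/2" \<delta>] \<beta> by (simp add: H_def v_def)
    have Hle: "H \<le> exp (- v) / sqrt \<beta> * (- (v - 5/2) * gauss_diff (1/2) \<delta> \<beta>)"
      using row_excess_deriv_le[OF \<beta> a, of \<gamma>] by (simp add: H_def v_def)
    have d2: "0 \<le> \<beta> * \<delta>\<^sup>2" using \<beta> by simp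
    have "D \<le> 1 / 2 ^ m * (exp (- v) / sqrt \<beta> * ((v - 5/2) * gauss_diff (1/2) \<delta> \<beta>))"
    proof -
      have "\<xi>\<^sup>2 \<le> (real m * \<delta>)\<^sup>2" using \<xi> by (metis abs_ge_zero power2_abs power_mono)
      then have "\<beta> * \<xi>\<^sup>2 \<le> M * (\<beta> * \<delta>\<^sup>2)" using \<beta> by (simp add: M_def power_mult_distrib mult_left_mono mult.left_commute)
      then have "(v * M) * (\<beta> * \<xi>\<^sup>2) \<le> (v * M) * (M * (\<beta> * \<delta>\<^sup>2))" using v by (intro mult_left_mono) (auto simp: M_def)
      then have "exp (- (v * M)) / sqrt \<beta> * ((v * M) * (\<beta> * \<xi>\<^sup>2)) \<le> exp (- (v * M)) / sqrt \<beta> * ((v * M) * (M * (\<beta> * \<delta>\<^sup>2)))"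
        by (rule mult_left_mono) (use \<beta> in auto)
      with D(2) have "D \<le> exp (- (v * M)) / sqrt \<beta> * ((v * M) * (M * (\<beta> * \<delta>\<^sup>2)))"
        by (simp add: v_def mult_ac)
      also have "\<dots> = (v * exp (- v) / sqrt \<beta> * exp (- (25/36 * v)) * (\<beta> * \<delta>\<^sup>2)) * (M * M * exp (- ((M - 25/36 - 1) * v)))"
      proof -
        have "exp (- (v * M)) = exp (- v) * exp (- (25/36 * v)) * exp (- ((M - 25/36 - 1) * v))"
          by (simp add: exp_add[symmetric] algebra_simps)
        then show ?thesis by (simp add: mult_ac)
      qed
      also have "\<dots> \<le> (v * exp (- v) / sqrt \<beta> * exp (- (25/36 * v)) * (\<beta> * \<delta>\<^sup>2)) * (47/1000 / 2 ^ m)"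
      proof (rule mult_left_mono)
        show "M * M * exp (- ((M - 25/36 - 1) * v)) \<le> 47/1000 / 2 ^ m"
          using m_deficit[OF v m] by (simp add: M_def power4_eq_xxxx power2_eq_square mult_ac)
      qed (use v d2 \<beta> in auto)
      also have "\<dots> = 1 / 2 ^ m * (exp (- v) / sqrt \<beta> * ((47/200 * v) * (1/5 * exp (- (25/36 * v)) * (\<beta> * \<delta>\<^sup>2))))"
        by (simp add: mult_ac)
      also have "\<dots> \<le> 1 / 2 ^ m * (exp (- v) / sqrt \<beta> * ((v - 5/2) * gauss_diff (1/2) \<delta> \<beta>))"
      proof (intro mult_left_mono mult_mono)
        have "1/5 * exp (- (25/36 * v)) * (\<beta> * \<delta>\<^sup>2) \<le> 1/5 * exp (- (\<beta> / 4)) * (\<beta> * \<delta>\<^sup>2)"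
          using \<beta>v d2 by (intro mult_right_mono mult_left_mono) auto
        also have "\<dots> \<le> gauss_diff (1/2) \<delta> \<beta>" using \<beta> \<delta> by (intro gauss_diff_half_lower) auto
        finally show "1/5 * exp (- (25/36 * v)) * (\<beta> * \<delta>\<^sup>2) \<le> gauss_diff (1/2) \<delta> \<beta>" .
      qed (use v d2 \<beta> in auto)
      finally show ?thesis .
    qed
    moreover have "1 / 2 ^ m * H \<le> 1 / 2 ^ m * (exp (- v) / sqrt \<beta> * (- (v - 5/2) * gauss_diff (1/2) \<delta> \<beta>))"
      by (rule mult_left_mono[OF Hle]) simp
    moreover have "1 / 2 ^ m * (exp (- v) / sqrt \<beta> * (- (v - 5/2) * gauss_diff (1/2) \<delta> \<beta>))
        = - (1 / 2 ^ m * (exp (- v) / sqrt \<beta> * ((v - 5/2) * gauss_diff (1/2) \<delta> \<beta>)))"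
      by (simp only: mult_minus_left mult_minus_right)
    ultimately have "D + 1 / 2 ^ m * H \<le> 0" by linarith
    moreover have "(f has_real_derivative (D + 1 / 2 ^ m * H)) (at \<beta>)"
      unfolding f_def using D(1) H by (intro DERIV_add DERIV_cmult) (auto simp: M_def)
    ultimately show "\<exists>y. (f has_real_derivative y) (at \<beta>) \<and> y \<le> 0" by blast
  qed
  then show ?thesis by (simp add: f_def algebra_simps)
qed

section \<open>Theta functions summed by rows of the lattice\<close>

definition row_sum :: "real \<Rightarrow> real \<Rightarrow> real \<Rightarrow> real" where
  "row_sum \<gamma> \<beta> x = (\<Sum>\<^sub>\<infinity>m::int. sqrt \<beta> * exp (- (\<beta> * (\<gamma> * (of_int m)\<^sup>2))) * gauss_sum \<beta> (of_int m * x))"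

lemma row_sum_theta:
  assumes "0 < \<beta>" "0 < y"
  shows "((\<lambda>m::int. sqrt \<beta> * exp (- (\<beta> * (y\<^sup>2 * (of_int m)\<^sup>2))) * gauss_sum \<beta> (of_int m * x)) has_sum
    sqrt \<beta> * theta (\<beta> * y / pi) (Complex x y)) UNIV"
proof -
  have "((\<lambda>m::int. exp (- (\<beta> * (y\<^sup>2 * (of_int m)\<^sup>2))) * gauss_sum \<beta> (of_int m * x)) has_sum theta (\<beta> * y / pi) (Complex x y)) UNIV"
    using theta_spatial[of "\<beta> * y / pi" y x] assms by (simp add: power2_eq_square mult_ac)
  from has_sum_cmult_right[OF this, of "sqrt \<beta>"] show ?thesis by (simp add: mult_ac)
qed

lemma row_sum_has_sum:
  assumes "0 < \<beta>" "0 < y"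
  shows "((\<lambda>m::int. sqrt \<beta> * exp (- (\<beta> * (y\<^sup>2 * (of_int m)\<^sup>2))) * gauss_sum \<beta> (of_int m * x)) has_sum row_sum (y\<^sup>2) \<beta> x) UNIV"
  unfolding row_sum_def using has_sum_imp_summable[OF row_sum_theta[OF assms]] by (rule has_sum_infsum)

lemma ntheta_row_sum:
  assumes "0 < y"
  shows "ntheta t x y = sqrt (y / pi) * row_sum (y\<^sup>2) (pi * exp t / y) x"
proof -
  define \<beta> where "\<beta> = pi * exp t / y"
  have \<beta>: "0 < \<beta>" "\<beta> * y / pi = exp t" using assms by (auto simp: \<beta>_def)
  have "row_sum (y\<^sup>2) \<beta> x = sqrt \<beta> * theta (exp t) (Complex x y)"
    using has_sum_unique[OF row_sum_has_sum[OF \<beta>(1) assms] row_sum_theta[OF \<beta>(1) assms]] \<beta>(2) by simp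
  moreover have "sqrt (y / pi) * sqrt \<beta> = exp (t / 2)"
  proof -
    have "sqrt (y / pi) * sqrt \<beta> = sqrt (exp t)"
      using assms by (simp add: real_sqrt_mult[symmetric] \<beta>_def)
    also have "\<dots> = exp (t / 2)"
      by (rule real_sqrt_unique) (auto simp: power2_eq_square exp_add[symmetric])
    finally show ?thesis .
  qed
  ultimately show ?thesis by (simp add: ntheta_def \<beta>_def[symmetric] mult.assoc[symmetric])
qed

text \<open>Pairing n with -1 - n makes the points symmetric about the origin at distances n + 1/2,
  so moving the offset away from 1/2 acts on each pair through \<open>gauss_diff\<close>.\<close>

lemma gauss_sum_half_expand:
  assumes "0 < \<beta>"
  shows "((\<lambda>n::nat. gauss_diff (real n + 1/2) \<eta> \<beta>) has_sum (gauss_sum \<beta> (1/2 - \<eta>) - gauss_sum \<beta> (1/2))) UNIV"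
proof -
  have p: "((\<lambda>n::nat. exp (- \<beta> * (of_int (int n) + \<xi>)\<^sup>2) + exp (- \<beta> * (of_int (- 1 - int n) + \<xi>)\<^sup>2)) has_sum gauss_sum \<beta> \<xi>) UNIV" for \<xi>
    unfolding gauss_sum_def by (rule int_has_sum_pair1[OF gauss_summable[OF assms]])
  have sq: "(of_int (- 1 - int n) + (1/2 - \<eta>))\<^sup>2 = (real n + 1/2 + \<eta>)\<^sup>2" for n \<eta>
    by (simp add: power2_eq_square algebra_simps)
  have "((\<lambda>n::nat. (exp (- \<beta> * (of_int (int n) + (1/2 - \<eta>))\<^sup>2) + exp (- \<beta> * (of_int (- 1 - int n) + (1/2 - \<eta>))\<^sup>2))
     - (exp (- \<beta> * (of_int (int n) + (1/2 - 0))\<^sup>2) + exp (- \<beta> * (of_int (- 1 - int n) + (1/2 - 0))\<^sup>2))) has_sum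
     (gauss_sum \<beta> (1/2 - \<eta>) - gauss_sum \<beta> (1/2 - 0))) UNIV"
    by (rule has_sum_real_diff[OF p p])
  then show ?thesis unfolding sq by (simp add: gauss_diff_def add_diff_eq)
qed

text \<open>The pairs of opposite nonzero integers give second differences as before; the unpaired
  point 0 moves away from the origin and contributes the dip exp(-\<beta> \<xi>^2) - 1.\<close>

lemma gauss_sum_zero_expand:
  assumes "0 < \<beta>"
  shows "((\<lambda>n::nat. gauss_diff (1 + real n) \<xi> \<beta>) has_sum (gauss_sum \<beta> \<xi> - gauss_sum \<beta> 0 - (exp (- (\<beta> * \<xi>\<^sup>2)) - 1))) UNIV"
proof -
  have p: "((\<lambda>n::nat. exp (- \<beta> * (of_int (1 + int n) + \<xi>)\<^sup>2) + exp (- \<beta> * (of_int (- 1 - int n) + \<xi>)\<^sup>2)) has_sum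
     (gauss_sum \<beta> \<xi> - exp (- \<beta> * (of_int 0 + \<xi>)\<^sup>2))) UNIV" for \<xi>
    unfolding gauss_sum_def by (rule int_has_sum_pair0[OF gauss_summable[OF assms]])
  have sq: "(of_int (- 1 - int n) + \<xi>)\<^sup>2 = (1 + real n - \<xi>)\<^sup>2" for n \<xi>
    by (simp add: power2_eq_square algebra_simps)
  from has_sum_real_diff[OF p[of \<xi>] p[of 0]] show ?thesis
    unfolding sq by (simp add: gauss_diff_def algebra_simps)
qed

text \<open>Offsets matter only up to integers and sign, in even rows through z and in odd rows
  through 1/2 - z. Keeping \<eta> \<le> |z| preserves m \<delta> as a bound for the shift in row
  m.\<close>

lemma nearest_int_reduce:
  obtains \<eta> where "0 \<le> \<eta>" "\<eta> \<le> 1/2" "\<eta> \<le> \<bar>z\<bar>"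
    "\<And>\<beta>. gauss_sum \<beta> z = gauss_sum \<beta> \<eta>" "\<And>\<beta>. gauss_sum \<beta> (1/2 - z) = gauss_sum \<beta> (1/2 - \<eta>)"
proof
  define r where "r = z - of_int (round z)"
  show "0 \<le> \<bar>r\<bar>" by simp
  show "\<bar>r\<bar> \<le> 1/2" using of_int_round_abs_le[of z] by (simp add: r_def abs_minus_commute)
  show "\<bar>r\<bar> \<le> \<bar>z\<bar>" using round_diff_minimal[of z 0] by (simp add: r_def)
  have r1: "gauss_sum \<beta> z = gauss_sum \<beta> r" for \<beta>
    using gauss_sum_plus_int[of \<beta> z "- round z"] by (simp add: r_def)
  have r2: "gauss_sum \<beta> (1/2 - z) = gauss_sum \<beta> (1/2 - r)" for \<beta>
    using gauss_sum_plus_int[of \<beta> "1/2 - z" "round z"] by (simp add: r_def algebra_simps)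
  have r3: "gauss_sum \<beta> (1/2 - (- r)) = gauss_sum \<beta> (1/2 - r)" for \<beta>
    using gauss_sum_plus_int[of \<beta> "- (1/2 - (- r))" 1] gauss_sum_minus[of \<beta> "1/2 - (- r)"] by (simp add: algebra_simps)
  show "gauss_sum \<beta> z = gauss_sum \<beta> \<bar>r\<bar>" for \<beta>
    using r1[of \<beta>] gauss_sum_minus[of \<beta> r] by (cases "0 \<le> r") auto
  show "gauss_sum \<beta> (1/2 - z) = gauss_sum \<beta> (1/2 - \<bar>r\<bar>)" for \<beta>
    using r2[of \<beta>] r3[of \<beta>] by (cases "0 \<le> r") auto
qed

text \<open>An odd row has offset 1/2 at x = 1/2, and every pair in it works in the right direction.
  Only the innermost pair is kept as a gain.\<close>

lemma odd_row:
  fixes M :: real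
  assumes b: "91/10 \<le> b1" "b1 \<le> b2" and M: "5/2 \<le> b1 * M" and \<eta>: "0 \<le> \<eta>" "\<eta> \<le> 1/2"
  defines "D \<equiv> \<lambda>\<beta>. sqrt \<beta> * exp (- (\<beta> * M)) * (gauss_sum \<beta> (1/2 - \<eta>) - gauss_sum \<beta> (1/2))"
  shows "D b2 - D b1 \<le> - (row_excess M (1/2) \<eta> b1 - row_excess M (1/2) \<eta> b2)"
proof -
  have D: "((\<lambda>n::nat. row_excess M (real n + 1/2) \<eta> \<beta>) has_sum D \<beta>) UNIV" if "0 < \<beta>" for \<beta>
    unfolding D_def row_excess_def by (rule has_sum_cmult_right[OF gauss_sum_half_expand[OF that]])
  have w: "((\<lambda>n::nat. if n = 0 then - 1 else 0) has_sum (- 1 :: real)) UNIV"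
    by (rule has_sum_finite_neutralI[of "{0}"]) auto
  have "D b2 - D b1 \<le> - 1 * (row_excess M (1/2) \<eta> b1 - row_excess M (1/2) \<eta> b2)"
  proof (rule has_sum_le_diff[OF D D w])
    fix n :: nat
    have "row_excess M (real n + 1/2) \<eta> b2 \<le> row_excess M (real n + 1/2) \<eta> b1" if "n \<noteq> 0"
    proof (rule row_excess_antimono[OF b _ M])
      have "1 \<le> real n" using that by simp
      then show "diff_admissible (real n + 1/2) \<eta>" using \<eta> by (simp add: diff_admissible_def)
    qed
    then show "row_excess M (real n + 1/2) \<eta> b2 - row_excess M (real n + 1/2) \<eta> b1 \<le> (if n = 0 then - 1 else 0) * (row_excess M (1/2) \<eta> b1 - row_excess M (1/2) \<eta> b2)"
      by (cases "n = 0") auto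
  qed (use b in auto)
  then show ?thesis by simp
qed

lemma even_row:
  fixes M :: real
  assumes b: "91/10 \<le> b1" "b1 \<le> b2" and M: "5/2 \<le> b1 * M" and \<eta>: "0 \<le> \<eta>" "\<eta> \<le> 1/2"
  defines "D \<equiv> \<lambda>\<beta>. sqrt \<beta> * exp (- (\<beta> * M)) * (gauss_sum \<beta> \<eta> - gauss_sum \<beta> 0)"
  shows "D b2 - D b1 \<le> row_dip M \<eta> b2 - row_dip M \<eta> b1"
proof -
  have D: "((\<lambda>n::nat. row_excess M (1 + real n) \<eta> \<beta>) has_sum (D \<beta> - row_dip M \<eta> \<beta>)) UNIV" if "0 < \<beta>" for \<beta>
    using has_sum_cmult_right[OF gauss_sum_zero_expand[OF that, of \<eta>], of "sqrt \<beta> * exp (- (\<beta> * M))"]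
    unfolding D_def row_excess_def row_dip_def by (simp add: algebra_simps)
  have "D b2 - row_dip M \<eta> b2 \<le> D b1 - row_dip M \<eta> b1"
  proof (rule has_sum_mono[OF D D])
    fix n :: nat
    show "row_excess M (1 + real n) \<eta> b2 \<le> row_excess M (1 + real n) \<eta> b1"
      by (rule row_excess_antimono[OF b _ M]) (use \<eta> in \<open>simp add: diff_admissible_def\<close>)
  qed (use b in auto)
  then show ?thesis by simp
qed

text \<open>Rows 1 and -1 contribute -1 each in units of the reference \<open>c\<close>, row 0 does
  not see x, and the rows with |m| \<ge> 2 cost at most 2^(-|m|), in total 1. This leaves
  -1.\<close>

lemma row_sum_x_move:
  assumes b: "91/10 \<le> b1" "b1 \<le> b2" and y: "6/10 \<le> y" and \<delta>: "0 \<le> \<delta>" "\<delta> \<le> 1/2"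
  shows "(row_sum (y\<^sup>2) b2 (1/2 - \<delta>) - row_sum (y\<^sup>2) b2 (1/2)) - (row_sum (y\<^sup>2) b1 (1/2 - \<delta>) - row_sum (y\<^sup>2) b1 (1/2))
    \<le> - (row_excess (y\<^sup>2) (1/2) \<delta> b1 - row_excess (y\<^sup>2) (1/2) \<delta> b2)"
proof -
  define \<gamma> where "\<gamma> = y\<^sup>2"
  have \<gamma>: "36/100 \<le> \<gamma>" using power_mono[OF y, of 2] by (simp add: \<gamma>_def power2_eq_square)
  define T where "T = (\<lambda>\<beta> (m::int) x. sqrt \<beta> * exp (- (\<beta> * (\<gamma> * (of_int m)\<^sup>2))) * gauss_sum \<beta> (of_int m * x))"
  define D where "D = (\<lambda>\<beta> m. T \<beta> m (1/2 - \<delta>) - T \<beta> m (1/2))"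
  define c where "c = row_excess \<gamma> (1/2) \<delta> b1 - row_excess \<gamma> (1/2) \<delta> b2"
  have Mm: "5/2 \<le> b1 * (\<gamma> * (of_int m)\<^sup>2)" if "m \<noteq> 0" for m :: int
  proof -
    have "(1::int) \<le> m\<^sup>2" using that by (simp add: int_one_le_iff_zero_less)
    then have "(1::real) \<le> (of_int m)\<^sup>2" by (metis of_int_1 of_int_le_iff of_int_power)
    then have "36/100 * 1 \<le> \<gamma> * (of_int m)\<^sup>2" using \<gamma> by (intro mult_mono) auto
    then have "91/10 * (36/100) \<le> b1 * (\<gamma> * (of_int m)\<^sup>2)" using b by (intro mult_mono) auto
    then show ?thesis by simp
  qed
  have Dsum: "(D \<beta> has_sum (row_sum \<gamma> \<beta> (1/2 - \<delta>) - row_sum \<gamma> \<beta> (1/2))) UNIV" if "0 < \<beta>" for \<beta>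
    unfolding D_def T_def \<gamma>_def using y that
    by (intro has_sum_real_diff row_sum_has_sum) auto
  have Deq: "D \<beta> m = sqrt \<beta> * exp (- (\<beta> * (\<gamma> * (of_int m)\<^sup>2))) * (gauss_sum \<beta> (of_int m * (1/2 - \<delta>)) - gauss_sum \<beta> (of_int m * (1/2)))" for \<beta> m
    by (simp add: D_def T_def algebra_simps)
  have adm: "diff_admissible (1/2) \<eta>" if "0 \<le> \<eta>" "\<eta> \<le> 1/2" for \<eta> using that by (simp add: diff_admissible_def)
  have c0: "0 \<le> c"
    unfolding c_def using row_excess_antimono[OF b adm[OF \<delta>], of \<gamma>] Mm[of 1] by simp
  have half: "gauss_sum \<beta> (of_int m * (1/2) - z) = gauss_sum \<beta> (1/2 - z)" if odd: "odd m" for \<beta> m z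
  proof -
    obtain k where "m = 2 * k + 1" using odd by (rule oddE)
    then show ?thesis using gauss_sum_plus_int[of \<beta> "1/2 - z" k] by (simp add: algebra_simps)
  qed
  have whole: "gauss_sum \<beta> (of_int m * (1/2) - z) = gauss_sum \<beta> z" if even: "even m" for \<beta> m z
  proof -
    obtain k where "m = 2 * k" using even by (rule evenE)
    then show ?thesis using gauss_sum_plus_int[of \<beta> "- z" k] gauss_sum_minus[of \<beta> z] by (simp add: algebra_simps)
  qed
  have mx: "of_int m * (1/2 - \<delta>) = of_int m * (1/2) - of_int m * \<delta>" for m :: int by (simp add: algebra_simps)
  have Dodd: "D \<beta> m = sqrt \<beta> * exp (- (\<beta> * (\<gamma> * (of_int m)\<^sup>2))) * (gauss_sum \<beta> (1/2 - of_int m * \<delta>) - gauss_sum \<beta> (1/2))" if "odd m" for \<beta> m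
    using half[OF that, of \<beta> "of_int m * \<delta>"] half[OF that, of \<beta> 0] unfolding Deq mx by simp
  have Deven: "D \<beta> m = sqrt \<beta> * exp (- (\<beta> * (\<gamma> * (of_int m)\<^sup>2))) * (gauss_sum \<beta> (of_int m * \<delta>) - gauss_sum \<beta> 0)" if "even m" for \<beta> m
    using whole[OF that, of \<beta> "of_int m * \<delta>"] whole[OF that, of \<beta> 0] unfolding Deq mx by simp
  have D1: "D b2 1 - D b1 1 \<le> - c"
    using odd_row[OF b _ \<delta>, of \<gamma>] Mm[of 1] Dodd[of 1] by (simp add: c_def)
  have Dm1: "D \<beta> (- 1) = D \<beta> 1" for \<beta>
    using gauss_sum_minus[of \<beta> "1/2 - \<delta>"] gauss_sum_minus[of \<beta> "1/2"] unfolding Deq by simp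
  have Dge2: "D b2 m - D b1 m \<le> (1/2) ^ nat \<bar>m\<bar> * c" if m: "2 \<le> \<bar>m\<bar>" for m
  proof -
    obtain \<eta> where \<eta>: "0 \<le> \<eta>" "\<eta> \<le> 1/2" "\<eta> \<le> \<bar>of_int m * \<delta>\<bar>"
      "\<And>\<beta>. gauss_sum \<beta> (of_int m * \<delta>) = gauss_sum \<beta> \<eta>" "\<And>\<beta>. gauss_sum \<beta> (1/2 - of_int m * \<delta>) = gauss_sum \<beta> (1/2 - \<eta>)"
      using nearest_int_reduce[of "of_int m * \<delta>"] by metis
    have m0: "m \<noteq> 0" using m by auto
    show ?thesis
    proof (cases "odd m")
      case True
      have "D b2 m - D b1 m \<le> - (row_excess (\<gamma> * (of_int m)\<^sup>2) (1/2) \<eta> b1 - row_excess (\<gamma> * (of_int m)\<^sup>2) (1/2) \<eta> b2)"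
        using odd_row[OF b Mm[OF m0] \<eta>(1,2)] unfolding Dodd[OF True] \<eta>(5) .
      also have "\<dots> \<le> 0"
        using row_excess_antimono[OF b adm[OF \<eta>(1,2)] Mm[OF m0]] by simp
      also have "0 \<le> (1/2) ^ nat \<bar>m\<bar> * c" using c0 by simp
      finally show ?thesis .
    next
      case False
      then have ev: "even m" by simp
      define k where "k = nat \<bar>m\<bar>"
      have k: "2 \<le> k" "real k = \<bar>of_int m\<bar>" "(real k)\<^sup>2 = (of_int m)\<^sup>2" using m by (auto simp: k_def)
      have "D b2 m - D b1 m \<le> row_dip (\<gamma> * (of_int m)\<^sup>2) \<eta> b2 - row_dip (\<gamma> * (of_int m)\<^sup>2) \<eta> b1"
        using even_row[OF b Mm[OF m0] \<eta>(1,2)] unfolding Deven[OF ev] \<eta>(4) .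
      also have "\<dots> \<le> 1 / 2 ^ k * (row_excess \<gamma> (1/2) \<delta> b1 - row_excess \<gamma> (1/2) \<delta> b2)"
        unfolding k(3)[symmetric]
        by (rule row_dip_le_excess[OF b \<gamma> \<delta> k(1)]) (use \<eta> \<delta> k in \<open>simp add: abs_mult\<close>)
      finally show ?thesis by (simp add: c_def k_def power_divide)
    qed
  qed
  define w where "w = (\<lambda>m::int. (1/2) ^ nat \<bar>m\<bar> + (if m = 0 then - 1 else if m = 1 \<or> m = - 1 then - 3/2 else (0::real)))"
  have w: "(w has_sum ((1 + 1/2) / (1 - 1/2) + (- 1 - 3/2 - 3/2))) UNIV"
  proof -
    have "((\<lambda>m::int. if m = 0 then - 1 else if m = 1 \<or> m = - 1 then - 3/2 else (0::real)) has_sum (- 1 - 3/2 - 3/2)) UNIV"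
      by (rule has_sum_finite_neutralI[of "{0, 1, - 1}"]) auto
    from has_sum_add[OF int_geometric_has_sum[of "1/2"] this] show ?thesis unfolding w_def by simp
  qed
  have "(row_sum \<gamma> b2 (1/2 - \<delta>) - row_sum \<gamma> b2 (1/2)) - (row_sum \<gamma> b1 (1/2 - \<delta>) - row_sum \<gamma> b1 (1/2))
     \<le> ((1 + 1/2) / (1 - 1/2) + (- 1 - 3/2 - 3/2)) * c"
  proof (rule has_sum_le_diff[OF Dsum Dsum w])
    fix m :: int
    consider "m = 0" | "m = 1" | "m = - 1" | "2 \<le> \<bar>m\<bar>" by linarith
    then show "D b2 m - D b1 m \<le> w m * c"
    proof cases
      case 1
      then show ?thesis by (simp add: D_def T_def w_def)
    next
      case 2
      then show ?thesis using D1 by (simp add: w_def)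
    next
      case 3
      then show ?thesis using D1 Dm1 by (simp add: w_def)
    next
      case 4
      then have "w m = (1/2) ^ nat \<bar>m\<bar>" by (auto simp: w_def)
      then show ?thesis using Dge2[OF 4] by simp
    qed
  qed (use b in auto)
  then show ?thesis by (simp add: c_def \<gamma>_def)
qed

lemma row_excess_strict:
  assumes b: "91/10 \<le> b1" "b1 < b2" and \<gamma>: "36/100 \<le> \<gamma>" and \<delta>: "0 < \<delta>" "\<delta> \<le> 1/2"
  shows "row_excess \<gamma> (1/2) \<delta> b2 < row_excess \<gamma> (1/2) \<delta> b1"
proof (rule DERIV_neg_imp_decreasing[OF b(2)])
  fix \<beta> assume "b1 \<le> \<beta>" "\<beta> \<le> b2"
  then have \<beta>: "91/10 \<le> \<beta>" using b by simp
  have a: "diff_admissible (1/2) \<delta>" using \<delta> by (simp add: diff_admissible_def)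
  have v: "91/10 * (36/100) \<le> \<beta> * \<gamma>" using \<beta> \<gamma> by (intro mult_mono) auto
  have "0 < 1/5 * exp (- (\<beta> / 4)) * (\<beta> * \<delta>\<^sup>2)" using \<beta> \<delta> by simp
  also have "\<dots> \<le> gauss_diff (1/2) \<delta> \<beta>" using \<beta> \<delta> by (intro gauss_diff_half_lower) auto
  finally have r: "0 < gauss_diff (1/2) \<delta> \<beta>" .
  have "exp (- (\<beta> * \<gamma>)) / sqrt \<beta> * (- (\<beta> * \<gamma> - 5/2) * gauss_diff (1/2) \<delta> \<beta>) < 0"
    using r v \<beta> by (intro mult_pos_neg mult_neg_pos) auto
  moreover have "0 < \<beta>" using \<beta> by simp
  ultimately show "\<exists>y. (row_excess \<gamma> (1/2) \<delta> has_real_derivative y) (at \<beta>) \<and> y < 0"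
    using le_less_trans[OF row_excess_deriv_le[OF \<beta> a, of \<gamma>]] row_excess_deriv[of \<beta> \<gamma> "1/2" \<delta>] by blast
qed

lemma x_move_spatial:
  assumes y: "6/10 \<le> y" and st: "s < t" "29/10 * y \<le> exp s" and \<delta>: "0 < \<delta>" "\<delta> \<le> 1/2"
  shows "ntheta t (1/2 - \<delta>) y - ntheta t (1/2) y < ntheta s (1/2 - \<delta>) y - ntheta s (1/2) y"
proof -
  define b1 where "b1 = pi * exp s / y"
  define b2 where "b2 = pi * exp t / y"
  have y0: "0 < y" using y by simp
  have "314/100 * (29/10 * y) \<le> pi * exp s" using pi_gt_314 st y by (intro mult_mono) auto
  then have "91/10 * y \<le> pi * exp s" using y by simp
  then have b1: "91/10 \<le> b1" using y0 by (simp add: b1_def pos_le_divide_eq)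
  have b12: "b1 < b2" using st y0 by (simp add: b1_def b2_def divide_strict_right_mono)
  have \<gamma>: "36/100 \<le> y\<^sup>2" using power_mono[OF y, of 2] by (simp add: power2_eq_square)
  have "(row_sum (y\<^sup>2) b2 (1/2 - \<delta>) - row_sum (y\<^sup>2) b2 (1/2)) - (row_sum (y\<^sup>2) b1 (1/2 - \<delta>) - row_sum (y\<^sup>2) b1 (1/2)) < 0"
    using row_sum_x_move[OF b1 less_imp_le[OF b12] y less_imp_le[OF \<delta>(1)] \<delta>(2)] row_excess_strict[OF b1 b12 \<gamma> \<delta>] by linarith
  then have "sqrt (y / pi) * ((row_sum (y\<^sup>2) b2 (1/2 - \<delta>) - row_sum (y\<^sup>2) b2 (1/2)) - (row_sum (y\<^sup>2) b1 (1/2 - \<delta>) - row_sum (y\<^sup>2) b1 (1/2))) < 0"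
    using y0 by (intro mult_pos_neg) auto
  then show ?thesis unfolding ntheta_row_sum[OF y0] b1_def[symmetric] b2_def[symmetric] by (simp add: algebra_simps)
qed

section \<open>The vertical move for large parameters\<close>

text \<open>For a point z at height y / c the parameter k is c |m z + n|^2. With this scaling the
  lattices at heights y and y/2 share the variable e^t / y.\<close>

definition lattice_term :: "real \<Rightarrow> real \<Rightarrow> real \<Rightarrow> real" where
  "lattice_term y k t = exp (t / 2) * exp (- (pi * exp t / y * k))"

lemma lattice_term_deriv: "0 < y \<Longrightarrow> (lattice_term y k has_real_derivative ((1/2 - pi * exp t / y * k) * lattice_term y k t)) (at t)"
  unfolding lattice_term_def[abs_def] by (auto intro!: derivative_eq_intros simp: algebra_simps)

lemma lattice_term_antimono:
  assumes y: "0 < y" "y \<le> exp s" and st: "s \<le> t" and k: "1/2 \<le> k"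
  shows "lattice_term y k t \<le> lattice_term y k s"
proof (rule DERIV_nonpos_imp_nonincreasing[OF st])
  fix u assume u: "s \<le> u" "u \<le> t"
  have "y \<le> exp u" using y u by (meson exp_le_cancel_iff order_trans)
  then have "1 * 1 \<le> pi * (exp u / y)" using y pi_gt_314 by (intro mult_mono) auto
  then have "1 * (1/2) \<le> pi * (exp u / y) * k" using k by (intro mult_mono) auto
  then have "(1/2 - pi * exp u / y * k) * lattice_term y k u \<le> 0" by (intro mult_nonpos_nonneg) (auto simp: lattice_term_def)
  then show "\<exists>D. (lattice_term y k has_real_derivative D) (at u) \<and> D \<le> 0" using lattice_term_deriv[OF y(1)] by blast
qed

lemma lattice_term_strict:
  assumes y: "0 < y" "y \<le> exp s" and st: "s < t"
  shows "lattice_term y 1 t < lattice_term y 1 s"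
proof (rule DERIV_neg_imp_decreasing[OF st])
  fix u assume u: "s \<le> u" "u \<le> t"
  have "y \<le> exp u" using y u by (meson exp_le_cancel_iff order_trans)
  then have "1 * 1 \<le> pi * (exp u / y)" using y pi_gt_314 by (intro mult_mono) auto
  then have "1/2 - pi * exp u / y * 1 < 0" by (simp only: times_divide_eq_right mult_1_right)
  then have "(1/2 - pi * exp u / y * 1) * lattice_term y 1 u < 0" by (intro mult_neg_pos) (auto simp: lattice_term_def)
  then show "\<exists>D. (lattice_term y 1 has_real_derivative D) (at u) \<and> D < 0" using lattice_term_deriv[OF y(1)] by blast
qed

text \<open>With b = pi e^t / y \<ge> 3.14 the ratio of derivatives is (b k - 1/2) / (b - 1/2) *
  exp(-(k - 1) b); the fraction is at most 6/5 k once b \<ge> 3.\<close>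

lemma lattice_term_compare:
  assumes y: "0 < y" "y \<le> exp s" and st: "s \<le> t" and k: "1 \<le> k"
  shows "lattice_term y k s - lattice_term y k t \<le> 6/5 * k * exp (- (314/100 * (k - 1))) * (lattice_term y 1 s - lattice_term y 1 t)"
proof -
  define e where "e = 6/5 * k * exp (- (314/100 * (k - 1)))"
  define f where "f = (\<lambda>t. e * lattice_term y 1 t - lattice_term y k t)"
  have "f t \<le> f s"
  proof (rule DERIV_nonpos_imp_nonincreasing[OF st])
    fix u assume u: "s \<le> u" "u \<le> t"
    define b where "b = pi * exp u / y"
    have "y \<le> exp u" using y u by (meson exp_le_cancel_iff order_trans)
    then have "314/100 * 1 \<le> pi * (exp u / y)" using y pi_gt_314 by (intro mult_mono) auto
    then have b: "314/100 \<le> b" by (simp add: b_def)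
    have gk: "lattice_term y k u = exp (- ((k - 1) * b)) * lattice_term y 1 u"
      by (simp add: lattice_term_def b_def[symmetric] exp_add[symmetric] algebra_simps)
    have g1: "0 < lattice_term y 1 u" by (simp add: lattice_term_def)
    have "(b * k - 1/2) * lattice_term y k u \<le> e * (b - 1/2) * lattice_term y 1 u"
    proof -
      have "314/100 * (k - 1) \<le> (k - 1) * b" using mult_left_mono[OF b, of "k - 1"] k by (simp add: mult.commute)
      then have 1: "exp (- ((k - 1) * b)) \<le> exp (- (314/100 * (k - 1)))" by simp
      have "b * k - 1/2 \<le> 6/5 * k * (b - 1/2)"
      proof -
        have "k * 3 \<le> k * b" using b k by (intro mult_left_mono) auto
        then show ?thesis by (simp add: algebra_simps)
      qed
      then have "(b * k - 1/2) * exp (- ((k - 1) * b)) \<le> (6/5 * k * (b - 1/2)) * exp (- (314/100 * (k - 1)))"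
        using 1 b k by (intro mult_mono) auto
      then have "(b * k - 1/2) * exp (- ((k - 1) * b)) * lattice_term y 1 u \<le> (6/5 * k * (b - 1/2)) * exp (- (314/100 * (k - 1))) * lattice_term y 1 u"
        using g1 by (intro mult_right_mono) auto
      then show ?thesis unfolding gk e_def by (simp only: mult_ac)
    qed
    then have "e * ((1/2 - b * 1) * lattice_term y 1 u) - (1/2 - b * k) * lattice_term y k u \<le> 0" by (simp add: algebra_simps)
    moreover have "(f has_real_derivative (e * ((1/2 - b * 1) * lattice_term y 1 u) - (1/2 - b * k) * lattice_term y k u)) (at u)"
      unfolding f_def b_def by (intro DERIV_diff DERIV_cmult lattice_term_deriv y)
    ultimately show "\<exists>D. (f has_real_derivative D) (at u) \<and> D \<le> 0" by blast
  qed
  then show ?thesis by (simp add: f_def e_def algebra_simps)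
qed

lemma ntheta_lattice_terms:
  assumes y: "0 < y" and c: "0 < c"
  shows "((\<lambda>(m, n). lattice_term y (c * (y\<^sup>2 / c\<^sup>2 * (of_int m)\<^sup>2 + (of_int n + of_int m * x)\<^sup>2)) t) has_sum ntheta t x (y / c)) (UNIV :: (int \<times> int) set)"
proof -
  have "((\<lambda>i. exp (t / 2) * (case i of (m, n) \<Rightarrow> exp (- pi * exp t * (cmod (of_int m * Complex x (y / c) + of_int n))\<^sup>2 / Im (Complex x (y / c)))))
     has_sum ntheta t x (y / c)) (UNIV :: (int \<times> int) set)"
    unfolding ntheta_def using y c by (intro has_sum_cmult_right theta_has_sum) auto
  moreover have "exp (t / 2) * exp (- pi * exp t * (cmod (of_int m * Complex x (y / c) + of_int n))\<^sup>2 / Im (Complex x (y / c)))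
     = lattice_term y (c * (y\<^sup>2 / c\<^sup>2 * (of_int m)\<^sup>2 + (of_int n + of_int m * x)\<^sup>2)) t" for m n :: int
  proof -
    have yc: "0 < y / c" using y c by simp
    have "- (pi * exp t * (y / c)) * (of_int m)\<^sup>2 + - (pi * exp t / (y / c)) * (of_int n + of_int m * x)\<^sup>2
       = - (pi * exp t / y * (c * (y\<^sup>2 / c\<^sup>2 * (of_int m)\<^sup>2 + (of_int n + of_int m * x)\<^sup>2)))"
      using y c by (simp add: field_simps power2_eq_square)
    then show ?thesis
      unfolding theta_term[OF yc] lattice_term_def exp_add[symmetric] by (simp only:)
  qed
  ultimately show ?thesis by (simp add: case_prod_unfold)
qed

text \<open>This is the form of the lattice at height y/2, with p = y^2 / 2 \<ge> 9/8. The constant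
  79/100 is just below the least eigenvalue at p = 9/8, as the completed square shows, and 9/2 is
  attained there at (2,-1), outside the seven excluded vectors.\<close>

lemma form_ge:
  fixes m n :: int and p :: real
  assumes p: "9/8 \<le> p"
  defines "k \<equiv> p * (of_int m)\<^sup>2 + 2 * (of_int n + of_int m * (1/2))\<^sup>2"
  shows "79/100 * of_int (\<bar>m\<bar> + \<bar>n\<bar>) \<le> k"
    and "(m, n) \<notin> {(0,0), (0,1), (0,-1), (1,0), (-1,0), (1,-1), (-1,1)} \<Longrightarrow> 9/2 \<le> k"
proof -
  have int_sq: "of_int \<bar>i\<bar> \<le> (of_int i :: real)\<^sup>2" for i :: int
  proof -
    have "\<bar>i\<bar> * 1 \<le> \<bar>i\<bar> * \<bar>i\<bar>" by (cases "i = 0") (simp, intro mult_left_mono, auto)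
    then have "\<bar>i\<bar> \<le> i\<^sup>2" by (simp add: power2_eq_square)
    then show ?thesis by (metis of_int_le_iff of_int_power)
  qed
  have k0: "9/8 * (of_int m)\<^sup>2 + 2 * (of_int n + of_int m * (1/2))\<^sup>2 \<le> k"
    unfolding k_def using p by (intro add_mono mult_right_mono) auto
  define M N :: real where "M = of_int m" and "N = of_int n"
  have "9/8 * M\<^sup>2 + 2 * (N + M * (1/2))\<^sup>2 - 79/100 * (M\<^sup>2 + N\<^sup>2) = 121/100 * (N + 100/121 * M)\<^sup>2 + (835/1000 - 100/121) * M\<^sup>2"
    by (simp add: power2_eq_square field_simps)
  moreover have "0 \<le> 121/100 * (N + 100/121 * M)\<^sup>2 + (835/1000 - 100/121) * M\<^sup>2" by simp
  ultimately have "79/100 * (M\<^sup>2 + N\<^sup>2) \<le> k" using k0 unfolding M_def N_def by linarith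
  moreover have "79/100 * of_int (\<bar>m\<bar> + \<bar>n\<bar>) \<le> 79/100 * (M\<^sup>2 + N\<^sup>2)"
    using int_sq[of m] int_sq[of n] unfolding M_def N_def of_int_add by simp
  ultimately show "79/100 * of_int (\<bar>m\<bar> + \<bar>n\<bar>) \<le> k" by linarith
  assume ex: "(m, n) \<notin> {(0,0), (0,1), (0,-1), (1,0), (-1,0), (1,-1), (-1,1)}"
  consider "2 \<le> \<bar>m\<bar>" | "m = 0" "2 \<le> \<bar>n\<bar>" | "m = 1 \<or> m = -1" "3 \<le> \<bar>2 * n + m\<bar>"
    using ex by (cases "m = 0"; cases "m = 1"; cases "m = - 1"; auto)
  then show "9/2 \<le> k"
  proof cases
    case 1
    then have "(2::real) \<le> \<bar>of_int m\<bar>" by (metis of_int_abs of_int_le_iff of_int_numeral)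
    then have "2\<^sup>2 \<le> \<bar>of_int m :: real\<bar>\<^sup>2" by (intro power_mono) auto
    then have "9/2 \<le> 9/8 * (of_int m :: real)\<^sup>2" by simp
    then show ?thesis using k0 zero_le_power2[of "of_int n + of_int m * (1/2) :: real"] by linarith
  next
    case 2
    then have "(2::real) \<le> \<bar>of_int n\<bar>" by (metis of_int_abs of_int_le_iff of_int_numeral)
    then have "2\<^sup>2 \<le> \<bar>of_int n :: real\<bar>\<^sup>2" by (intro power_mono) auto
    then show ?thesis using k0 2 by simp
  next
    case 3
    then have "(3::real) \<le> \<bar>of_int (2 * n + m)\<bar>" by (metis of_int_abs of_int_le_iff of_int_numeral)
    then have "3\<^sup>2 \<le> \<bar>of_int (2 * n + m) :: real\<bar>\<^sup>2" by (intro power_mono) auto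
    then have "9 \<le> (2 * (of_int n + of_int m * (1/2)) :: real)\<^sup>2" by (simp add: algebra_simps)
    then have "9 \<le> 4 * (of_int n + of_int m * (1/2) :: real)\<^sup>2" by (simp only: power_mult_distrib) simp
    moreover have "(of_int m :: real)\<^sup>2 = 1" using 3 by auto
    ultimately show ?thesis using k0 by simp
  qed
qed

text \<open>The exponent 3.14 k is split as 1.07 k + 2.07 k. The first part absorbs the factor 6/5
  k; in the second, 2.07 * 0.79 > 1.635 > ln 5 produces the geometric factor.\<close>

lemma far_vector_weight:
  fixes k :: real and a :: nat
  assumes k: "9/2 \<le> k" "79/100 * real a \<le> k"
  shows "6/5 * k * exp (- (314/100 * (k - 1))) \<le> 3/2 * (1/5) ^ a"
proof -
  define z where "z = 107/100 * k - 314/100"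
  have z: "1675/1000 \<le> z" using k by (simp add: z_def)
  have "1 + z + z\<^sup>2 / 2 \<le> exp z" using z by (intro exp_lower_Taylor_quadratic) auto
  moreover have "1675/1000 * (1675/1000) \<le> z\<^sup>2" unfolding power2_eq_square using z by (intro mult_mono) auto
  moreover have "6/5 * k \<le> 3/2 * (1 + z + 1675/1000 * (1675/1000) / 2)" using k by (simp add: z_def)
  ultimately have "6/5 * k \<le> 3/2 * exp z" by argo
  then have "6/5 * k * exp (- (314/100 * (k - 1))) \<le> 3/2 * exp z * exp (- (314/100 * (k - 1)))"
    by (rule mult_right_mono) simp
  also have "\<dots> = 3/2 * exp (- (207/100 * k))" unfolding mult.assoc exp_add[symmetric] by (simp add: z_def field_simps)
  also have "\<dots> \<le> 3/2 * (1/5) ^ a"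
  proof (rule mult_left_mono)
    have "exp (- (207/100 * k)) \<le> exp (real a * (- (1635/1000)))" using k(2) by simp
    also have "\<dots> = exp (- (1635/1000)) ^ a" by (rule exp_of_nat_mult)
    also have "\<dots> \<le> (1/5) ^ a"
    proof (rule power_mono)
      have "exp (- (1635/1000 :: real)) \<le> 1 / (1 + 109/1000 + (109/1000)\<^sup>2 / 2) ^ 15" by (rule exp_minus_le_step) auto
      also have "\<dots> \<le> (1/5 :: real)" by (simp add: power_divide power2_eq_square)
      finally show "exp (- (1635/1000)) \<le> (1/5 :: real)" .
    qed simp
    finally show "exp (- (207/100 * k)) \<le> (1/5) ^ a" .
  qed simp
  finally show ?thesis .
qed

text \<open>13/8 = 9/8 + 1/2 is the least value of the form at (1,0), (1,-1) and their negatives.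
  The tangent bound k \<le> 13/8 exp(k - 13/8) reduces the estimate to that value.\<close>

lemma near_vector_weight:
  fixes k :: real
  assumes "13/8 \<le> k"
  shows "6/5 * k * exp (- (314/100 * (k - 1))) \<le> 28/100"
proof -
  have "k \<le> 13/8 * exp (k - 13/8)"
  proof -
    have "k \<le> 13/8 * (1 + (k - 13/8))" using assms by simp
    also have "\<dots> \<le> 13/8 * exp (k - 13/8)" using exp_ge_add_one_self[of "k - 13/8"] by simp
    finally show ?thesis .
  qed
  then have "6/5 * k * exp (- (314/100 * (k - 1))) \<le> 6/5 * (13/8 * exp (k - 13/8)) * exp (- (314/100 * (k - 1)))"
    by (intro mult_right_mono) auto
  also have "\<dots> = 39/20 * exp (- (214/100 * (k - 13/8) + 314/100 * (5/8)))"
    by (simp add: exp_add[symmetric] field_simps)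
  also have "\<dots> \<le> 39/20 * (1 / (1 + 98/1000 + (98/1000)\<^sup>2 / 2) ^ 20)"
  proof (rule mult_left_mono[OF exp_minus_le_step])
    show "real 20 * (98/1000) \<le> 214/100 * (k - 13/8) + 314/100 * (5/8)"
      unfolding of_nat_numeral using assms by argo
  qed auto
  also have "\<dots> \<le> 28/100" by (simp add: power_divide power2_eq_square)
  finally show ?thesis .
qed

lemma int_pair_geometric:
  assumes "0 \<le> r" "r < (1::real)"
  shows "((\<lambda>(m::int, n::int). r ^ nat (\<bar>m\<bar> + \<bar>n\<bar>)) has_sum ((1 + r) / (1 - r) * ((1 + r) / (1 - r)))) UNIV"
proof -
  let ?c = "(1 + r) / (1 - r)"
  have eq: "r ^ nat (\<bar>m\<bar> + \<bar>n\<bar>) = r ^ nat \<bar>m\<bar> * r ^ nat \<bar>n\<bar>" for m n :: int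
    by (simp add: nat_add_distrib power_add)
  have 1: "((\<lambda>n::int. case (m, n) of (m, n) \<Rightarrow> r ^ nat (\<bar>m\<bar> + \<bar>n\<bar>)) has_sum (r ^ nat \<bar>m\<bar> * ?c)) UNIV" for m :: int
    unfolding prod.case eq by (intro has_sum_cmult_right int_geometric_has_sum assms)
  have 2: "((\<lambda>m::int. r ^ nat \<bar>m\<bar> * ?c) has_sum (?c * ?c)) UNIV"
    by (intro has_sum_cmult_left int_geometric_has_sum assms)
  have 3: "(\<lambda>(m::int, n::int). r ^ nat (\<bar>m\<bar> + \<bar>n\<bar>)) summable_on Sigma UNIV (\<lambda>_. UNIV)"
    by (rule summable_on_SigmaI[OF 1 has_sum_imp_summable[OF 2]]) (use assms in auto)
  show ?thesis using has_sum_SigmaI[OF 1 2 3] by simp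
qed

text \<open>At height y the shortest vectors (0,1) and (0,-1) have k = 1 and supply -2 in units of
  the reference decrease \<open>c\<close>; the other terms there decrease too and are dropped. The
  terms at height y/2 have the opposite sign and cost 11/100 twice, 28/100 four times and a
  geometric tail, together less than 2.\<close>

lemma y_halving_spatial:
  assumes y: "15/10 \<le> y" and st: "s < t" "y \<le> exp s"
  shows "ntheta t (1/2) y - ntheta t (1/2) (y / 2) < ntheta s (1/2) y - ntheta s (1/2) (y / 2)"
proof -
  define k1 where "k1 = (\<lambda>(m::int) (n::int). 1 * (y\<^sup>2 / 1\<^sup>2 * (of_int m)\<^sup>2 + (of_int n + of_int m * (1/2))\<^sup>2))"
  define k2 where "k2 = (\<lambda>(m::int) (n::int). 2 * (y\<^sup>2 / 2\<^sup>2 * (of_int m)\<^sup>2 + (of_int n + of_int m * (1/2))\<^sup>2))"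
  have y0: "0 < y" using y by simp
  have st': "s \<le> t" using st by simp
  have y2: "9/4 \<le> y\<^sup>2" using power_mono[OF y, of 2] by (simp add: power2_eq_square)
  define c where "c = lattice_term y 1 s - lattice_term y 1 t"
  have c: "0 < c" unfolding c_def using lattice_term_strict[OF y0 st(2,1)] by simp
  have D: "((\<lambda>(m, n). lattice_term y (k1 m n) u - lattice_term y (k2 m n) u) has_sum (ntheta u (1/2) y - ntheta u (1/2) (y / 2))) UNIV" for u
    using has_sum_real_diff[OF ntheta_lattice_terms[OF y0, of 1 "1/2" u] ntheta_lattice_terms[OF y0, of 2 "1/2" u]]
    unfolding k1_def k2_def by (simp add: case_prod_unfold)
  \<comment> \<open>Each entry is the actual weight minus the geometric weight at that vector, which
    is 3/2, 3/10 or 3/50.\<close>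
  define e where "e = (\<lambda>(m::int, n::int). if (m, n) = (0, 0) then - 3/2 else
     if (m, n) = (0, 1) \<or> (m, n) = (0, -1) then - 1 + 11/100 - 3/10 else
     if (m, n) = (1, 0) \<or> (m, n) = (-1, 0) then 28/100 - 3/10 else
     if (m, n) = (1, -1) \<or> (m, n) = (-1, 1) then 28/100 - 3/50 else (0::real))"
  define w where "w = (\<lambda>(m::int, n::int). 3/2 * (1/5) ^ nat (\<bar>m\<bar> + \<bar>n\<bar>) + e (m, n))"
  define W :: real where "W = 3/2 * ((1 + 1/5) / (1 - 1/5) * ((1 + 1/5) / (1 - 1/5))) +
     (- 3/2 + 2 * (- 1 + 11/100 - 3/10) + 2 * (28/100 - 3/10) + 2 * (28/100 - 3/50))"
  have w: "(w has_sum W) UNIV"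
  proof -
    have "(e has_sum (- 3/2 + 2 * (- 1 + 11/100 - 3/10) + 2 * (28/100 - 3/10) + 2 * (28/100 - 3/50))) UNIV"
      by (rule has_sum_finite_neutralI[of "{(0,0), (0,1), (0,-1), (1,0), (-1,0), (1,-1), (-1,1)}"])
         (auto simp: e_def split: if_splits)
    from has_sum_add[OF has_sum_cmult_right[OF int_pair_geometric[of "1/5"], of "3/2"] this]
    show ?thesis unfolding w_def W_def by (simp add: case_prod_unfold)
  qed
  have k1_ge: "1 \<le> k1 m n" if "(m, n) \<noteq> (0, 0)" for m n
  proof (cases "m = 0")
    case True
    then have "(1::int) \<le> n\<^sup>2" using that by (simp add: int_one_le_iff_zero_less)
    then have "(1::real) \<le> (of_int n)\<^sup>2" by (metis of_int_1 of_int_le_iff of_int_power)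
    then show ?thesis using True by (simp add: k1_def)
  next
    case False
    then have "(1::int) \<le> m\<^sup>2" by (simp add: int_one_le_iff_zero_less)
    then have "(1::real) \<le> (of_int m)\<^sup>2" by (metis of_int_1 of_int_le_iff of_int_power)
    then have "9/4 * 1 \<le> y\<^sup>2 * (of_int m)\<^sup>2" using y2 by (intro mult_mono) auto
    moreover have "0 \<le> (of_int n + of_int m * (1/2) :: real)\<^sup>2" by simp
    moreover have "k1 m n = y\<^sup>2 * (of_int m)\<^sup>2 + (of_int n + of_int m * (1/2))\<^sup>2" by (simp add: k1_def)
    ultimately show ?thesis by linarith
  qed
  have k2_form: "k2 m n = y\<^sup>2 / 2 * (of_int m)\<^sup>2 + 2 * (of_int n + of_int m * (1/2))\<^sup>2" for m n
    by (simp add: k2_def power2_eq_square algebra_simps)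
  have p: "9/8 \<le> y\<^sup>2 / 2" using y2 by simp
  have term_le: "(lattice_term y (k1 m n) t - lattice_term y (k2 m n) t) - (lattice_term y (k1 m n) s - lattice_term y (k2 m n) s) \<le> w (m, n) * c" for m n
  proof -
    have k1le: "lattice_term y (k1 m n) t - lattice_term y (k1 m n) s \<le> 0" if "(m, n) \<noteq> (0, 0)"
      using lattice_term_antimono[OF y0 st(2) st', of "k1 m n"] k1_ge[OF that] by simp
    have k2le: "lattice_term y (k2 m n) s - lattice_term y (k2 m n) t \<le> v * c"
      if "1 \<le> k2 m n" "6/5 * k2 m n * exp (- (314/100 * (k2 m n - 1))) \<le> v" for v
    proof -
      have "lattice_term y (k2 m n) s - lattice_term y (k2 m n) t \<le> 6/5 * k2 m n * exp (- (314/100 * (k2 m n - 1))) * c"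
        unfolding c_def by (rule lattice_term_compare[OF y0 st(2) st' that(1)])
      also have "\<dots> \<le> v * c" using that(2) c by (intro mult_right_mono) auto
      finally show ?thesis .
    qed
    consider (z) "(m, n) = (0, 0)" | (a) "m = 0" "n = 1 \<or> n = -1"
      | (b) "(m, n) = (1, 0) \<or> (m, n) = (-1, 0)" | (d) "(m, n) = (1, -1) \<or> (m, n) = (-1, 1)"
      | (r) "(m, n) \<notin> {(0,0), (0,1), (0,-1), (1,0), (-1,0), (1,-1), (-1,1)}" by auto
    then show ?thesis
    proof cases
      case z
      then show ?thesis by (simp add: k1_def k2_def w_def e_def)
    next
      case a
      then have k: "k1 m n = 1" "k2 m n = 2" by (auto simp: k1_def k2_def)
      have "exp (- (314/100 * (2 - 1) :: real)) \<le> 1 / (1 + 157/1000 + (157/1000)\<^sup>2 / 2) ^ (20::nat)"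
        by (rule exp_minus_le_step) auto
      also have "\<dots> \<le> (11/240 :: real)" by (simp add: power_divide power2_eq_square)
      finally have "6/5 * k2 m n * exp (- (314/100 * (k2 m n - 1))) \<le> 11/100" unfolding k by simp
      then have le: "lattice_term y (k2 m n) s - lattice_term y (k2 m n) t \<le> 11/100 * c" using k by (intro k2le) auto
      have wv: "w (m, n) = - 1 + 11/100" using a by (auto simp: w_def e_def)
      have eq: "(- 1 + 11/100) * c = - (lattice_term y 1 s - lattice_term y 1 t) + 11/100 * c" by (simp add: c_def field_simps)
      show ?thesis unfolding k(1) wv eq using le by linarith
    next
      case b
      have "13/8 \<le> k2 m n" unfolding k2_form using b p by (auto simp: power2_eq_square)
      then have le: "lattice_term y (k2 m n) s - lattice_term y (k2 m n) t \<le> 28/100 * c" by (intro k2le near_vector_weight) auto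
      have wv: "w (m, n) = 28/100" using b unfolding w_def e_def by (elim disjE) simp_all
      have nz: "(m, n) \<noteq> (0, 0)" using b by auto
      show ?thesis unfolding wv using le k1le[OF nz] by linarith
    next
      case d
      have "13/8 \<le> k2 m n" unfolding k2_form using d p by (auto simp: power2_eq_square)
      then have le: "lattice_term y (k2 m n) s - lattice_term y (k2 m n) t \<le> 28/100 * c" by (intro k2le near_vector_weight) auto
      have wv: "w (m, n) = 28/100" using d unfolding w_def e_def by (elim disjE) (simp_all add: power2_eq_square)
      have nz: "(m, n) \<noteq> (0, 0)" using d by auto
      show ?thesis unfolding wv using le k1le[OF nz] by linarith
    next
      case r
      have k: "9/2 \<le> k2 m n" "79/100 * real (nat (\<bar>m\<bar> + \<bar>n\<bar>)) \<le> k2 m n"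
        using form_ge[OF p, of m n] r unfolding k2_form by auto
      have le: "lattice_term y (k2 m n) s - lattice_term y (k2 m n) t \<le> 3/2 * (1/5) ^ nat (\<bar>m\<bar> + \<bar>n\<bar>) * c"
        using k(1) by (intro k2le far_vector_weight k) auto
      have wv: "w (m, n) = 3/2 * (1/5) ^ nat (\<bar>m\<bar> + \<bar>n\<bar>)" using r by (auto simp: w_def e_def)
      have nz: "(m, n) \<noteq> (0, 0)" using r by auto
      show ?thesis unfolding wv using le k1le[OF nz] by linarith
    qed
  qed
  have "(ntheta t (1/2) y - ntheta t (1/2) (y / 2)) - (ntheta s (1/2) y - ntheta s (1/2) (y / 2)) \<le> W * c"
    by (rule has_sum_le_diff[OF D D w]) (use term_le in auto)
  also have "\<dots> < 0" using c by (intro mult_neg_pos) (auto simp: W_def)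
  finally show ?thesis by simp
qed

section \<open>The maximum of the gap\<close>

lemma ntheta_plus_int:
  assumes "0 < y"
  shows "ntheta t (x + of_int k) y = ntheta t x y"
proof -
  have "cos (2 * pi * real m * real n * (x + of_int k)) = cos (2 * pi * real m * real n * x)" for m n
    using cos_of_int_shift[of "m * n" k x] by (simp add: mult_ac add.commute)
  then show ?thesis unfolding ntheta_fourier[OF assms] by simp
qed

lemma ntheta_minus:
  assumes "0 < y"
  shows "ntheta t (- x) y = ntheta t x y"
  unfolding ntheta_fourier[OF assms] by simp

text \<open>Negating t exchanges the two axis sums and transposes the off-diagonal modes, whose
  coefficients cos(2 pi m n x) are symmetric in m and n.\<close>

lemma ntheta_dual:
  assumes "0 < y"
  shows "ntheta (- t) x y = ntheta t x y"
proof -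
  define d where "d = (\<lambda>(m::nat) (n::nat). cos (2 * pi * real m * real n * x))"
  have H: "fmode y (- t) n m = fmode y t m n" for m n by (simp add: fmode_def add.commute)
  have "((\<lambda>(m, n). fmode y (- t) m n * d m n) has_sum offdiag_sum y (- t) d) ({1..} \<times> {1..})"
    by (rule offdiag_sum_has_sum[OF assms, where B = 1]) (simp add: d_def)
  from has_sum_swap[THEN iffD1, OF this]
  have "((\<lambda>(m, n). fmode y t m n * d m n) has_sum offdiag_sum y (- t) d) ({1..} \<times> {1..})"
    by (simp add: H d_def mult_ac case_prod_unfold)
  moreover have "((\<lambda>(m, n). fmode y t m n * d m n) has_sum offdiag_sum y t d) ({1..} \<times> {1..})"
    by (rule offdiag_sum_has_sum[OF assms, where B = 1]) (simp add: d_def)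
  ultimately have "offdiag_sum y (- t) d = offdiag_sum y t d" by (rule has_sum_unique)
  then show ?thesis unfolding ntheta_fourier[OF assms] d_def by simp
qed

lemma ntheta_reduce:
  obtains \<delta> where "0 \<le> \<delta>" "\<delta> \<le> 1/2" "\<And>t y. 0 < y \<Longrightarrow> ntheta t x y = ntheta t (1/2 - \<delta>) y"
    "\<delta> = 0 \<Longrightarrow> x = of_int (round (x - 1/2)) + 1/2"
proof
  define r where "r = x - 1/2 - of_int (round (x - 1/2))"
  show "0 \<le> \<bar>r\<bar>" by simp
  show "\<bar>r\<bar> \<le> 1/2" using of_int_round_abs_le[of "x - 1/2"] by (simp add: r_def abs_minus_commute)
  show "\<bar>r\<bar> = 0 \<Longrightarrow> x = of_int (round (x - 1/2)) + 1/2" by (simp add: r_def)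
  fix t y :: real assume y: "0 < y"
  have 1: "ntheta t x y = ntheta t (1/2 + r) y"
    using ntheta_plus_int[OF y, of t "1/2 + r" "round (x - 1/2)"] by (simp add: r_def)
  have 2: "ntheta t (1/2 + r) y = ntheta t (1/2 - r) y"
    using ntheta_plus_int[OF y, of t "- (1/2 + r)" 1] ntheta_minus[OF y, of t "1/2 + r"] by (simp add: algebra_simps)
  show "ntheta t x y = ntheta t (1/2 - \<bar>r\<bar>) y" using 1 2 by (cases "0 \<le> r") auto
qed

text \<open>The claim is additive over adjacent parameter intervals, so an interval containing the
  point with e^u = 29/10 y is cut there and each half uses its own expansion.\<close>

lemma x_move:
  assumes y: "6/10 \<le> y" and st: "0 \<le> s" "s < t" and \<delta>: "0 < \<delta>" "\<delta> \<le> 1/2"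
  shows "ntheta t (1/2 - \<delta>) y - ntheta t (1/2) y < ntheta s (1/2 - \<delta>) y - ntheta s (1/2) y"
proof -
  have F: "ntheta t (1/2 - \<delta>) y - ntheta t (1/2) y < ntheta s (1/2 - \<delta>) y - ntheta s (1/2) y"
    if "0 \<le> s" "s < t" "exp t \<le> 29/10 * y" for s t
  proof -
    have "cos (2 * pi * \<delta>) < cos 0" using \<delta> by (intro cos_monotone_0_pi) auto
    moreover have "cos (2 * pi * (1/2 - \<delta>)) = - cos (2 * pi * \<delta>)"
      by (simp add: right_diff_distrib cos_diff)
    ultimately have 1: "0 < 1 + cos (2 * pi * (1/2 - \<delta>))" by simp
    have 2: "fmode y t 1 1 < fmode y s 1 1" using fmode_11_strict[of y s t] y that by simp
    have "0 < sqrt y * 4 * ((1 + cos (2 * pi * (1/2 - \<delta>))) * (fmode y s 1 1 - fmode y t 1 1)) / 100"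
      using 1 2 y by (intro divide_pos_pos mult_pos_pos) auto
    with x_move_fourier[OF y that(1) less_imp_le[OF that(2)] that(3), of "1/2 - \<delta>"] show ?thesis by linarith
  qed
  define u where "u = ln (29/10 * y)"
  have eu: "exp u = 29/10 * y" using y by (simp add: u_def)
  have u0: "0 \<le> u" using y by (simp add: u_def)
  consider "t \<le> u" | "u \<le> s" | "s < u" "u < t" by linarith
  then show ?thesis
  proof cases
    case 1
    then have "exp t \<le> 29/10 * y" using eu by (metis exp_le_cancel_iff)
    then show ?thesis by (rule F[OF st])
  next
    case 2
    then have "29/10 * y \<le> exp s" using eu by (metis exp_le_cancel_iff)
    then show ?thesis by (rule x_move_spatial[OF y st(2) _ \<delta>])
  next
    case 3
    have "29/10 * y \<le> exp u" using eu by simp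
    from x_move_spatial[OF y 3(2) this \<delta>] F[OF st(1) 3(1)] eu show ?thesis by linarith
  qed
qed

lemma y_halving:
  assumes y: "15/10 \<le> y" and st: "0 \<le> s" "s < t"
  shows "ntheta t (1/2) y - ntheta t (1/2) (y / 2) < ntheta s (1/2) y - ntheta s (1/2) (y / 2)"
proof -
  define u where "u = ln y"
  have eu: "exp u = y" using y by (simp add: u_def)
  consider "t \<le> u" | "u \<le> s" | "s < u" "u < t" by linarith
  then show ?thesis
  proof cases
    case 1
    then have "exp t \<le> y" using eu by (metis exp_le_cancel_iff)
    then show ?thesis by (rule y_halving_fourier[OF y st])
  next
    case 2
    then have "y \<le> exp s" using eu by (metis exp_le_cancel_iff)
    then show ?thesis by (rule y_halving_spatial[OF y st(2)])
  next
    case 3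
    have "y \<le> exp u" using eu by simp
    from y_halving_spatial[OF y 3(2) this] y_halving_fourier[OF y st(1) 3(1)] eu show ?thesis by linarith
  qed
qed

section \<open>Modular invariance\<close>

lemma Im_moebius:
  fixes a b c d :: int
  assumes "a * d - b * c = 1" "0 < Im z"
  shows "Im ((of_int a * z + of_int b) / (of_int c * z + of_int d)) = Im z / (cmod (of_int c * z + of_int d))\<^sup>2"
proof -
  have "of_int (a * d - b * c) = (1 :: real)" using assms(1) by simp
  then have "of_int a * of_int d - of_int b * of_int c = (1 :: real)" by simp
  then have "(of_int a * Im z) * (of_int c * Re z + of_int d) - (of_int a * Re z + of_int b) * (of_int c * Im z) = Im z"
    by (simp add: algebra_simps)
  then show ?thesis by (simp add: Im_divide cmod_power2)
qed

lemma moebius_denominator_nonzero: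
  fixes a b c d :: int
  assumes "a * d - b * c = 1" "0 < Im z"
  shows "of_int c * z + of_int d \<noteq> 0"
proof
  assume "of_int c * z + of_int d = 0"
  then have "of_int c * Im z = 0" "of_int c * Re z + of_int d = 0" by (auto simp: complex_eq_iff)
  then have "c = 0" "d = 0" using assms(2) by auto
  then show False using assms(1) by simp
qed

lemma SL2_bij:
  fixes a b c d :: int
  assumes "a * d - b * c = 1"
  shows "bij_betw (\<lambda>(m, n). (m * a + n * c, m * b + n * d)) UNIV UNIV"
proof (rule bij_betwI[where g = "\<lambda>(p, q). (d * p - c * q, a * q - b * p)"])
  have 1: "d * (m * a + n * c) - c * (m * b + n * d) = m" for m n
  proof -
    have "d * (m * a + n * c) - c * (m * b + n * d) = m * (a * d - b * c)" by (simp add: algebra_simps)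
    then show ?thesis using assms by simp
  qed
  have 2: "a * (m * b + n * d) - b * (m * a + n * c) = n" for m n
  proof -
    have "a * (m * b + n * d) - b * (m * a + n * c) = n * (a * d - b * c)" by (simp add: algebra_simps)
    then show ?thesis using assms by simp
  qed
  have 3: "(d * p - c * q) * a + (a * q - b * p) * c = p" for p q
  proof -
    have "(d * p - c * q) * a + (a * q - b * p) * c = p * (a * d - b * c)" by (simp add: algebra_simps)
    then show ?thesis using assms by simp
  qed
  have 4: "(d * p - c * q) * b + (a * q - b * p) * d = q" for p q
  proof -
    have "(d * p - c * q) * b + (a * q - b * p) * d = q * (a * d - b * c)" by (simp add: algebra_simps)
    then show ?thesis using assms by simp
  qed
  show "(case (case x of (m, n) \<Rightarrow> (m * a + n * c, m * b + n * d)) of (p, q) \<Rightarrow> (d * p - c * q, a * q - b * p)) = x" for x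
    by (cases x) (simp add: 1 2)
  show "(case (case y of (p, q) \<Rightarrow> (d * p - c * q, a * q - b * p)) of (m, n) \<Rightarrow> (m * a + n * c, m * b + n * d)) = y" for y
    by (cases y) (simp add: 3 4)
qed auto

lemma moebius_row:
  fixes a b c d m n :: int
  assumes "a * d - b * c = 1" "0 < Im z"
  shows "of_int m * ((of_int a * z + of_int b) / (of_int c * z + of_int d)) + of_int n
     = (of_int (m * a + n * c) * z + of_int (m * b + n * d)) / (of_int c * z + of_int d)"
  using moebius_denominator_nonzero[OF assms] by (simp add: field_simps)

text \<open>The vector (m, n) of the image lattice is a vector of the old one divided by c z + d,
  and the imaginary part is divided by |c z + d|^2; so the exponents are only permuted, by the
  matrix acting on row vectors.\<close>

lemma theta_moebius:
  fixes a b c d :: int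
  assumes det: "a * d - b * c = 1" and z: "0 < Im z"
  shows "theta \<alpha> ((of_int a * z + of_int b) / (of_int c * z + of_int d)) = theta \<alpha> z"
proof -
  define w where "w = (of_int a * z + of_int b) / (of_int c * z + of_int d)"
  define D where "D = of_int c * z + of_int d"
  have D: "D \<noteq> 0" unfolding D_def by (rule moebius_denominator_nonzero[OF det z])
  let ?f = "\<lambda>(m::int, n::int). exp (- pi * \<alpha> * (cmod (of_int m * z + of_int n))\<^sup>2 / Im z)"
  have "exp (- pi * \<alpha> * (cmod (of_int m * w + of_int n))\<^sup>2 / Im w) = ?f (m * a + n * c, m * b + n * d)" for m n :: int
  proof -
    have "(cmod (of_int m * w + of_int n))\<^sup>2 / Im w = (cmod (of_int (m * a + n * c) * z + of_int (m * b + n * d)))\<^sup>2 / Im z"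
    proof -
      have "of_int m * w + of_int n = (of_int (m * a + n * c) * z + of_int (m * b + n * d)) / D"
        unfolding w_def D_def by (rule moebius_row[OF det z])
      moreover have "Im w = Im z / (cmod D)\<^sup>2"
        unfolding w_def D_def by (rule Im_moebius[OF det z])
      ultimately show ?thesis using D z by (simp only: norm_divide power_divide) simp
    qed
    then show ?thesis by (metis (no_types, lifting) prod.case times_divide_eq_right)
  qed
  then have "theta \<alpha> w = infsum (\<lambda>i. ?f (case i of (m, n) \<Rightarrow> (m * a + n * c, m * b + n * d))) UNIV"
    unfolding theta_def by (simp add: case_prod_unfold)
  also have "\<dots> = infsum ?f UNIV"
    by (rule infsum_reindex_bij_betw[OF SL2_bij[OF det]])
  finally show ?thesis by (simp add: theta_def w_def)
qed

definition theta_gap :: "real \<Rightarrow> real \<Rightarrow> complex \<Rightarrow> real" where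
  "theta_gap s t z = ntheta t (Re z) (Im z) - ntheta s (Re z) (Im z)"

lemma theta_gap_moebius:
  fixes a b c d :: int
  assumes "a * d - b * c = 1" "0 < Im z"
  shows "theta_gap s t ((of_int a * z + of_int b) / (of_int c * z + of_int d)) = theta_gap s t z"
  unfolding theta_gap_def ntheta_def complex_surj theta_moebius[OF assms] ..

lemma theta_gap_x_move:
  assumes st: "0 \<le> s" "s < t" and y: "6/10 \<le> Im z"
  shows "theta_gap s t z \<le> theta_gap s t (Complex (1/2) (Im z))"
    and "Re z \<noteq> of_int (round (Re z - 1/2)) + 1/2 \<Longrightarrow> theta_gap s t z < theta_gap s t (Complex (1/2) (Im z))"
proof -
  obtain \<delta> where \<delta>: "0 \<le> \<delta>" "\<delta> \<le> 1/2" "\<And>t y. 0 < y \<Longrightarrow> ntheta t (Re z) y = ntheta t (1/2 - \<delta>) y"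
    "\<delta> = 0 \<Longrightarrow> Re z = of_int (round (Re z - 1/2)) + 1/2"
    using ntheta_reduce[of "Re z"] by metis
  have y0: "0 < Im z" using y by simp
  have 1: "theta_gap s t z < theta_gap s t (Complex (1/2) (Im z))" if "0 < \<delta>"
    using x_move[OF y st that \<delta>(2)] by (simp add: theta_gap_def \<delta>(3)[OF y0])
  have 2: "theta_gap s t z = theta_gap s t (Complex (1/2) (Im z))" if "\<delta> = 0"
    using that by (simp add: theta_gap_def \<delta>(3)[OF y0])
  show "theta_gap s t z \<le> theta_gap s t (Complex (1/2) (Im z))" using 1 2 \<delta>(1) by fastforce
  show "Re z \<noteq> of_int (round (Re z - 1/2)) + 1/2 \<Longrightarrow> theta_gap s t z < theta_gap s t (Complex (1/2) (Im z))"
    using 1 \<delta>(1,4) by fastforce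
qed

section \<open>The gap on the line Re z = 1/2\<close>

lemma ntheta_half_continuous: "continuous_on {6/10..15/10} (ntheta t (1/2))"
proof -
  define \<alpha> where "\<alpha> = exp t"
  have \<alpha>: "0 < \<alpha>" by (simp add: \<alpha>_def)
  define u where "u = (\<lambda>(m::int, n::int) y. exp (- (pi * \<alpha> * y) * (of_int m)\<^sup>2) * exp (- (pi * \<alpha> / y) * (of_int n + of_int m * (1/2))\<^sup>2))"
  define M where "M = (\<lambda>(m::int, n::int). exp (- (pi * \<alpha> * (6/10)) * (of_int m)\<^sup>2) * exp (- (pi * \<alpha> / (15/10)) * (of_int n + of_int m * (1/2))\<^sup>2))"
  have M: "M summable_on UNIV"
  proof -
    \<comment> \<open>The majorant takes the worst height in each factor, 6/10 in one and 15/10 in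
      the other. It is the term of a theta series at height y0 with y0^2 = 6/10 * 15/10 and
      parameter \<open>A\<close>, hence summable.\<close>
    define y0 where "y0 = sqrt (9/10 :: real)"
    define A where "A = \<alpha> * (6/10) / y0"
    have y0: "0 < y0" "y0 * y0 = 9/10" by (auto simp: y0_def)
    have A: "0 < A" using \<alpha> y0 by (simp add: A_def)
    have e: "pi * A * y0 = pi * \<alpha> * (6/10)" "pi * A / y0 = pi * \<alpha> / (15/10)"
    proof -
      show "pi * A * y0 = pi * \<alpha> * (6/10)" using y0 by (simp add: A_def)
      have "pi * A / y0 = pi * \<alpha> * (6/10) / (y0 * y0)" by (simp add: A_def)
      then show "pi * A / y0 = pi * \<alpha> / (15/10)" unfolding y0(2) by simp
    qed
    have "0 < Im (Complex (1/2) y0)" using y0 by simp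
    from theta_summable[OF A this] show ?thesis
      unfolding theta_term[OF y0(1)] e M_def .
  qed
  have le: "\<bar>u i y\<bar> \<le> M i" if "y \<in> {6/10..15/10}" for i y
  proof -
    obtain m n where i: "i = (m, n)" by (cases i)
    have "exp (- (pi * \<alpha> * y) * (of_int m)\<^sup>2) \<le> exp (- (pi * \<alpha> * (6/10)) * (of_int m)\<^sup>2)"
    proof -
      have "(pi * \<alpha> * (6/10)) * (of_int m)\<^sup>2 \<le> (pi * \<alpha> * y) * (of_int m)\<^sup>2"
        using that \<alpha> by (intro mult_right_mono mult_left_mono) auto
      then show ?thesis by simp
    qed
    moreover have "exp (- (pi * \<alpha> / y) * (of_int n + of_int m * (1/2))\<^sup>2) \<le> exp (- (pi * \<alpha> / (15/10)) * (of_int n + of_int m * (1/2))\<^sup>2)"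
    proof -
      have "pi * \<alpha> / (15/10) \<le> pi * \<alpha> / y" using that \<alpha> by (intro divide_left_mono) auto
      then have "- (pi * \<alpha> / y) * (of_int n + of_int m * (1/2))\<^sup>2 \<le> - (pi * \<alpha> / (15/10)) * (of_int n + of_int m * (1/2))\<^sup>2"
        by (intro mult_right_mono) auto
      then show ?thesis by (rule exp_mono)
    qed
    ultimately show ?thesis
      unfolding i u_def M_def prod.case abs_mult by (intro mult_mono) auto
  qed
  have "continuous_on {6/10..15/10} (\<lambda>y. \<Sum>\<^sub>\<infinity>i. u i y)"
  proof (rule has_sum_uniform_integral(2)[OF le M])
    show "continuous_on {6/10..15/10} (u i)" for i
      unfolding u_def by (cases i) (auto intro!: continuous_intros)
  qed
  then have "continuous_on {6/10..15/10} (\<lambda>y. exp (t / 2) * (\<Sum>\<^sub>\<infinity>i. u i y))"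
    by (intro continuous_intros)
  moreover have "exp (t / 2) * (\<Sum>\<^sub>\<infinity>i. u i y) = ntheta t (1/2) y" if "y \<in> {6/10..15/10}" for y
  proof -
    have "0 < y" using that by simp
    then show ?thesis unfolding ntheta_def theta_def theta_term[OF \<open>0 < y\<close>] u_def \<alpha>_def[symmetric] by (simp add: case_prod_unfold)
  qed
  ultimately show ?thesis by (rule continuous_on_eq)
qed

lemma line_inversion:
  assumes st: "0 \<le> s" "s < t" and y: "6/10 \<le> y" "y \<le> 15/10" "y\<^sup>2 \<noteq> 3/4"
  obtains h where "6/10 \<le> h" "h \<le> 15/10" "theta_gap s t (Complex (1/2) y) < theta_gap s t (Complex (1/2) h)"
proof
  define q where "q = y\<^sup>2 + 1/4"
  define h where "h = y / q"
  have y2: "36/100 \<le> y\<^sup>2" using power_mono[OF y(1), of 2] by (simp add: power2_eq_square)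
  have q: "61/100 \<le> q" using y2 by (simp add: q_def)
  have h_eq: "h = y / q" by (rule h_def)
  have "6/10 * q \<le> y"
  proof -
    \<comment> \<open>15/10 and 1/6 are the roots of y = 6/10 (y^2 + 1/4).\<close>
    have "(y - 15/10) * (y - 1/6) \<le> 0" using y by (intro mult_nonpos_nonneg) auto
    then show ?thesis by (simp add: q_def power2_eq_square algebra_simps)
  qed
  then show 1: "6/10 \<le> h" using q unfolding h_eq by (simp add: pos_le_divide_eq)
  have "y \<le> 15/10 * q"
  proof -
    have "0 \<le> (y - 1/2)\<^sup>2" by simp
    then show ?thesis using y by (simp add: q_def power2_eq_square algebra_simps)
  qed
  then show "h \<le> 15/10" using q unfolding h_eq by (simp add: pos_divide_le_eq)
  define z where "z = Complex (1/2) y"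
  have z: "0 < Im z" using y by (simp add: z_def)
  define w where "w = (of_int 0 * z + of_int (- 1)) / (of_int 1 * z + of_int 0)"
  have det: "(0::int) * 0 - (- 1) * 1 = 1" by simp
  have "theta_gap s t w = theta_gap s t z" unfolding w_def by (rule theta_gap_moebius[OF det z])
  moreover have qz: "(1/2)\<^sup>2 + y\<^sup>2 = q" by (simp add: q_def power2_eq_square)
  have w: "Re w = - (1/2) / q" "Im w = h"
    unfolding w_def z_def h_def by (simp_all add: Re_divide Im_divide qz)
  have "theta_gap s t w < theta_gap s t (Complex (1/2) (Im w))"
  proof (rule theta_gap_x_move(2)[OF st])
    show "6/10 \<le> Im w" using 1 w by simp
    show "Re w \<noteq> of_int (round (Re w - 1/2)) + 1/2"
    proof
      define k where "k = round (Re w - 1/2)"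
      assume "Re w = of_int (round (Re w - 1/2)) + 1/2"
      then have k: "- (1/2) / q = of_int k + 1/2" using w by (simp add: k_def)
      define p where "p = (1/2) / q"
      have p: "0 < p" "p \<le> 50/61" using q by (auto simp: p_def pos_divide_le_eq)
      have pk: "- p = of_int k + 1/2" using k by (simp add: p_def)
      \<comment> \<open>Re w lies strictly between -1 and 0, so -1/2 is its only possible
        half-integer value, and that forces q = 1.\<close>
      then have "of_int k < (0::real)" "- 2 < (of_int k :: real)" using p by linarith+
      then have "k = - 1" by linarith
      then have "(1/2) / q = 1/2" using pk by (simp add: p_def)
      then have "q = 1" using q by (simp add: field_simps)
      then show False using y(3) by (simp add: q_def)
    qed
  qed
  ultimately show "theta_gap s t (Complex (1/2) y) < theta_gap s t (Complex (1/2) h)" using w by (simp add: z_def)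
qed

lemma line_max_compact:
  assumes st: "0 \<le> s" "s < t" and y: "6/10 \<le> y" "y \<le> 15/10"
  shows "theta_gap s t (Complex (1/2) y) \<le> theta_gap s t (Complex (1/2) (sqrt 3 / 2))"
    and "y \<noteq> sqrt 3 / 2 \<Longrightarrow> theta_gap s t (Complex (1/2) y) < theta_gap s t (Complex (1/2) (sqrt 3 / 2))"
proof -
  have c: "continuous_on {6/10..15/10} (\<lambda>y. theta_gap s t (Complex (1/2) y))"
  proof -
    have "continuous_on {6/10..15/10} (\<lambda>y. ntheta t (1/2) y - ntheta s (1/2) y)"
      by (intro continuous_on_diff ntheta_half_continuous)
    then show ?thesis by (simp add: theta_gap_def)
  qed
  have "\<exists>x\<in>{6/10..15/10::real}. \<forall>y\<in>{6/10..15/10}. theta_gap s t (Complex (1/2) y) \<le> theta_gap s t (Complex (1/2) x)"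
    by (rule continuous_attains_sup) (use c in auto)
  then obtain x where x: "x \<in> {6/10..15/10}" "\<And>y. y \<in> {6/10..15/10} \<Longrightarrow> theta_gap s t (Complex (1/2) y) \<le> theta_gap s t (Complex (1/2) x)"
    by blast
  have sq: "v = sqrt 3 / 2" if "v\<^sup>2 = 3/4" "6/10 \<le> v" for v :: real
  proof -
    have "v = sqrt (3/4)" using that by (metis real_sqrt_abs abs_of_nonneg order_trans zero_le_divide_iff zero_le_numeral)
    then show ?thesis by (simp add: real_sqrt_divide)
  qed
  have "x\<^sup>2 = 3/4"
  proof (rule ccontr)
    assume "x\<^sup>2 \<noteq> 3/4"
    with x(1) obtain h where "6/10 \<le> h" "h \<le> 15/10" "theta_gap s t (Complex (1/2) x) < theta_gap s t (Complex (1/2) h)"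
      using line_inversion[OF st, of x] by auto
    then show False using x(2)[of h] by simp
  qed
  then have xs: "x = sqrt 3 / 2" using sq x(1) by simp
  then show "theta_gap s t (Complex (1/2) y) \<le> theta_gap s t (Complex (1/2) (sqrt 3 / 2))" using x(2)[of y] y unfolding xs by simp
  assume "y \<noteq> sqrt 3 / 2"
  then have "y\<^sup>2 \<noteq> 3/4" using sq y by blast
  with y obtain h where "6/10 \<le> h" "h \<le> 15/10" "theta_gap s t (Complex (1/2) y) < theta_gap s t (Complex (1/2) h)"
    using line_inversion[OF st, of y] by auto
  then show "theta_gap s t (Complex (1/2) y) < theta_gap s t (Complex (1/2) (sqrt 3 / 2))" using x(2)[of h] unfolding xs by simp
qed

text \<open>Induction on the number of halvings that bring y down to [6/10, 15/10]; each halving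
  strictly increases the gap and stays above 75/100.\<close>

lemma line_max:
  assumes st: "0 \<le> s" "s < t" and y: "6/10 \<le> y"
  shows "y \<noteq> sqrt 3 / 2 \<Longrightarrow> theta_gap s t (Complex (1/2) y) < theta_gap s t (Complex (1/2) (sqrt 3 / 2))"
proof -
  have le: "theta_gap s t (Complex (1/2) y) \<le> theta_gap s t (Complex (1/2) (sqrt 3 / 2)) \<and>
     (15/10 < y \<longrightarrow> theta_gap s t (Complex (1/2) y) < theta_gap s t (Complex (1/2) (sqrt 3 / 2)))"
    if "6/10 \<le> y" "y \<le> 15/10 * 2 ^ n" for n :: nat and y
    using that
  proof (induction n arbitrary: y)
    case 0
    then show ?case using line_max_compact(1)[OF st] by simp
  next
    case (Suc n)
    show ?case
    proof (cases "y \<le> 15/10")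
      case True
      then show ?thesis using line_max_compact(1)[OF st] Suc.prems by simp
    next
      case False
      have "theta_gap s t (Complex (1/2) y) < theta_gap s t (Complex (1/2) (y / 2))"
        using y_halving[of y s t] False st by (simp add: theta_gap_def)
      also have "\<dots> \<le> theta_gap s t (Complex (1/2) (sqrt 3 / 2))"
        using Suc.IH[of "y / 2"] Suc.prems False by simp
      finally show ?thesis by simp
    qed
  qed
  obtain n where "y < 2 ^ n" using real_arch_pow[of 2 y] by auto
  then have "y \<le> 15/10 * 2 ^ n" using zero_less_power[of "2::real" n] by linarith
  from le[OF y this]
  show "y \<noteq> sqrt 3 / 2 \<Longrightarrow> theta_gap s t (Complex (1/2) y) < theta_gap s t (Complex (1/2) (sqrt 3 / 2))"
    using line_max_compact(2)[OF st y] by (cases "y \<le> 15/10") auto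
qed

section \<open>Comparison of quotients\<close>

lemma axis_pair_mono:
  assumes Y: "1 \<le> Y" and st: "0 \<le> s" "s \<le> t"
  shows "axis_pair Y s \<le> axis_pair Y t"
proof (rule DERIV_nonneg_imp_nondecreasing[OF st(2)])
  fix u assume "s \<le> u" "u \<le> t"
  then have u: "0 \<le> u" using st by simp
  have "1 * 1 \<le> pi * Y" using pi_gt_314 Y by (intro mult_mono) auto
  then have "1 * sinh u \<le> pi * Y * sinh u" using u by (intro mult_right_mono) auto
  then have "0 \<le> pi * Y * sinh u - u" using sinh_ge_self[OF u] by simp
  then have "0 \<le> 2 * pi * Y * sqrt Y * (exp (- (pi * Y * cosh u)) * sinh (pi * Y * sinh u - u))"
    using Y by simp
  then show "\<exists>D. (axis_pair Y has_real_derivative D) (at u) \<and> 0 \<le> D" using axis_pair_deriv by blast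
qed

text \<open>As long as e^t \<le> y, both the axis part and the off-diagonal part at x = 1/2 increase
  with t. Taken at y = e^t this is the point in the cusp where the gap is nonnegative.\<close>

lemma ntheta_half_mono:
  assumes y: "1 \<le> y" and st: "0 \<le> s" "s < t" "exp t \<le> y"
  shows "ntheta s (1/2) y \<le> ntheta t (1/2) y"
proof -
  have y0: "0 < y" using y by simp
  define S where "S = (\<lambda>u. 2 * sqrt y * (gauss_tail (pi * y * exp u) + gauss_tail (pi * y * exp (- u))))"
  have ntheta: "ntheta u (1/2) y = sqrt y + S u + 4 * sqrt y * offdiag_sum y u (\<lambda>m n. cos (2 * pi * real m * real n * (1/2)))" for u
    unfolding ntheta_fourier[OF y0] S_def by (simp only: distrib_left mult.left_commute mult_1_right mult_ac add_ac)
  have "S s \<le> S t"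
    unfolding S_def
  proof (rule has_sum_mono[OF axis_has_sum[OF y0] axis_has_sum[OF y0]])
    fix n :: nat assume "n \<in> {1..}"
    then have "1 * 1 \<le> (real n)\<^sup>2 * y" using y by (intro mult_mono) auto
    then have "axis_pair ((real n)\<^sup>2 * y) s \<le> axis_pair ((real n)\<^sup>2 * y) t" using st by (intro axis_pair_mono) auto
    then show "2 * axis_pair ((real n)\<^sup>2 * y) s / real n \<le> 2 * axis_pair ((real n)\<^sup>2 * y) t / real n"
      by (intro divide_right_mono mult_left_mono) auto
  qed
  moreover have "offdiag_sum y s (\<lambda>m n. cos (2 * pi * real m * real n * (1/2))) \<le> offdiag_sum y t (\<lambda>m n. cos (2 * pi * real m * real n * (1/2)))"
    using offdiag_sum_half_strict_mono[of y s t] st y by simp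
  then have "4 * sqrt y * offdiag_sum y s (\<lambda>m n. cos (2 * pi * real m * real n * (1/2))) \<le> 4 * sqrt y * offdiag_sum y t (\<lambda>m n. cos (2 * pi * real m * real n * (1/2)))"
    by (rule mult_left_mono) (use y in auto)
  ultimately show ?thesis unfolding ntheta by linarith
qed

definition hexpoint :: complex where "hexpoint = Complex (1/2) (sqrt 3 / 2)"

lemma hexpoint_exp: "exp (\<i> * pi / 3) = hexpoint"
proof -
  have "exp (\<i> * pi / 3) = cis (pi / 3)" by (simp add: cis_conv_exp)
  then show ?thesis by (simp add: hexpoint_def complex_eq_iff cos_60 sin_60)
qed

lemma finite_short_vectors:
  assumes z: "0 < Im z"
  shows "finite {(c::int, d::int). cmod (of_int c * z + of_int d) \<le> 1}"
proof (rule finite_subset)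
  define A where "A = 1 / Im z"
  define B where "B = 1 + A * \<bar>Re z\<bar>"
  show "finite ({- \<lfloor>A\<rfloor>..\<lfloor>A\<rfloor>} \<times> {- \<lfloor>B\<rfloor>..\<lfloor>B\<rfloor>})" by simp
  show "{(c::int, d::int). cmod (of_int c * z + of_int d) \<le> 1} \<subseteq> {- \<lfloor>A\<rfloor>..\<lfloor>A\<rfloor>} \<times> {- \<lfloor>B\<rfloor>..\<lfloor>B\<rfloor>}"
  proof clarify
    fix c d :: int assume le: "cmod (of_int c * z + of_int d) \<le> 1"
    have "\<bar>Im (of_int c * z + of_int d)\<bar> \<le> 1" using abs_Im_le_cmod le order_trans by blast
    then have "\<bar>of_int c\<bar> * Im z \<le> 1" using z by (simp add: abs_mult)
    then have c: "\<bar>of_int c\<bar> \<le> A" using z by (simp add: A_def pos_le_divide_eq)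
    have "\<bar>Re (of_int c * z + of_int d)\<bar> \<le> 1" using abs_Re_le_cmod le order_trans by blast
    then have "\<bar>of_int d\<bar> \<le> 1 + \<bar>of_int c\<bar> * \<bar>Re z\<bar>" by (simp add: abs_mult[symmetric])
    also have "\<dots> \<le> B" unfolding B_def using c by (intro add_left_mono mult_right_mono) auto
    finally have d: "\<bar>of_int d\<bar> \<le> B" .
    have bnd: "k \<in> {- \<lfloor>X\<rfloor>..\<lfloor>X\<rfloor>}" if "\<bar>of_int k\<bar> \<le> X" for k :: int and X :: real
    proof -
      have "of_int \<bar>k\<bar> \<le> X" using that by simp
      then have "\<bar>k\<bar> \<le> \<lfloor>X\<rfloor>" by (simp only: le_floor_iff)
      then show ?thesis by auto
    qed
    show "c \<in> {- \<lfloor>A\<rfloor>..\<lfloor>A\<rfloor>} \<and> d \<in> {- \<lfloor>B\<rfloor>..\<lfloor>B\<rfloor>}" using bnd[OF c] bnd[OF d] by blast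
  qed
qed

text \<open>A shortest nonzero vector c z + d supplies the bottom row of the matrix. Minimality
  makes c and d coprime and gives every nonzero vector of the new lattice length at least 1; with
  |Re W| reduced to at most 1/2 by a translation, (Im W)^2 \<ge> 3/4.\<close>

lemma reduce_height:
  assumes z: "0 < Im z"
  obtains a b c d :: int where "a * d - b * c = 1"
    "6/10 \<le> Im ((of_int a * z + of_int b) / (of_int c * z + of_int d))"
proof -
  define f where "f = (\<lambda>(c::int, d::int). cmod (of_int c * z + of_int d))"
  define S where "S = {(c::int, d::int). cmod (of_int c * z + of_int d) \<le> 1} - {(0, 0)}"
  have "finite S" using finite_short_vectors[OF z] by (simp add: S_def)
  moreover have "(0, 1) \<in> S" by (simp add: S_def)
  ultimately obtain v where v: "v \<in> S" "\<And>u. u \<in> S \<Longrightarrow> f v \<le> f u"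
    using arg_min_if_finite(1)[of S f] arg_min_least[of S _ f] by (metis empty_iff)
  obtain c d where cd: "v = (c, d)" by (cases v)
  have cd0: "(c, d) \<noteq> (0, 0)" and cd1: "cmod (of_int c * z + of_int d) \<le> 1"
    using v(1) by (auto simp: S_def cd)
  have min: "cmod (of_int c * z + of_int d) \<le> cmod (of_int p * z + of_int q)" if "(p, q) \<noteq> (0, 0)" for p q
  proof (cases "(p, q) \<in> S")
    case True
    then show ?thesis using v(2)[OF True] by (simp add: f_def cd)
  next
    case False
    then have "1 < cmod (of_int p * z + of_int q)" using that by (auto simp: S_def)
    then show ?thesis using cd1 by simp
  qed
  have pos: "0 < cmod (of_int c * z + of_int d)"
  proof -
    have "of_int c * z + of_int d \<noteq> 0"
    proof
      assume "of_int c * z + of_int d = 0"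
      then have "of_int c * Im z = 0" "of_int c * Re z + of_int d = 0" by (auto simp: complex_eq_iff)
      then show False using z cd0 by auto
    qed
    then show ?thesis by simp
  qed
  have cop: "coprime c d"
  proof -
    define g where "g = gcd c d"
    have g: "1 \<le> g" using cd0 by (simp add: g_def int_one_le_iff_zero_less)
    obtain c' d' where c': "c = g * c'" "d = g * d'" by (metis g_def gcd_dvd1 gcd_dvd2 dvdE)
    have "(c', d') \<noteq> (0, 0)" using cd0 c' by auto
    then have le: "cmod (of_int c * z + of_int d) \<le> cmod (of_int c' * z + of_int d')" by (rule min)
    have "of_int c * z + of_int d = of_int g * (of_int c' * z + of_int d')"
      by (simp add: c' algebra_simps)
    then have eq: "cmod (of_int c * z + of_int d) = of_int g * cmod (of_int c' * z + of_int d')"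
      using g by (simp add: norm_mult)
    have pos': "0 < cmod (of_int c' * z + of_int d')" using pos le by linarith
    have "of_int g * cmod (of_int c' * z + of_int d') \<le> 1 * cmod (of_int c' * z + of_int d')"
      using eq le by simp
    then have "of_int g \<le> (1::real)" using pos' by (simp only: mult_le_cancel_right)
    then have "g = 1" using g by simp
    then show ?thesis by (simp add: g_def coprime_iff_gcd_eq_1)
  qed
  obtain u w where uw: "u * c + w * d = 1"
    using cop bezout_int[of c d] by (metis coprime_iff_gcd_eq_1)
  define a b where "a = w" and "b = - u"
  have det: "a * d - b * c = 1" using uw by (simp add: a_def b_def)
  define W where "W = (of_int a * z + of_int b) / (of_int c * z + of_int d)"
  have ImW: "0 < Im W" unfolding W_def Im_moebius[OF det z] using z pos by simp
  have len: "1 \<le> cmod (of_int m * W + of_int n)" if mn: "(m, n) \<noteq> (0, 0)" for m n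
  proof -
    have "(m * a + n * c, m * b + n * d) \<noteq> (0, 0)"
    proof
      assume z0: "(m * a + n * c, m * b + n * d) = (0, 0)"
      have "inj (\<lambda>(m, n). (m * a + n * c, m * b + n * d))"
        using SL2_bij[OF det] by (rule bij_betw_imp_inj_on)
      from injD[OF this, of "(m, n)" "(0, 0)"] have "(m, n) = (0, 0)" using z0 by simp
      then show False using mn by simp
    qed
    from min[OF this] have "cmod (of_int c * z + of_int d) \<le> cmod (of_int (m * a + n * c) * z + of_int (m * b + n * d))" .
    then show ?thesis unfolding W_def moebius_row[OF det z] norm_divide using pos by (simp add: pos_le_divide_eq)
  qed
  define r where "r = Re W - of_int (round (Re W))"
  have "\<bar>r\<bar> \<le> 1/2" using of_int_round_abs_le[of "Re W"] by (simp add: r_def abs_minus_commute)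
  then have r2: "r\<^sup>2 \<le> 1/4" using power_mono[of "\<bar>r\<bar>" "1/2" 2] by (simp add: power_divide)
  have "1 \<le> cmod (of_int 1 * W + of_int (- round (Re W)))" by (rule len) simp
  then have "1\<^sup>2 \<le> (cmod (of_int 1 * W + of_int (- round (Re W))))\<^sup>2" by (rule power_mono) simp
  also have "\<dots> = r\<^sup>2 + (Im W)\<^sup>2" by (simp add: cmod_power2 r_def)
  finally have "(6/10)\<^sup>2 \<le> (Im W)\<^sup>2" using r2 by (simp add: power2_eq_square)
  then have "6/10 \<le> Im W" using ImW by (simp add: power2_le_iff_abs_le)
  then show ?thesis using that[OF det] by (simp add: W_def)
qed

lemma theta_gap_max:
  assumes st: "0 \<le> s" "s < t" and z: "0 < Im z"
  shows "theta_gap s t z \<le> theta_gap s t hexpoint" and "z \<notin> modular_orbit hexpoint \<Longrightarrow> theta_gap s t z < theta_gap s t hexpoint"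
proof -
  obtain a b c d :: int where det: "a * d - b * c = 1"
    and im: "6/10 \<le> Im ((of_int a * z + of_int b) / (of_int c * z + of_int d))"
    by (rule reduce_height[OF z])
  define W where "W = (of_int a * z + of_int b) / (of_int c * z + of_int d)"
  have PW: "theta_gap s t W = theta_gap s t z" unfolding W_def by (rule theta_gap_moebius[OF det z])
  have im': "6/10 \<le> Im W" using im by (simp add: W_def)
  note x = theta_gap_x_move[OF st im']
  have l: "theta_gap s t (Complex (1/2) (Im W)) \<le> theta_gap s t hexpoint"
  proof (cases "Im W = sqrt 3 / 2")
    case True
    show ?thesis unfolding True hexpoint_def ..
  qed (use line_max[OF st im'] in \<open>auto simp: hexpoint_def\<close>)
  show "theta_gap s t z \<le> theta_gap s t hexpoint" using x(1) l PW by simp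
  assume out: "z \<notin> modular_orbit hexpoint"
  show "theta_gap s t z < theta_gap s t hexpoint"
  proof (cases "Im W = sqrt 3 / 2 \<and> Re W = of_int (round (Re W - 1/2)) + 1/2")
    case False
    then show ?thesis using x l PW line_max[OF st im'] unfolding hexpoint_def by fastforce
  next
    case True
    define k where "k = round (Re W - 1/2)"
    have Wk: "W = hexpoint + of_int k" using True by (simp add: complex_eq_iff hexpoint_def k_def)
    \<comment> \<open>The inverse matrix with rows (d, -b) and (-c, a) applied to hexpoint + k,
      which has the entries shown.\<close>
    have "z = (of_int d * hexpoint + of_int (d * k - b)) / (of_int (- c) * hexpoint + of_int (a - c * k))"
    proof -
      have D: "of_int c * z + of_int d \<noteq> 0" by (rule moebius_denominator_nonzero[OF det z])
      have WD: "W * (of_int c * z + of_int d) = of_int a * z + of_int b" using D by (simp add: W_def)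
      have det': "(of_int a * of_int d - of_int b * of_int c :: complex) = 1"
        using det by (metis of_int_1 of_int_diff of_int_mult)
      have num: "of_int d * W - of_int b = z * (of_int a - of_int c * W)" using WD by (simp add: algebra_simps)
      have den: "of_int a - of_int c * W \<noteq> 0"
      proof
        assume e: "of_int a - of_int c * W = 0"
        then have "of_int d * W - of_int b = 0" using num by simp
        then have "of_int a * (of_int d * W - of_int b) = 0" by simp
        moreover have "of_int a * (of_int d * W - of_int b) = (of_int a * of_int d - of_int b * of_int c) * W - of_int b * (of_int a - of_int c * W)"
          by (simp add: algebra_simps)
        ultimately have "W = 0" using e det' by simp
        then show False using im' by simp
      qed
      have "z = (of_int d * W - of_int b) / (of_int a - of_int c * W)" using num den by (simp add: field_simps)
      then show ?thesis unfolding Wk by (simp add: algebra_simps)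
    qed
    moreover have "d * (a - c * k) - (d * k - b) * (- c) = 1" using det by (simp add: algebra_simps)
    ultimately have "z \<in> modular_orbit hexpoint" unfolding modular_orbit_def by blast
    then show ?thesis using out by simp
  qed
qed

lemma ntheta_hex_mono:
  assumes "0 \<le> s" "s < t"
  shows "ntheta s (Re hexpoint) (Im hexpoint) \<le> ntheta t (Re hexpoint) (Im hexpoint)"
proof -
  have "1 \<le> exp t" using assms by simp
  from ntheta_half_mono[OF this assms] have "0 \<le> theta_gap s t (Complex (1/2) (exp t))" by (simp add: theta_gap_def)
  also have "\<dots> \<le> theta_gap s t hexpoint" by (rule theta_gap_max(1)[OF assms]) simp
  finally show ?thesis by (simp add: theta_gap_def)
qed

lemma theta_ge_1:
  assumes "0 < \<alpha>" "0 < Im z"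
  shows "1 \<le> theta \<alpha> z"
proof -
  have "((\<lambda>i::int\<times>int. if i = (0, 0) then 1 else (0::real)) has_sum 1) UNIV"
    by (rule has_sum_finite_neutralI[of "{(0, 0)}"]) (auto split: if_splits)
  then show ?thesis
    by (rule has_sum_mono[OF _ theta_has_sum[OF assms]]) auto
qed

lemma hexpoint_form: "1 \<le> (cmod (of_int m * hexpoint + of_int n))\<^sup>2 / Im hexpoint" if "(m, n) \<noteq> (0, 0)" for m n :: int
proof -
  have "(cmod (of_int m * hexpoint + of_int n))\<^sup>2 = of_int (m\<^sup>2 + m * n + n\<^sup>2)"
  proof -
    have "(of_int m * (sqrt 3 / 2))\<^sup>2 = 3/4 * (of_int m)\<^sup>2" by (simp add: power_mult_distrib power_divide)
    then have "(cmod (of_int m * hexpoint + of_int n))\<^sup>2 = (of_int m * (1/2) + of_int n)\<^sup>2 + 3/4 * (of_int m)\<^sup>2"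
      unfolding cmod_power2 by (simp add: hexpoint_def)
    then show ?thesis by (simp add: power2_eq_square field_simps)
  qed
  moreover have "1 \<le> m\<^sup>2 + m * n + n\<^sup>2"
  proof -
    have "4 * (m\<^sup>2 + m * n + n\<^sup>2) = (2 * m + n)\<^sup>2 + 3 * n\<^sup>2" by (simp add: power2_eq_square algebra_simps)
    moreover have "0 < (2 * m + n)\<^sup>2 + 3 * n\<^sup>2"
    proof (cases "n = 0")
      case True
      then have "m \<noteq> 0" using that by simp
      then show ?thesis using True by simp
    next
      case False
      then show ?thesis by (simp add: add_nonneg_pos)
    qed
    ultimately have "0 < 4 * (m\<^sup>2 + m * n + n\<^sup>2)" by (simp only:)
    then show ?thesis by simp
  qed
  then have "(1::real) \<le> of_int (m\<^sup>2 + m * n + n\<^sup>2)" by (metis of_int_1 of_int_le_iff)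
  moreover have "sqrt 3 \<le> 2" by (rule real_le_lsqrt) auto
  then have "0 < Im hexpoint" "Im hexpoint \<le> 1" by (auto simp: hexpoint_def)
  ultimately show ?thesis by (simp add: pos_le_divide_eq)
qed

text \<open>The zero vector gives e^(s/2). For the others the normalised squared length Q is at
  least 1, so exp(-pi e^s Q) \<le> exp(-pi (e^s - 1)) exp(-pi Q), and the rest is a vanishing
  multiple of the theta series at parameter 1.\<close>

lemma ntheta_hex_tail:
  assumes s: "0 \<le> s"
  shows "ntheta s (Re hexpoint) (Im hexpoint) \<le> exp (s / 2) + theta 1 hexpoint * exp (- (s / 2))"
proof -
  have I: "0 < Im hexpoint" by (simp add: hexpoint_def)
  define E where "E = exp (- (pi * (exp s - 1)))"
  have "((\<lambda>i::int\<times>int. if i = (0, 0) then 1 else (0::real)) has_sum 1) UNIV"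
    by (rule has_sum_finite_neutralI[of "{(0, 0)}"]) (auto split: if_splits)
  from has_sum_add[OF this has_sum_cmult_right[OF theta_has_sum[OF zero_less_one I], of E]]
  have "((\<lambda>i::int\<times>int. (if i = (0, 0) then 1 else 0) + E * (case i of (m, n) \<Rightarrow> exp (- pi * 1 * (cmod (of_int m * hexpoint + of_int n))\<^sup>2 / Im hexpoint))) has_sum (1 + E * theta 1 hexpoint)) UNIV" .
  then have "theta (exp s) hexpoint \<le> 1 + E * theta 1 hexpoint"
  proof (rule has_sum_mono[OF theta_has_sum[OF _ I], rotated])
    fix i :: "int \<times> int"
    obtain m n where i: "i = (m, n)" by (cases i)
    define Q where "Q = (cmod (of_int m * hexpoint + of_int n))\<^sup>2 / Im hexpoint"
    have e: "exp (- pi * \<alpha> * (cmod (of_int m * hexpoint + of_int n))\<^sup>2 / Im hexpoint) = exp (- (pi * \<alpha> * Q))" for \<alpha>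
      by (simp add: Q_def)
    show "(case i of (m, n) \<Rightarrow> exp (- pi * exp s * (cmod (of_int m * hexpoint + of_int n))\<^sup>2 / Im hexpoint))
      \<le> (if i = (0, 0) then 1 else 0) + E * (case i of (m, n) \<Rightarrow> exp (- pi * 1 * (cmod (of_int m * hexpoint + of_int n))\<^sup>2 / Im hexpoint))"
    proof (cases "i = (0, 0)")
      case True
      then show ?thesis by (simp add: E_def)
    next
      case False
      then have "1 \<le> Q" unfolding Q_def i by (intro hexpoint_form) auto
      moreover have "1 \<le> exp s" using s by simp
      ultimately have "(pi * (exp s - 1)) * 1 \<le> (pi * (exp s - 1)) * Q" by (intro mult_left_mono) auto
      then have "exp (- (pi * exp s * Q)) \<le> E * exp (- (pi * 1 * Q))"
        unfolding E_def exp_add[symmetric] by (simp add: algebra_simps)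
      then show ?thesis using False unfolding i prod.case e by simp
    qed
  qed simp
  then have "exp (s / 2) * theta (exp s) hexpoint \<le> exp (s / 2) * (1 + E * theta 1 hexpoint)" by (intro mult_left_mono) auto
  also have "\<dots> = exp (s / 2) + theta 1 hexpoint * (exp (s / 2) * E)" by (simp add: algebra_simps)
  also have "\<dots> \<le> exp (s / 2) + theta 1 hexpoint * exp (- (s / 2))"
  proof (intro add_left_mono mult_left_mono)
    have "s \<le> exp s - 1" using exp_ge_add_one_self[of s] by linarith
    also have "1 * (exp s - 1) \<le> pi * (exp s - 1)" using s pi_gt_314 by (intro mult_right_mono) auto
    finally have "s \<le> pi * (exp s - 1)" by simp
    then show "exp (s / 2) * E \<le> exp (- (s / 2))" unfolding E_def exp_add[symmetric] by simp
    show "0 \<le> theta 1 hexpoint" using theta_ge_1[OF zero_less_one I] by simp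
  qed
  finally show ?thesis by (simp add: ntheta_def)
qed

text \<open>In the gap between t and a large s the leading terms e^(s/2) at both points cancel; what
  remains at \<open>hexpoint\<close> tends to 0, and what remains at z is nonnegative.\<close>

lemma ntheta_hex_min:
  assumes t: "0 \<le> t" and z: "0 < Im z"
  shows "ntheta t (Re hexpoint) (Im hexpoint) \<le> ntheta t (Re z) (Im z)"
proof -
  have ev: "\<forall>\<^sub>F s in at_top. - (theta 1 hexpoint * exp (- (s / 2))) \<le> ntheta t (Re z) (Im z) - ntheta t (Re hexpoint) (Im hexpoint)"
    using eventually_gt_at_top[of t]
  proof eventually_elim
    case (elim s)
    have "exp (s / 2) * 1 \<le> ntheta s (Re z) (Im z)"
      unfolding ntheta_def by (intro mult_left_mono theta_ge_1) (use z in auto)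
    moreover have "theta_gap t s z \<le> theta_gap t s hexpoint" by (rule theta_gap_max(1)[OF t elim z])
    moreover have "ntheta s (Re hexpoint) (Im hexpoint) \<le> exp (s / 2) + theta 1 hexpoint * exp (- (s / 2))"
      by (rule ntheta_hex_tail) (use t elim in simp)
    ultimately show ?case by (simp add: theta_gap_def)
  qed
  have "((\<lambda>s::real. - (theta 1 hexpoint * exp (- (s / 2)))) \<longlongrightarrow> - (theta 1 hexpoint * 0)) at_top"
  proof (intro tendsto_intros)
    have "filterlim (\<lambda>s::real. 1/2 * s) at_top at_top"
      by (rule filterlim_tendsto_pos_mult_at_top[OF tendsto_const _ filterlim_ident]) simp
    then have "filterlim (\<lambda>s::real. - (s / 2)) at_bot at_top"
      by (simp add: filterlim_uminus_at_top)
    then show "((\<lambda>s::real. exp (- (s / 2))) \<longlongrightarrow> 0) at_top"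
      by (rule filterlim_compose[OF exp_at_bot])
  qed
  from tendsto_upperbound[OF this ev] show ?thesis by simp
qed

text \<open>With A, B, C, D as in the proof, the gap gives A \<le> C - B + D, and C D - (C - B + D)
  B = (C - B)(D - B) \<ge> 0. Strictness is inherited from the gap since B > 0.\<close>

lemma ntheta_ratio:
  assumes st: "0 \<le> s" "s < t" and z: "0 < Im z"
  shows "ntheta t (Re z) (Im z) * ntheta s (Re hexpoint) (Im hexpoint) \<le> ntheta t (Re hexpoint) (Im hexpoint) * ntheta s (Re z) (Im z)"
    and "z \<notin> modular_orbit hexpoint \<Longrightarrow>
      ntheta t (Re z) (Im z) * ntheta s (Re hexpoint) (Im hexpoint) < ntheta t (Re hexpoint) (Im hexpoint) * ntheta s (Re z) (Im z)"
proof -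
  define A B C D where "A = ntheta t (Re z) (Im z)" and "B = ntheta s (Re hexpoint) (Im hexpoint)"
    and "C = ntheta t (Re hexpoint) (Im hexpoint)" and "D = ntheta s (Re z) (Im z)"
  have B: "0 < B"
  proof -
    have "0 < exp (s / 2) * theta (exp s) hexpoint"
      using theta_ge_1[of "exp s" hexpoint] by (intro mult_pos_pos) (auto simp: hexpoint_def)
    then show ?thesis by (simp add: B_def ntheta_def)
  qed
  have BC: "B \<le> C" unfolding B_def C_def by (rule ntheta_hex_mono[OF st])
  have BD: "B \<le> D" unfolding B_def D_def by (rule ntheta_hex_min[OF st(1) z])
  have id: "C * D - (C - B + D) * B = (C - B) * (D - B)" by (simp add: algebra_simps)
  have p: "0 \<le> (C - B) * (D - B)" using BC BD by simp
  have "A \<le> C - B + D" using theta_gap_max(1)[OF st z] by (simp add: theta_gap_def A_def B_def C_def D_def)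
  then have "A * B \<le> (C - B + D) * B" using B by (intro mult_right_mono) auto
  then show "ntheta t (Re z) (Im z) * ntheta s (Re hexpoint) (Im hexpoint) \<le> ntheta t (Re hexpoint) (Im hexpoint) * ntheta s (Re z) (Im z)"
    using id p unfolding A_def B_def C_def D_def by linarith
  assume "z \<notin> modular_orbit hexpoint"
  then have "A < C - B + D" using theta_gap_max(2)[OF st z] by (simp add: theta_gap_def A_def B_def C_def D_def)
  then have "A * B < (C - B + D) * B" using B by (intro mult_strict_right_mono) auto
  then show "ntheta t (Re z) (Im z) * ntheta s (Re hexpoint) (Im hexpoint) < ntheta t (Re hexpoint) (Im hexpoint) * ntheta s (Re z) (Im z)"
    using id p unfolding A_def B_def C_def D_def by linarith
qed

text \<open>In logarithms the two conditions on the parameters say |ln \<alpha>| \<le> ln \<beta>,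
  and duality permits replacing ln \<alpha> by its modulus. Equality means \<alpha> = \<beta> or
  \<alpha> \<beta> = 1, which explains the extra assumptions for strictness.\<close>

lemma theta_quotient_pair:
  assumes pos: "0 < \<alpha>" "0 < \<beta>" and le: "\<alpha> \<le> \<beta>" "1 \<le> \<alpha> * \<beta>" and z: "0 < Im z"
  shows "theta \<beta> z * theta \<alpha> hexpoint \<le> theta \<beta> hexpoint * theta \<alpha> z"
    and "\<alpha> < \<beta> \<Longrightarrow> 1 < \<alpha> * \<beta> \<Longrightarrow> z \<notin> modular_orbit hexpoint \<Longrightarrow> theta \<beta> z * theta \<alpha> hexpoint < theta \<beta> hexpoint * theta \<alpha> z"
proof -
  define t where "t = ln \<beta>"
  define s where "s = \<bar>ln \<alpha>\<bar>"
  define A B where "A = exp (ln \<alpha> / 2)" and "B = exp (ln \<beta> / 2)"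
  have AB: "0 < B * A" by (simp add: A_def B_def)
  have Tt: "ntheta t (Re u) (Im u) = B * theta \<beta> u" for u
    using pos by (simp add: ntheta_def t_def B_def)
  have Ts: "ntheta s (Re u) (Im u) = A * theta \<alpha> u" if "0 < Im u" for u
  proof -
    have "ntheta s (Re u) (Im u) = ntheta (ln \<alpha>) (Re u) (Im u)"
      using ntheta_dual[OF that, of "ln \<alpha>" "Re u"] by (cases "0 \<le> ln \<alpha>") (auto simp: s_def)
    then show ?thesis using pos by (simp add: ntheta_def A_def)
  qed
  have hz: "0 < Im hexpoint" by (simp add: hexpoint_def)
  have st: "s \<le> t" "s = t \<Longrightarrow> \<not> (\<alpha> < \<beta> \<and> 1 < \<alpha> * \<beta>)"
  proof -
    have l: "ln (\<alpha> * \<beta>) = ln \<alpha> + ln \<beta>" using pos by (simp add: ln_mult)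
    have 1: "ln \<alpha> \<le> ln \<beta>" using pos le by simp
    have 2: "0 \<le> ln \<alpha> + ln \<beta>" using le unfolding l[symmetric] by simp
    show "s \<le> t" using 1 2 by (simp add: s_def t_def abs_le_iff)
    assume eq: "s = t"
    show "\<not> (\<alpha> < \<beta> \<and> 1 < \<alpha> * \<beta>)"
    proof
      assume a: "\<alpha> < \<beta> \<and> 1 < \<alpha> * \<beta>"
      then have "ln \<alpha> < ln \<beta>" using pos by simp
      moreover have "0 < ln \<alpha> + ln \<beta>" using a unfolding l[symmetric] by simp
      ultimately show False using eq by (auto simp: s_def t_def abs_if split: if_splits)
    qed
  qed
  have s0: "0 \<le> s" by (simp add: s_def)
  have lhs: "ntheta t (Re z) (Im z) * ntheta s (Re hexpoint) (Im hexpoint) = (B * A) * (theta \<beta> z * theta \<alpha> hexpoint)"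
    unfolding Tt Ts[OF hz] by simp
  have rhs: "ntheta t (Re hexpoint) (Im hexpoint) * ntheta s (Re z) (Im z) = (B * A) * (theta \<beta> hexpoint * theta \<alpha> z)"
    unfolding Tt Ts[OF z] by simp
  have "ntheta t (Re z) (Im z) * ntheta s (Re hexpoint) (Im hexpoint) \<le> ntheta t (Re hexpoint) (Im hexpoint) * ntheta s (Re z) (Im z)"
  proof (cases "s = t")
    case False
    then show ?thesis using ntheta_ratio(1)[OF s0 _ z, of t] st by simp
  qed simp
  then show "theta \<beta> z * theta \<alpha> hexpoint \<le> theta \<beta> hexpoint * theta \<alpha> z"
    unfolding lhs rhs using AB by (simp only: mult_le_cancel_left_pos)
  assume a: "\<alpha> < \<beta>" "1 < \<alpha> * \<beta>" "z \<notin> modular_orbit hexpoint"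
  then have "s < t" using st by fastforce
  from ntheta_ratio(2)[OF s0 this z a(3)] show "theta \<beta> z * theta \<alpha> hexpoint < theta \<beta> hexpoint * theta \<alpha> z"
    unfolding lhs rhs using AB by (simp only: mult_less_cancel_left_pos)
qed

text \<open>A pair with \<alpha> k = \<beta> j or \<alpha> k * \<beta> j = 1 has a ratio of theta
  functions that is constant in z, by duality. Equality of the two sets is therefore tied to one
  pair with positive coefficients away from both cases.\<close>

theorem theorem1p2:
  fixes N :: nat and \<alpha> \<beta> a b :: "nat \<Rightarrow> real"
  assumes "2 \<le> N"
    and "\<And>j. j \<in> {1..N} \<Longrightarrow> 0 < \<alpha> j"
    and "\<And>j. j \<in> {1..N} \<Longrightarrow> 0 < \<beta> j"
    and "(MAX j\<in>{1..N}. \<alpha> j) \<le> (MIN j\<in>{1..N}. \<beta> j)"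
    and "1 \<le> (MAX j\<in>{1..N}. \<alpha> j)"
    and "1 \<le> (MIN j\<in>{1..N}. \<alpha> j) * (MIN j\<in>{1..N}. \<beta> j)"
    and "\<And>j. j \<in> {1..N} \<Longrightarrow> 0 \<le> a j"
    and "\<And>j. j \<in> {1..N} \<Longrightarrow> 0 \<le> b j"
  shows "modular_orbit (exp (\<i> * pi / 3))
           \<subseteq> arg_max_set (theta_quotient N b \<beta> a \<alpha>) upper_half_plane
       \<and> ((\<exists>j\<in>{1..N}. \<exists>k\<in>{1..N}. 0 < b j \<and> 0 < a k \<and> \<alpha> k < \<beta> j \<and> 1 < \<alpha> k * \<beta> j)
          \<longrightarrow> arg_max_set (theta_quotient N b \<beta> a \<alpha>) upper_half_plane
                = modular_orbit (exp (\<i> * pi / 3)))"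
proof -
  let ?f = "theta_quotient N b \<beta> a \<alpha>"
  note \<alpha> = assms(2) and \<beta> = assms(3) and a0 = assms(7) and b0 = assms(8)
  have hz: "0 < Im hexpoint" by (simp add: hexpoint_def)
  have le: "\<alpha> k \<le> \<beta> j" "1 \<le> \<alpha> k * \<beta> j" if "j \<in> {1..N}" "k \<in> {1..N}" for j k
  proof -
    have m: "\<alpha> k \<le> (MAX j\<in>{1..N}. \<alpha> j)" "(MIN j\<in>{1..N}. \<alpha> j) \<le> \<alpha> k" "(MIN j\<in>{1..N}. \<beta> j) \<le> \<beta> j"
      using that by (auto intro!: Max_ge Min_le)
    show "\<alpha> k \<le> \<beta> j" using m assms(4) by linarith
    have "(MIN j\<in>{1..N}. \<alpha> j) * (MIN j\<in>{1..N}. \<beta> j) \<le> \<alpha> k * \<beta> j"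
      using m assms(4,5) less_imp_le[OF \<alpha>[OF that(2)]] by (intro mult_mono) auto
    then show "1 \<le> \<alpha> k * \<beta> j" using assms(6) by linarith
  qed
  define P where "P = (\<lambda>z. \<Sum>j=1..N. b j * theta (\<beta> j) z)"
  define Q where "Q = (\<lambda>z. \<Sum>j=1..N. a j * theta (\<alpha> j) z)"
  have f: "?f z = P z / Q z" for z by (simp add: theta_quotient_def P_def Q_def)
  have Qpos: "0 < Q z" if "k \<in> {1..N}" "0 < a k" "0 < Im z" for k z
  proof -
    have th: "0 < theta (\<alpha> j) z" if "j \<in> {1..N}" for j
      using theta_ge_1[OF \<alpha>[OF that] \<open>0 < Im z\<close>] by simp
    show ?thesis unfolding Q_def
      by (rule sum_pos2[of _ k]) (use that th mult_nonneg_nonneg[OF a0 less_imp_le[OF th]] in auto)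
  qed
  \<comment> \<open>After cross-multiplication both sides are double sums over pairs (j, k) with
    nonnegative coefficients, so the comparison is made entry by entry.\<close>
  have cross: "P z * Q hexpoint = (\<Sum>j=1..N. \<Sum>k=1..N. (b j * a k) * (theta (\<beta> j) z * theta (\<alpha> k) hexpoint))"
    "P hexpoint * Q z = (\<Sum>j=1..N. \<Sum>k=1..N. (b j * a k) * (theta (\<beta> j) hexpoint * theta (\<alpha> k) z))" for z
    unfolding P_def Q_def sum_product by (intro sum.cong refl; simp)+
  have tle: "(b j * a k) * (theta (\<beta> j) z * theta (\<alpha> k) hexpoint) \<le> (b j * a k) * (theta (\<beta> j) hexpoint * theta (\<alpha> k) z)"
    if "j \<in> {1..N}" "k \<in> {1..N}" "0 < Im z" for j k z
    using theta_quotient_pair(1)[OF \<alpha>[OF that(2)] \<beta>[OF that(1)] le[OF that(1,2)] that(3)] a0[OF that(2)] b0[OF that(1)]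
    by (intro mult_left_mono) auto
  have PQ: "P z * Q hexpoint \<le> P hexpoint * Q z" if "0 < Im z" for z
    unfolding cross using that by (intro sum_mono tle) auto
  have max: "?f z \<le> ?f hexpoint" if z: "0 < Im z" for z
  proof (cases "\<exists>k\<in>{1..N}. 0 < a k")
    case True
    then obtain k where k: "k \<in> {1..N}" "0 < a k" by blast
    show ?thesis unfolding f using PQ[OF z] Qpos[OF k z] Qpos[OF k hz] by (simp add: frac_le_eq divide_le_eq field_simps)
  next
    case False
    then have "a k = 0" if "k \<in> {1..N}" for k using a0[OF that] that by force
    \<comment> \<open>With all a k zero the denominator vanishes; division by 0 yields 0, so the
      quotient is constant and every point is a maximiser.\<close>
    then have "Q u = 0" for u by (simp add: Q_def)
    then show ?thesis by (simp add: f)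
  qed
  have orbit: "0 < Im x \<and> ?f x = ?f hexpoint" if "x \<in> modular_orbit hexpoint" for x
  proof -
    obtain p q r s :: int where x: "x = (of_int p * hexpoint + of_int q) / (of_int r * hexpoint + of_int s)" and det: "p * s - q * r = 1"
      using \<open>x \<in> modular_orbit hexpoint\<close> by (auto simp: modular_orbit_def)
    have "0 < Im x" unfolding x Im_moebius[OF det hz] using moebius_denominator_nonzero[OF det hz] hz by simp
    moreover have "?f x = ?f hexpoint" unfolding x theta_quotient_def theta_moebius[OF det hz] ..
    ultimately show ?thesis by simp
  qed
  have arg: "x \<in> arg_max_set ?f upper_half_plane \<longleftrightarrow> 0 < Im x \<and> (\<forall>y. 0 < Im y \<longrightarrow> ?f y \<le> ?f x)" for x
    unfolding arg_max_set_def is_arg_max_def upper_half_plane_def mem_Collect_eq by (meson not_less)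
  have sub: "modular_orbit hexpoint \<subseteq> arg_max_set ?f upper_half_plane"
    using orbit max by (auto simp: arg)
  moreover have "arg_max_set ?f upper_half_plane \<subseteq> modular_orbit hexpoint"
    if ex: "\<exists>j\<in>{1..N}. \<exists>k\<in>{1..N}. 0 < b j \<and> 0 < a k \<and> \<alpha> k < \<beta> j \<and> 1 < \<alpha> k * \<beta> j"
  proof
    obtain j k where jk: "j \<in> {1..N}" "k \<in> {1..N}" "0 < b j" "0 < a k" "\<alpha> k < \<beta> j" "1 < \<alpha> k * \<beta> j"
      using ex by blast
    fix x assume x: "x \<in> arg_max_set ?f upper_half_plane"
    then have xz: "0 < Im x" by (simp add: arg)
    show "x \<in> modular_orbit hexpoint"
    proof (rule ccontr)
      assume out: "x \<notin> modular_orbit hexpoint"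
      have strict: "(b j * a k) * (theta (\<beta> j) x * theta (\<alpha> k) hexpoint) < (b j * a k) * (theta (\<beta> j) hexpoint * theta (\<alpha> k) x)"
        using theta_quotient_pair(2)[OF \<alpha>[OF jk(2)] \<beta>[OF jk(1)] le[OF jk(1,2)] xz jk(5,6) out] jk(3,4)
        by (intro mult_strict_left_mono) auto
      have "P x * Q hexpoint < P hexpoint * Q x"
        unfolding cross
      proof (rule sum_strict_mono_ex1)
        show "\<forall>j\<in>{1..N}. (\<Sum>k=1..N. (b j * a k) * (theta (\<beta> j) x * theta (\<alpha> k) hexpoint)) \<le> (\<Sum>k=1..N. (b j * a k) * (theta (\<beta> j) hexpoint * theta (\<alpha> k) x))"
          using xz by (intro ballI sum_mono tle) auto
        have "(\<Sum>k=1..N. (b j * a k) * (theta (\<beta> j) x * theta (\<alpha> k) hexpoint)) < (\<Sum>k=1..N. (b j * a k) * (theta (\<beta> j) hexpoint * theta (\<alpha> k) x))"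
        proof (rule sum_strict_mono_ex1)
          show "\<forall>k\<in>{1..N}. (b j * a k) * (theta (\<beta> j) x * theta (\<alpha> k) hexpoint) \<le> (b j * a k) * (theta (\<beta> j) hexpoint * theta (\<alpha> k) x)"
            using xz jk(1) by (intro ballI tle) auto
          show "\<exists>k\<in>{1..N}. (b j * a k) * (theta (\<beta> j) x * theta (\<alpha> k) hexpoint) < (b j * a k) * (theta (\<beta> j) hexpoint * theta (\<alpha> k) x)"
            using strict jk(2) by blast
        qed simp
        then show "\<exists>j\<in>{1..N}. (\<Sum>k=1..N. (b j * a k) * (theta (\<beta> j) x * theta (\<alpha> k) hexpoint)) < (\<Sum>k=1..N. (b j * a k) * (theta (\<beta> j) hexpoint * theta (\<alpha> k) x))"
          using jk(1) by blast
      qed simp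
      then have "?f x < ?f hexpoint"
        unfolding f using Qpos[OF jk(2,4) xz] Qpos[OF jk(2,4) hz] by (simp add: field_simps)
      then show False using x hz by (auto simp: arg not_less)
    qed
  qed
  ultimately show ?thesis unfolding hexpoint_exp by blast
qed

end
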